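(* Let $R$ be a ring and $B:=R[X_1,\ldots,X_n]$ the polynomial ring in $n$ variables over $R$. Let $\varphi:B\to B$ be an $R$-retraction with image $A$. If $\varphi(X_i)$ is zero or a monomial for all but at most one $i$, then there exists an $R$-module $M$, which is the direct sum of $m$ cyclic projective $R$-modules, for some non-negative integer $m\le n$, such that $A\cong\mathrm{Sym}_R(M)$ as $R$-algebras.
   Context: All rings are commutative with unity. An $R$-retraction $\varphi:B\to B$ is an $R$-algebra homomorphism with $\varphi^2=\varphi$. A monomial of $B$ is a polynomial $\lambda X_1^{a_1}\cdots X_n^{a_n}$ with $0\neq\lambda\in R$ and $a_i$ non-negative integers (nonzero constants are monomials). $\mathrm{Sym}_R(M)$ is the symmetric algebra of $M$ over $R$. *)

theory Defs
  imports "HOL-Algebra.Indexed_Polynomials"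
begin

text \<open>
  Modules and algebras over a commutative ring \<open>R\<close> are those of \<^theory>\<open>HOL-Algebra.Module\<close>
  (locales \<^locale>\<open>module\<close> and \<^locale>\<open>algebra\<close>). The record type of modules extends that of rings;
  for a mere module the fields \<open>mult\<close> and \<open>one\<close> carry no meaning and are left unspecified.
  The zero ring is allowed for \<open>R\<close>.
\<close>

section \<open>Homomorphisms\<close>

definition module_hom ::
    "('a, 'r) ring_scheme \<Rightarrow> ('a, 'b, 'm) module_scheme \<Rightarrow> ('a, 'c, 'n) module_scheme \<Rightarrow> ('b \<Rightarrow> 'c) set"
  where "module_hom R M N =
    {h \<in> carrier M \<rightarrow> carrier N.
       (\<forall>x\<in>carrier M. \<forall>y\<in>carrier M. h (x \<oplus>\<^bsub>M\<^esub> y) = h x \<oplus>\<^bsub>N\<^esub> h y) \<and>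
       (\<forall>r\<in>carrier R. \<forall>x\<in>carrier M. h (r \<odot>\<^bsub>M\<^esub> x) = r \<odot>\<^bsub>N\<^esub> h x)}"

definition module_isomorphic ::
    "('a, 'r) ring_scheme \<Rightarrow> ('a, 'b, 'm) module_scheme \<Rightarrow> ('a, 'c, 'n) module_scheme \<Rightarrow> bool"
  where "module_isomorphic R M N \<longleftrightarrow> (\<exists>h\<in>module_hom R M N. bij_betw h (carrier M) (carrier N))"

definition alg_hom ::
    "('a, 'r) ring_scheme \<Rightarrow> ('a, 'b, 'm) module_scheme \<Rightarrow> ('a, 'c, 'n) module_scheme \<Rightarrow> ('b \<Rightarrow> 'c) set"
  where "alg_hom R A B =
    {h \<in> ring_hom A B. \<forall>r\<in>carrier R. \<forall>x\<in>carrier A. h (r \<odot>\<^bsub>A\<^esub> x) = r \<odot>\<^bsub>B\<^esub> h x}"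

definition alg_isomorphic ::
    "('a, 'r) ring_scheme \<Rightarrow> ('a, 'b, 'm) module_scheme \<Rightarrow> ('a, 'c, 'n) module_scheme \<Rightarrow> bool"
  where "alg_isomorphic R A B \<longleftrightarrow> (\<exists>h\<in>alg_hom R A B. bij_betw h (carrier A) (carrier B))"

definition retraction ::
    "('a, 'r) ring_scheme \<Rightarrow> ('a, 'b, 'm) module_scheme \<Rightarrow> ('b \<Rightarrow> 'b) \<Rightarrow> bool"
  where "retraction R B \<phi> \<longleftrightarrow> \<phi> \<in> alg_hom R B B \<and> (\<forall>x\<in>carrier B. \<phi> (\<phi> x) = \<phi> x)"

definition image_alg :: "('b \<Rightarrow> 'b) \<Rightarrow> ('a, 'b, 'm) module_scheme \<Rightarrow> ('a, 'b, 'm) module_scheme"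
  where "image_alg \<phi> B = B\<lparr>carrier := \<phi> ` carrier B\<rparr>"

section \<open>Polynomial algebras\<close>

text \<open>
  Following \<^theory>\<open>HOL-Algebra.Indexed_Polynomials\<close>, a polynomial in variables indexed by \<open>I\<close> is a
  function from monomials (finite multisets of variables) to coefficients. That theory supplies the
  set of polynomials, the constants, the variables and the addition; the product is the convolution.
\<close>

definition poly_alg :: "('a, 'r) ring_scheme \<Rightarrow> 'v set \<Rightarrow> ('a, 'v multiset \<Rightarrow> 'a) module"
  where "poly_alg R I =
    \<lparr>carrier = ring.indexed_pset R I (carrier R),
     monoid.mult = (\<lambda>P Q m. \<Oplus>\<^bsub>R\<^esub>a\<in>{a. a \<subseteq># m}. P a \<otimes>\<^bsub>R\<^esub> Q (m - a)),
     one = ring.indexed_const R \<one>\<^bsub>R\<^esub>,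
     zero = ring.indexed_const R \<zero>\<^bsub>R\<^esub>,
     add = ring.indexed_padd R,
     smult = (\<lambda>r P m. r \<otimes>\<^bsub>R\<^esub> P m)\<rparr>"

definition is_monomial :: "('a, 'r) ring_scheme \<Rightarrow> 'v set \<Rightarrow> ('v multiset \<Rightarrow> 'a) \<Rightarrow> bool"
  where "is_monomial R I P \<longleftrightarrow>
    (\<exists>c\<in>carrier R - {\<zero>\<^bsub>R\<^esub>}. \<exists>a :: 'v \<Rightarrow> nat.
       P = c \<odot>\<^bsub>poly_alg R I\<^esub>
         (\<Otimes>\<^bsub>poly_alg R I\<^esub>i\<in>I. ring.indexed_var R i [^]\<^bsub>poly_alg R I\<^esub> a i))"

section \<open>Direct sums, free, projective and cyclic modules\<close>

definition direct_sum :: "'i set \<Rightarrow> ('i \<Rightarrow> ('a, 'b, 'm) module_scheme) \<Rightarrow> ('a, 'i \<Rightarrow> 'b) module"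
  where "direct_sum I M =
    \<lparr>carrier = {x \<in> \<Pi>\<^sub>E i\<in>I. carrier (M i). finite {i \<in> I. x i \<noteq> \<zero>\<^bsub>M i\<^esub>}},
     monoid.mult = undefined,
     one = undefined,
     zero = (\<lambda>i\<in>I. \<zero>\<^bsub>M i\<^esub>),
     add = (\<lambda>x y. \<lambda>i\<in>I. x i \<oplus>\<^bsub>M i\<^esub> y i),
     smult = (\<lambda>r x. \<lambda>i\<in>I. r \<odot>\<^bsub>M i\<^esub> x i)\<rparr>"

definition regular_module :: "('a, 'r) ring_scheme \<Rightarrow> ('a, 'a) module"
  where "regular_module R =
    \<lparr>carrier = carrier R, monoid.mult = monoid.mult R, one = one R, zero = zero R,
     add = add R, smult = monoid.mult R\<rparr>"

definition free_module :: "('a, 'r) ring_scheme \<Rightarrow> 'i set \<Rightarrow> ('a, 'i \<Rightarrow> 'a) module"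
  where "free_module R S = direct_sum S (\<lambda>_. regular_module R)"

text \<open>
  Projective: isomorphic to a direct summand of a free module. Taking bases in the element type
  of \<open>P\<close> is no restriction, since if \<open>P\<close> is projective then the canonical surjection
  \<open>R\<^bsup>(P)\<^esup> \<rightarrow> P\<close> splits.
\<close>

definition projective_module :: "('a, 'r) ring_scheme \<Rightarrow> ('a, 'b, 'm) module_scheme \<Rightarrow> bool"
  where "projective_module R P \<longleftrightarrow> module R P \<and>
    (\<exists>(S :: 'b set) N N'. let F = free_module R S in
       submodule N R F \<and> submodule N' R F \<and>
       N <+>\<^bsub>F\<^esub> N' = carrier F \<and> N \<inter> N' = {\<zero>\<^bsub>F\<^esub>} \<and>
       module_isomorphic R P (F\<lparr>carrier := N\<rparr>))"

definition cyclic_module :: "('a, 'r) ring_scheme \<Rightarrow> ('a, 'b, 'm) module_scheme \<Rightarrow> bool"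
  where "cyclic_module R M \<longleftrightarrow> module R M \<and>
    (\<exists>x\<in>carrier M. carrier M = (\<lambda>r. r \<odot>\<^bsub>M\<^esub> x) ` carrier R)"

section \<open>Symmetric algebras\<close>

definition quotient_alg :: "('a, 'b, 'm) module_scheme \<Rightarrow> 'b set \<Rightarrow> ('a, 'b set) module"
  where "quotient_alg A J =
    ring.extend (A Quot J) (module.fields (\<lambda>r C. \<Union>x\<in>C. J +>\<^bsub>A\<^esub> (r \<odot>\<^bsub>A\<^esub> x)))"

text \<open>
  \<open>Sym\<^sub>R(M)\<close> is the commutative \<open>R\<close>-algebra generated by symbols \<open>[x]\<close>, one for each \<open>x \<in> M\<close>, subject
  only to the relations making \<open>x \<mapsto> [x]\<close> an \<open>R\<close>-linear map. The generator \<open>[x]\<close> is the variable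
  with index \<open>x\<close>.
\<close>

definition sym_relations :: "('a, 'r) ring_scheme \<Rightarrow> ('a, 'b, 'm) module_scheme \<Rightarrow> ('b multiset \<Rightarrow> 'a) set"
  where "sym_relations R M = (let T = poly_alg R (carrier M); gen = ring.indexed_var R in
    {gen (x \<oplus>\<^bsub>M\<^esub> y) \<ominus>\<^bsub>T\<^esub> (gen x \<oplus>\<^bsub>T\<^esub> gen y) | x y. x \<in> carrier M \<and> y \<in> carrier M} \<union>
    {gen (r \<odot>\<^bsub>M\<^esub> x) \<ominus>\<^bsub>T\<^esub> (r \<odot>\<^bsub>T\<^esub> gen x) | r x. r \<in> carrier R \<and> x \<in> carrier M})"

definition sym_alg ::
    "('a, 'r) ring_scheme \<Rightarrow> ('a, 'b, 'm) module_scheme \<Rightarrow> ('a, ('b multiset \<Rightarrow> 'a) set) module"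
  where "sym_alg R M = (let T = poly_alg R (carrier M) in
    quotient_alg T (genideal T (sym_relations R M)))"

end

theory Submission
  imports Defs
begin

text \<open>
  Let \<open>f\<^sub>i\<close> be the images of the variables; all but \<open>g = f\<^bsub>i0\<^esub>\<close> are zero or monomials. If \<open>f\<^sub>i\<close> with
  \<open>i \<noteq> i0\<close> does not involve \<open>X\<^sub>i\<close>, then substituting \<open>f\<^sub>i\<close> for \<open>X\<^sub>i\<close> exhibits the image as a retract of a
  polynomial ring in fewer variables, and the hypothesis on monomials persists. Once this is no longer possible,
  comparing coefficients in \<open>f\<^sub>i = f\<^sub>i(f)\<close> forces \<open>f\<^sub>i = \<lambda>\<^sub>i X\<^sub>i Y\<^bsup>b\<^esup>\<close>, where \<open>Y = X\<^bsub>i0\<^esub>\<close> and \<open>\<lambda>\<^sub>i\<close> generates an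
  ideal \<open>\<epsilon>\<^sub>i R\<close> with \<open>\<epsilon>\<^sub>i\<close> idempotent. Setting \<open>X = 0\<close> turns \<open>g\<close> into a retraction of \<open>R[Y]\<close>, so \<open>g(0, Y) = e Y + c\<close>
  with \<open>e\<close> idempotent and \<open>e c = 0\<close>. Then \<open>(1 - e) g\<close> lies in \<open>R[f\<^sub>i | i \<noteq> i0]\<close>, by successive approximation in the
  \<open>X\<close>-adic order, and the elements \<open>f\<^sub>i\<close> and \<open>e g\<close> generate the image. Their lowest order terms in \<open>X\<close> are
  distinct monomials, so the only relations among them come from \<open>\<epsilon>\<^sub>i f\<^sub>i = f\<^sub>i\<close> and \<open>e (e g) = e g\<close>; this is
  a presentation of the symmetric algebra of a direct sum of ideals generated by idempotents.
\<close>

section \<open>Polynomial algebras\<close>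

text \<open>What remains is the order in the variables other than Y: after elimination every
  monomial image has positive order, so modulo positive order g is a polynomial in Y alone, and the
  one-variable case determines that polynomial. The factors Y^b do no harm: the power of Y that they
  add to a product depends only on the exponents of the other variables, so leading monomials cannot
  collide. The idempotent behind \<lambda>_i comes from an equation \<lambda> = \<lambda>^2 \<mu>:
  it is \<lambda> \<mu>. Elimination changes the polynomial ring but must keep the image. Hence the
  induction concerns a fixed algebra C with a family y of elements and a section \<iota> of
  evaluation at y, rather than retractions. An eliminated variable is later readmitted with
  idempotent zero, so exactly n ideals arise, some of them possibly zero.\<close>

definition pmonom :: "('a, 'r) ring_scheme \<Rightarrow> 'a \<Rightarrow> 'v multiset \<Rightarrow> 'v multiset \<Rightarrow> 'a"
  where "pmonom R c m = (\<lambda>m'. if m' = m then c else \<zero>\<^bsub>R\<^esub>)"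

definition mpow :: "('b, 'm) monoid_scheme \<Rightarrow> ('v \<Rightarrow> 'b) \<Rightarrow> 'v multiset \<Rightarrow> 'b"
  where "mpow S y m = (\<Otimes>\<^bsub>S\<^esub>i\<in>set_mset m. y i [^]\<^bsub>S\<^esub> count m i)"

text \<open>No index set appears, so one evaluation serves a polynomial that is regarded in rings
  with different sets of variables.\<close>

definition peval ::
    "('a, 'r) ring_scheme \<Rightarrow> ('a, 'b, 'm) module_scheme \<Rightarrow> ('v \<Rightarrow> 'b) \<Rightarrow> ('v multiset \<Rightarrow> 'a) \<Rightarrow> 'b"
  where "peval R S y P = (\<Oplus>\<^bsub>S\<^esub>m\<in>{m. P m \<noteq> \<zero>\<^bsub>R\<^esub>}. P m \<odot>\<^bsub>S\<^esub> mpow S y m)"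

lemma finite_submsets: "finite {a. a \<subseteq># m}"
proof (induction m)
  case empty
  then show ?case by simp
next
  case (add x m)
  have "{a. a \<subseteq># add_mset x m} \<subseteq> {a. a \<subseteq># m} \<union> add_mset x ` {a. a \<subseteq># m}"
  proof
    fix a
    assume a: "a \<in> {a. a \<subseteq># add_mset x m}"
    show "a \<in> {a. a \<subseteq># m} \<union> add_mset x ` {a. a \<subseteq># m}"
    proof (cases "x \<in># a")
      case True
      then obtain b where "a = add_mset x b" by (meson multi_member_split)
      then show ?thesis using a by auto
    next
      case False
      have "count a j \<le> count m j" for j
        using a mset_subset_eq_count[of a "add_mset x m" j] False
        by (cases "j = x") (auto simp: not_in_iff)
      then show ?thesis by (auto intro: mset_subset_eqI)
    qed
  qed
  then show ?case using add.IH by (meson finite_UnI finite_imageI finite_subset)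
qed

lemma mset_diff_diff: "a \<subseteq># m \<Longrightarrow> m - (m - a) = a"
  using mset_subset_eq_count[of a m] by (intro multiset_eqI) simp

lemma (in comm_monoid) mpow_empty [simp]: "mpow G y {#} = \<one>"
  by (simp add: mpow_def)

lemma (in comm_monoid) mpow_closed [simp, intro]:
  assumes "\<And>i. i \<in># m \<Longrightarrow> y i \<in> carrier G"
  shows "mpow G y m \<in> carrier G"
  unfolding mpow_def using assms by (intro finprod_closed) auto

lemma (in comm_monoid) mpow_cong:
  assumes "\<And>i. i \<in># m \<Longrightarrow> y i = y' i" and "\<And>i. i \<in># m \<Longrightarrow> y' i \<in> carrier G"
  shows "mpow G y m = mpow G y' m"
  unfolding mpow_def using assms by (intro finprod_cong) (auto simp: simp_implies_def)

lemma (in comm_monoid) mpow_add_mset: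
  assumes y: "\<And>i. i \<in># add_mset j m \<Longrightarrow> y i \<in> carrier G"
  shows "mpow G y (add_mset j m) = y j \<otimes> mpow G y m"
proof -
  define A where "A = set_mset m - {j}"
  have yj: "y j \<in> carrier G" and fA: "finite A" "j \<notin> A" and yA: "\<And>i. i \<in> A \<Longrightarrow> y i \<in> carrier G"
    using y by (auto simp: A_def)
  have c: "(\<Otimes>i\<in>A. y i [^] count (add_mset j m) i) = (\<Otimes>i\<in>A. y i [^] count m i)"
    using yA fA by (intro finprod_cong) (auto simp: simp_implies_def)
  have "mpow G y (add_mset j m) = (\<Otimes>i\<in>insert j A. y i [^] count (add_mset j m) i)"
    by (simp add: mpow_def A_def)
  also have "\<dots> = y j [^] Suc (count m j) \<otimes> (\<Otimes>i\<in>A. y i [^] count m i)"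
    using fA yj yA by (subst finprod_insert) (simp_all only: c, auto)
  also have "\<dots> = y j \<otimes> (y j [^] count m j \<otimes> (\<Otimes>i\<in>A. y i [^] count m i))"
    using fA yj yA by (simp add: m_comm m_lcomm m_assoc)
  also have "y j [^] count m j \<otimes> (\<Otimes>i\<in>A. y i [^] count m i) = mpow G y m"
  proof (cases "j \<in># m")
    case True
    then have "set_mset m = insert j A" by (auto simp: A_def)
    then show ?thesis using fA yj yA unfolding mpow_def by (auto simp: finprod_insert)
  next
    case False
    then have "set_mset m = A" by (auto simp: A_def)
    moreover have "count m j = 0" using False by (simp add: not_in_iff)
    ultimately show ?thesis using yj yA unfolding mpow_def by simp
  qed
  finally show ?thesis .
qed

section \<open>Convolution makes the finitely supported coefficient functions a commutative
  algebra\<close>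

context cring
begin

lemma pa_zero: "\<zero>\<^bsub>poly_alg R I\<^esub> = (\<lambda>_. \<zero>)"
  by (simp add: poly_alg_def indexed_zero_def)

lemma pa_one: "\<one>\<^bsub>poly_alg R I\<^esub> = pmonom R \<one> {#}"
  by (simp add: poly_alg_def indexed_const_def pmonom_def)

lemma pa_add: "P \<oplus>\<^bsub>poly_alg R I\<^esub> Q = (\<lambda>m. P m \<oplus> Q m)"
  by (simp add: poly_alg_def indexed_padd_def)

lemma pa_mult: "P \<otimes>\<^bsub>poly_alg R I\<^esub> Q = (\<lambda>m. \<Oplus>a\<in>{a. a \<subseteq># m}. P a \<otimes> Q (m - a))"
  by (simp add: poly_alg_def)

lemma pa_smult: "r \<odot>\<^bsub>poly_alg R I\<^esub> P = (\<lambda>m. r \<otimes> P m)"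
  by (simp add: poly_alg_def)

lemma indexed_const_pmonom: "indexed_const k = pmonom R k {#}"
  by (simp add: indexed_const_def pmonom_def)

lemma indexed_var_pmonom: "indexed_var i = pmonom R \<one> {#i#}"
  unfolding indexed_var_def indexed_pmult_def indexed_const_def pmonom_def
  by (rule ext) (auto simp: multi_member_split dest: multi_member_split)

lemma pa_carrier_induct [consumes 1, case_names const add pmult]:
  assumes "P \<in> carrier (poly_alg R I)"
    and "\<And>k. k \<in> carrier R \<Longrightarrow> Q (indexed_const k)"
    and "\<And>P P'. P \<in> carrier (poly_alg R I) \<Longrightarrow> P' \<in> carrier (poly_alg R I) \<Longrightarrow> Q P \<Longrightarrow> Q P'
           \<Longrightarrow> Q (P \<oplus>\<^bsub>poly_alg R I\<^esub> P')"
    and "\<And>P i. P \<in> carrier (poly_alg R I) \<Longrightarrow> i \<in> I \<Longrightarrow> Q P \<Longrightarrow> Q (indexed_pmult P i)"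
  shows "Q P"
proof -
  have "P \<in> indexed_pset I (carrier R)" using assms(1) by (simp add: poly_alg_def)
  then show ?thesis
    by (induction P rule: indexed_pset.induct)
      (use assms(2-) in \<open>simp_all add: poly_alg_def\<close>)
qed

lemma pa_const_closed: "k \<in> carrier R \<Longrightarrow> indexed_const k \<in> carrier (poly_alg R I)"
  and pa_add_closed: "P \<in> carrier (poly_alg R I) \<Longrightarrow> Q \<in> carrier (poly_alg R I) \<Longrightarrow>
         P \<oplus>\<^bsub>poly_alg R I\<^esub> Q \<in> carrier (poly_alg R I)"
  and pa_pmult_closed: "P \<in> carrier (poly_alg R I) \<Longrightarrow> i \<in> I \<Longrightarrow>
         indexed_pmult P i \<in> carrier (poly_alg R I)"
  by (auto simp: poly_alg_def intro: indexed_pset.intros)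

lemma pa_carrierD:
  assumes "P \<in> carrier (poly_alg R I)"
  shows "P m \<in> carrier R" "finite {m. P m \<noteq> \<zero>}" "P m \<noteq> \<zero> \<Longrightarrow> set_mset m \<subseteq> I"
proof -
  have "(\<forall>m. P m \<in> carrier R) \<and> finite {m. P m \<noteq> \<zero>} \<and> (\<forall>m. P m \<noteq> \<zero> \<longrightarrow> set_mset m \<subseteq> I)"
    using assms
  proof (induction rule: pa_carrier_induct)
    case (const k)
    have "{m. indexed_const k m \<noteq> \<zero>} \<subseteq> {{#}}" by (auto simp: indexed_const_def)
    from finite_subset[OF this] const show ?case
      by (auto simp: indexed_const_def)
  next
    case (add P P')
    have "{m. (P \<oplus>\<^bsub>poly_alg R I\<^esub> P') m \<noteq> \<zero>} \<subseteq> {m. P m \<noteq> \<zero>} \<union> {m. P' m \<noteq> \<zero>}"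
      by (auto simp: pa_add)
    then have "finite {m. (P \<oplus>\<^bsub>poly_alg R I\<^esub> P') m \<noteq> \<zero>}"
      using add by (meson finite_UnI finite_subset)
    moreover have "set_mset m \<subseteq> I" if "(P \<oplus>\<^bsub>poly_alg R I\<^esub> P') m \<noteq> \<zero>" for m
    proof -
      have "P m \<noteq> \<zero> \<or> P' m \<noteq> \<zero>" using that by (auto simp: pa_add)
      then show ?thesis using add by blast
    qed
    ultimately show ?case using add by (auto simp: pa_add)
  next
    case (pmult P i)
    have "{m. indexed_pmult P i m \<noteq> \<zero>} \<subseteq> add_mset i ` {m. P m \<noteq> \<zero>}"
      by (auto simp: indexed_pmult_def image_iff split: if_splits intro!: exI[of _ "_ - {#i#}"])
    then have "finite {m. indexed_pmult P i m \<noteq> \<zero>}"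
      using pmult by (meson finite_imageI finite_subset)
    moreover have "set_mset m \<subseteq> I" if nz: "indexed_pmult P i m \<noteq> \<zero>" for m
    proof -
      have "i \<in># m" "P (m - {#i#}) \<noteq> \<zero>" using nz by (auto simp: indexed_pmult_def split: if_splits)
      then obtain m' where "m = add_mset i m'" "P m' \<noteq> \<zero>" by (auto dest: multi_member_split)
      then show ?thesis using pmult by auto
    qed
    ultimately show ?case using pmult by (auto simp: indexed_pmult_def)
  qed
  then show "P m \<in> carrier R" "finite {m. P m \<noteq> \<zero>}" "P m \<noteq> \<zero> \<Longrightarrow> set_mset m \<subseteq> I"
    by blast+
qed

lemma pmonom_closed [intro]:
  assumes "c \<in> carrier R" and "set_mset m \<subseteq> I"
  shows "pmonom R c m \<in> carrier (poly_alg R I)"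
  using assms(2)
proof (induction m)
  case empty
  then show ?case using pa_const_closed[OF assms(1)] by (simp add: indexed_const_pmonom)
next
  case (add i m)
  have "pmonom R c (add_mset i m) = indexed_pmult (pmonom R c m) i"
    by (rule ext) (auto simp: pmonom_def indexed_pmult_def dest: multi_member_split)
  then show ?case using add by (auto intro: pa_pmult_closed)
qed

text \<open>The monomials that are split off are those of \<open>P\<close> itself, with their
  coefficients in \<open>P\<close>. Facts about the support of \<open>P\<close> thus remain usable
  in the induction step.\<close>

lemma pa_induct [consumes 1, case_names zero add]:
  assumes P: "P \<in> carrier (poly_alg R I)"
    and zero: "Q (\<lambda>_. \<zero>)"
    and add: "\<And>m P'. P m \<noteq> \<zero> \<Longrightarrow> P' \<in> carrier (poly_alg R I) \<Longrightarrow> Q P' \<Longrightarrow>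
       Q (pmonom R (P m) m \<oplus>\<^bsub>poly_alg R I\<^esub> P')"
  shows "Q P"
proof -
  define part where "part A = (\<lambda>m. if m \<in> A then P m else \<zero>)" for A
  note PD = pa_carrierD[OF P]
  have "part A \<in> carrier (poly_alg R I) \<and> Q (part A)" if "finite A" "A \<subseteq> {m. P m \<noteq> \<zero>}" for A
    using that
  proof (induction A rule: finite_induct)
    case empty
    have "part {} = pmonom R \<zero> {#}" by (auto simp: part_def pmonom_def)
    then show ?case using zero by (auto simp: part_def)
  next
    case (insert m A)
    have eq: "part (insert m A) = pmonom R (P m) m \<oplus>\<^bsub>poly_alg R I\<^esub> part A"
      using insert.hyps PD(1) by (auto simp: part_def pmonom_def pa_add fun_eq_iff)
    show ?case unfolding eq using insert PD by (auto intro!: add pa_add_closed)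
  qed
  from this[OF PD(2)] have "Q (part {m. P m \<noteq> \<zero>})" by blast
  moreover have "part {m. P m \<noteq> \<zero>} = P" by (auto simp: part_def)
  ultimately show ?thesis by simp
qed

lemma pa_carrierI:
  assumes "\<And>m. P m \<in> carrier R" and "finite {m. P m \<noteq> \<zero>}" and "\<And>m. P m \<noteq> \<zero> \<Longrightarrow> set_mset m \<subseteq> I"
  shows "P \<in> carrier (poly_alg R I)"
proof -
  define part where "part A = (\<lambda>m. if m \<in> A then P m else \<zero>)" for A
  have "part A \<in> carrier (poly_alg R I)" if "finite A" "A \<subseteq> {m. P m \<noteq> \<zero>}" for A
    using that
  proof (induction A rule: finite_induct)
    case empty
    have "part {} = pmonom R \<zero> {#}" by (auto simp: part_def pmonom_def)
    then show ?case by auto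
  next
    case (insert m A)
    have "part (insert m A) = pmonom R (P m) m \<oplus>\<^bsub>poly_alg R I\<^esub> part A"
      using insert.hyps assms(1) by (auto simp: part_def pmonom_def pa_add fun_eq_iff)
    then show ?case using insert assms by (auto intro!: pa_add_closed)
  qed
  from this[OF assms(2)] have "part {m. P m \<noteq> \<zero>} \<in> carrier (poly_alg R I)" by blast
  moreover have "part {m. P m \<noteq> \<zero>} = P" by (auto simp: part_def)
  ultimately show ?thesis by simp
qed

lemma pa_mono: "P \<in> carrier (poly_alg R I) \<Longrightarrow> I \<subseteq> J \<Longrightarrow> P \<in> carrier (poly_alg R J)"
  by (rule pa_carrierI) (auto dest: pa_carrierD)

text \<open>With \<open>pa_mult_const\<close> and \<open>pa_mult_add\<close> this allows induction
  on the second factor, so that closure and associativity of the product need no double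
  sums.\<close>

lemma pa_mult_pmult:
  assumes "\<And>m. P m \<in> carrier R" "\<And>m. Q m \<in> carrier R"
  shows "P \<otimes>\<^bsub>poly_alg R I\<^esub> indexed_pmult Q i = indexed_pmult (P \<otimes>\<^bsub>poly_alg R I\<^esub> Q) i"
proof
  fix m
  show "(P \<otimes>\<^bsub>poly_alg R I\<^esub> indexed_pmult Q i) m = indexed_pmult (P \<otimes>\<^bsub>poly_alg R I\<^esub> Q) i m"
  proof (cases "i \<in># m")
    case True
    then obtain k where k: "m = add_mset i k" by (auto dest: multi_member_split)
    \<comment> \<open>Splittings of \<open>m\<close> whose second part lacks \<open>i\<close>
      contribute zero; the others are the splittings of \<open>k\<close> with \<open>i\<close> added
      to the second part.\<close>
    have "(\<Oplus>a\<in>{a. a \<subseteq># m}. P a \<otimes> indexed_pmult Q i (m - a))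
        = (\<Oplus>a\<in>{a. a \<subseteq># k}. P a \<otimes> Q (k - a))"
    proof (rule add.finprod_mono_neutral_cong_right, rule finite_submsets)
      show "{a. a \<subseteq># k} \<subseteq> {a. a \<subseteq># m}" using k subset_mset.order_trans by fastforce
      fix a
      assume "a \<in> {a. a \<subseteq># m} - {a. a \<subseteq># k}"
      then have "a \<subseteq># add_mset i k" "\<not> a \<subseteq># k" using k by auto
      have "i \<notin># m - a"
      proof
        assume "i \<in># m - a"
        then have "count a i \<le> count k i" by (simp add: k in_diff_count)
        moreover have "count a j \<le> count k j" if "j \<noteq> i" for j
          using mset_subset_eq_count[OF \<open>a \<subseteq># add_mset i k\<close>, of j] that by simp
        ultimately have "a \<subseteq># k" by (metis mset_subset_eqI)
        with \<open>\<not> a \<subseteq># k\<close> show False ..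
      qed
      then show "P a \<otimes> indexed_pmult Q i (m - a) = \<zero>"
        using assms by (simp add: indexed_pmult_def)
    next
      fix a
      assume "a \<in> {a. a \<subseteq># k}"
      then have "m - a = add_mset i (k - a)" unfolding k
        using multiset_diff_union_assoc[of a k "{#i#}"] by simp
      then show "P a \<otimes> indexed_pmult Q i (m - a) = P a \<otimes> Q (k - a)"
        by (simp add: indexed_pmult_def)
    qed (use assms in \<open>auto simp: indexed_pmult_def\<close>)
    then show ?thesis by (simp add: pa_mult indexed_pmult_def k)
  next
    case False
    have "(\<Oplus>a\<in>{a. a \<subseteq># m}. P a \<otimes> indexed_pmult Q i (m - a)) = \<zero>"
      using False assms by (intro add.finprod_one_eqI) (auto simp: indexed_pmult_def dest: in_diffD)
    then show ?thesis using False by (simp add: pa_mult indexed_pmult_def)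
  qed
qed

lemma pa_mult_const:
  assumes "\<And>m. P m \<in> carrier R" and "k \<in> carrier R"
  shows "P \<otimes>\<^bsub>poly_alg R I\<^esub> indexed_const k = (\<lambda>m. k \<otimes> P m)"
proof
  fix m
  have "(\<Oplus>a\<in>{a. a \<subseteq># m}. P a \<otimes> indexed_const k (m - a))
      = (\<Oplus>a\<in>{a. a \<subseteq># m}. if m = a then k \<otimes> P a else \<zero>)"
    using assms by (intro add.finprod_cong')
      (auto simp: indexed_const_def m_comm Diff_eq_empty_iff_mset subset_mset.order_antisym)
  also have "\<dots> = k \<otimes> P m"
    using assms by (intro add.finprod_singleton) (auto simp: finite_submsets)
  finally show "(P \<otimes>\<^bsub>poly_alg R I\<^esub> indexed_const k) m = k \<otimes> P m" by (simp add: pa_mult)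
qed

lemma pa_mult_add:
  assumes "\<And>m. P m \<in> carrier R" "\<And>m. Q m \<in> carrier R" "\<And>m. Q' m \<in> carrier R"
  shows "P \<otimes>\<^bsub>poly_alg R I\<^esub> (Q \<oplus>\<^bsub>poly_alg R I\<^esub> Q')
       = (P \<otimes>\<^bsub>poly_alg R I\<^esub> Q) \<oplus>\<^bsub>poly_alg R I\<^esub> (P \<otimes>\<^bsub>poly_alg R I\<^esub> Q')"
  using assms by (auto simp: pa_mult pa_add r_distr fun_eq_iff intro!: add.finprod_multf)

text \<open>Complementation \<open>a \<mapsto> m - a\<close> is an involution on the submultisets of
  \<open>m\<close>, and it exchanges the two factors.\<close>

lemma pa_mult_comm:
  fixes P Q :: "'v multiset \<Rightarrow> 'a"
  assumes "\<And>m. P m \<in> carrier R" "\<And>m. Q m \<in> carrier R"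
  shows "P \<otimes>\<^bsub>poly_alg R I\<^esub> Q = Q \<otimes>\<^bsub>poly_alg R I\<^esub> P"
proof
  fix m :: "'v multiset"
  let ?A = "{a. a \<subseteq># m}"
  have img: "(\<lambda>a. m - a) ` ?A = ?A"
  proof
    show "?A \<subseteq> (\<lambda>a. m - a) ` ?A"
    proof
      fix a
      assume "a \<in> ?A"
      then show "a \<in> (\<lambda>a. m - a) ` ?A"
        by (intro image_eqI[of _ _ "m - a"]) (auto simp: mset_diff_diff)
    qed
  qed auto
  have inj: "inj_on (\<lambda>a. m - a) ?A"
    by (rule inj_on_inverseI[of _ "\<lambda>a. m - a"]) (auto simp: mset_diff_diff)
  have "(\<Oplus>a\<in>?A. P a \<otimes> Q (m - a)) = (\<Oplus>a\<in>(\<lambda>a. m - a) ` ?A. P a \<otimes> Q (m - a))"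
    by (simp only: img)
  also have "\<dots> = (\<Oplus>a\<in>?A. P (m - a) \<otimes> Q (m - (m - a)))"
    using assms inj by (intro finsum_reindex) auto
  also have "\<dots> = (\<Oplus>a\<in>?A. Q a \<otimes> P (m - a))"
    using assms by (intro add.finprod_cong') (auto simp: m_comm mset_diff_diff)
  finally show "(P \<otimes>\<^bsub>poly_alg R I\<^esub> Q) m = (Q \<otimes>\<^bsub>poly_alg R I\<^esub> P) m" by (simp add: pa_mult)
qed

lemma pa_smult_closed:
  "r \<in> carrier R \<Longrightarrow> P \<in> carrier (poly_alg R I) \<Longrightarrow> r \<odot>\<^bsub>poly_alg R I\<^esub> P \<in> carrier (poly_alg R I)"
proof (rule pa_carrierI)
  assume *: "r \<in> carrier R" "P \<in> carrier (poly_alg R I)"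
  have "{m. r \<otimes> P m \<noteq> \<zero>} \<subseteq> {m. P m \<noteq> \<zero>}" using * by auto
  from finite_subset[OF this pa_carrierD(2)[OF *(2)]]
  show "finite {m. (r \<odot>\<^bsub>poly_alg R I\<^esub> P) m \<noteq> \<zero>}" by (simp add: pa_smult)
  fix m
  show "(r \<odot>\<^bsub>poly_alg R I\<^esub> P) m \<in> carrier R" using * by (simp add: pa_smult pa_carrierD(1))
  assume "(r \<odot>\<^bsub>poly_alg R I\<^esub> P) m \<noteq> \<zero>"
  then have "P m \<noteq> \<zero>" using * by (auto simp: pa_smult)
  then show "set_mset m \<subseteq> I" by (rule pa_carrierD(3)[OF *(2)])
qed

lemma pa_mult_closed:
  assumes P: "P \<in> carrier (poly_alg R I)" and Q: "Q \<in> carrier (poly_alg R I)"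
  shows "P \<otimes>\<^bsub>poly_alg R I\<^esub> Q \<in> carrier (poly_alg R I)"
  using Q
proof (induction rule: pa_carrier_induct)
  case (const k)
  then show ?case using P pa_smult_closed[OF const P] pa_carrierD(1)[OF P]
    by (simp add: pa_mult_const pa_smult)
next
  case (add Q Q')
  then show ?case using pa_carrierD(1)[OF P] by (auto simp: pa_mult_add pa_carrierD(1) intro: pa_add_closed)
next
  case (pmult Q i)
  then show ?case using P by (auto simp: pa_mult_pmult pa_carrierD(1) intro: pa_pmult_closed)
qed

lemma pa_mult_assoc:
  assumes P: "P \<in> carrier (poly_alg R I)" and Q: "Q \<in> carrier (poly_alg R I)"
    and S: "S \<in> carrier (poly_alg R I)"
  shows "(P \<otimes>\<^bsub>poly_alg R I\<^esub> Q) \<otimes>\<^bsub>poly_alg R I\<^esub> S = P \<otimes>\<^bsub>poly_alg R I\<^esub> (Q \<otimes>\<^bsub>poly_alg R I\<^esub> S)"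
proof -
  have c: "\<And>m. P m \<in> carrier R" "\<And>m. Q m \<in> carrier R"
    "\<And>m. (P \<otimes>\<^bsub>poly_alg R I\<^esub> Q) m \<in> carrier R"
    using pa_carrierD(1) P Q pa_mult_closed by blast+
  show ?thesis using S
  proof (induction rule: pa_carrier_induct)
    case (const k)
    have "P \<otimes>\<^bsub>poly_alg R I\<^esub> (\<lambda>m. k \<otimes> Q m) = (\<lambda>m. k \<otimes> (P \<otimes>\<^bsub>poly_alg R I\<^esub> Q) m)"
      using c const
      by (auto simp: pa_mult fun_eq_iff finsum_rdistr finite_submsets m_lcomm intro!: add.finprod_cong')
    then show ?case using c const by (simp add: pa_mult_const)
  next
    case (add S S')
    then show ?case using c by (simp add: pa_mult_add pa_carrierD(1) pa_mult_closed Q P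
          pa_mult_closed[THEN pa_carrierD(1)])
  next
    case (pmult S i)
    then show ?case using c
      by (simp add: pa_mult_pmult pa_carrierD(1) pa_mult_closed[OF Q, THEN pa_carrierD(1)])
  qed
qed

lemma pa_algebra: "algebra R (poly_alg R I)"
proof (rule algebraI)
  note D = pa_carrierD(1)
  show "cring R" by (rule is_cring)
  show "cring (poly_alg R I)"
  proof (rule cringI)
    show "abelian_group (poly_alg R I)"
    proof (rule abelian_groupI)
      show "\<zero>\<^bsub>poly_alg R I\<^esub> \<in> carrier (poly_alg R I)"
        by (rule pa_carrierI) (auto simp: pa_zero)
      fix P
      assume P: "P \<in> carrier (poly_alg R I)"
      have "(\<lambda>m. \<ominus> P m) \<in> carrier (poly_alg R I)"
        using pa_smult_closed[of "\<ominus> \<one>", OF _ P] D[OF P] by (simp add: pa_smult l_minus)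
      moreover have "(\<lambda>m. \<ominus> P m) \<oplus>\<^bsub>poly_alg R I\<^esub> P = \<zero>\<^bsub>poly_alg R I\<^esub>"
        using D[OF P] by (simp add: pa_add pa_zero l_neg)
      ultimately show "\<exists>y\<in>carrier (poly_alg R I). y \<oplus>\<^bsub>poly_alg R I\<^esub> P = \<zero>\<^bsub>poly_alg R I\<^esub>" by blast
    qed (simp_all add: pa_add_closed, auto simp: pa_add pa_zero a_assoc D fun_eq_iff intro: a_comm)
    show "comm_monoid (poly_alg R I)"
    proof (rule comm_monoidI)
      fix P
      assume P: "P \<in> carrier (poly_alg R I)"
      show "\<one>\<^bsub>poly_alg R I\<^esub> \<otimes>\<^bsub>poly_alg R I\<^esub> P = P"
        using pa_mult_const[of P "\<one>" I] D[OF P] pa_mult_comm[of "\<one>\<^bsub>poly_alg R I\<^esub>" P I]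
        by (simp add: pa_one indexed_const_pmonom) (simp add: pmonom_def)
    qed (auto simp: pa_mult_assoc pa_one D intro: pa_mult_closed pa_mult_comm)
    fix P Q S
    assume *: "P \<in> carrier (poly_alg R I)" "Q \<in> carrier (poly_alg R I)" "S \<in> carrier (poly_alg R I)"
    have "(P \<oplus>\<^bsub>poly_alg R I\<^esub> Q) \<otimes>\<^bsub>poly_alg R I\<^esub> S = S \<otimes>\<^bsub>poly_alg R I\<^esub> (P \<oplus>\<^bsub>poly_alg R I\<^esub> Q)"
      using * by (intro pa_mult_comm) (auto intro: D pa_add_closed)
    also have "\<dots> = S \<otimes>\<^bsub>poly_alg R I\<^esub> P \<oplus>\<^bsub>poly_alg R I\<^esub> S \<otimes>\<^bsub>poly_alg R I\<^esub> Q"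
      using * by (simp add: pa_mult_add D)
    also have "S \<otimes>\<^bsub>poly_alg R I\<^esub> P = P \<otimes>\<^bsub>poly_alg R I\<^esub> S" using * by (simp add: pa_mult_comm D)
    also have "S \<otimes>\<^bsub>poly_alg R I\<^esub> Q = Q \<otimes>\<^bsub>poly_alg R I\<^esub> S" using * by (simp add: pa_mult_comm D)
    finally show "(P \<oplus>\<^bsub>poly_alg R I\<^esub> Q) \<otimes>\<^bsub>poly_alg R I\<^esub> S
        = P \<otimes>\<^bsub>poly_alg R I\<^esub> S \<oplus>\<^bsub>poly_alg R I\<^esub> Q \<otimes>\<^bsub>poly_alg R I\<^esub> S" .
  qed
  show "(a \<odot>\<^bsub>poly_alg R I\<^esub> P) \<otimes>\<^bsub>poly_alg R I\<^esub> Q = a \<odot>\<^bsub>poly_alg R I\<^esub> (P \<otimes>\<^bsub>poly_alg R I\<^esub> Q)"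
    if "a \<in> carrier R" "P \<in> carrier (poly_alg R I)" "Q \<in> carrier (poly_alg R I)" for a P Q
    using that D[OF that(2)] D[OF that(3)]
    by (auto simp: pa_mult pa_smult fun_eq_iff finsum_rdistr finite_submsets m_assoc intro!: add.finprod_cong')
qed (auto simp: pa_smult pa_add l_distr r_distr m_assoc pa_carrierD(1) intro: pa_smult_closed [unfolded pa_smult])

end

section \<open>Evaluation of polynomials\<close>

lemma alg_homD:
  assumes "h \<in> alg_hom R A B"
  shows "x \<in> carrier A \<Longrightarrow> h x \<in> carrier B"
    and "x \<in> carrier A \<Longrightarrow> y \<in> carrier A \<Longrightarrow> h (x \<oplus>\<^bsub>A\<^esub> y) = h x \<oplus>\<^bsub>B\<^esub> h y"
    and "x \<in> carrier A \<Longrightarrow> y \<in> carrier A \<Longrightarrow> h (x \<otimes>\<^bsub>A\<^esub> y) = h x \<otimes>\<^bsub>B\<^esub> h y"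
    and "h \<one>\<^bsub>A\<^esub> = \<one>\<^bsub>B\<^esub>"
    and "r \<in> carrier R \<Longrightarrow> x \<in> carrier A \<Longrightarrow> h (r \<odot>\<^bsub>A\<^esub> x) = r \<odot>\<^bsub>B\<^esub> h x"
  using assms by (auto simp: alg_hom_def ring_hom_def)

lemma alg_homI:
  assumes "\<And>x. x \<in> carrier A \<Longrightarrow> h x \<in> carrier B"
    and "\<And>x y. x \<in> carrier A \<Longrightarrow> y \<in> carrier A \<Longrightarrow> h (x \<oplus>\<^bsub>A\<^esub> y) = h x \<oplus>\<^bsub>B\<^esub> h y"
    and "\<And>x y. x \<in> carrier A \<Longrightarrow> y \<in> carrier A \<Longrightarrow> h (x \<otimes>\<^bsub>A\<^esub> y) = h x \<otimes>\<^bsub>B\<^esub> h y"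
    and "h \<one>\<^bsub>A\<^esub> = \<one>\<^bsub>B\<^esub>"
    and "\<And>r x. r \<in> carrier R \<Longrightarrow> x \<in> carrier A \<Longrightarrow> h (r \<odot>\<^bsub>A\<^esub> x) = r \<odot>\<^bsub>B\<^esub> h x"
  shows "h \<in> alg_hom R A B"
  using assms by (auto simp: alg_hom_def ring_hom_def)

lemma alg_hom_comp:
  assumes "h \<in> alg_hom R A B" and "k \<in> alg_hom R B C"
  shows "(\<lambda>x. k (h x)) \<in> alg_hom R A C"
  by (rule alg_homI) (simp_all add: alg_homD[OF assms(1)] alg_homD[OF assms(2)])

text \<open>Unlike \<^locale>\<open>algebra\<close>, this locale qualifies the facts of both rings.\<close>

locale alg = R: cring R + S: cring S
  for R :: "('a, 'r) ring_scheme" (structure) and S :: "('a, 'b, 'm) module_scheme" +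
  assumes algebra: "algebra R S"
begin

lemmas smult_closed [simp, intro] = module.smult_closed[OF algebra.axioms(1)[OF algebra]]
  and smult_l_distr = module.smult_l_distr[OF algebra.axioms(1)[OF algebra]]
  and smult_r_distr = module.smult_r_distr[OF algebra.axioms(1)[OF algebra]]
  and smult_assoc1 = module.smult_assoc1[OF algebra.axioms(1)[OF algebra]]
  and smult_one [simp] = module.smult_one[OF algebra.axioms(1)[OF algebra]]
  and smult_l_null [simp] = module.smult_l_null[OF algebra.axioms(1)[OF algebra]]
  and smult_r_null [simp] = module.smult_r_null[OF algebra.axioms(1)[OF algebra]]
  and smult_r_minus = module.smult_r_minus[OF algebra.axioms(1)[OF algebra]]
  and finsum_smult_ldistr = module.finsum_smult_ldistr[OF algebra.axioms(1)[OF algebra]]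
  and smult_assoc2 = algebra.smult_assoc2[OF algebra]

lemma smult_assoc2_right:
  "r \<in> carrier R \<Longrightarrow> x \<in> carrier S \<Longrightarrow> y \<in> carrier S \<Longrightarrow>
   x \<otimes>\<^bsub>S\<^esub> (r \<odot>\<^bsub>S\<^esub> y) = r \<odot>\<^bsub>S\<^esub> (x \<otimes>\<^bsub>S\<^esub> y)"
  by (metis S.m_comm smult_assoc2 smult_closed)

text \<open>Enlarging the support to any finite \<open>A\<close> lets the values of several
  polynomials be written as sums over the same index set.\<close>

lemma peval_eq_finsum:
  assumes P: "P \<in> carrier (poly_alg R I)" and y: "y \<in> I \<rightarrow> carrier S"
    and A: "finite A" "{m. P m \<noteq> \<zero>} \<subseteq> A" "\<And>m. m \<in> A \<Longrightarrow> set_mset m \<subseteq> I"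
  shows "peval R S y P = (\<Oplus>\<^bsub>S\<^esub>m\<in>A. P m \<odot>\<^bsub>S\<^esub> mpow S y m)"
  unfolding peval_def
  by (rule S.add.finprod_mono_neutral_cong_left)
    (use assms R.pa_carrierD[OF P] in \<open>auto intro!: smult_closed smult_l_null S.mpow_closed\<close>)

lemma peval_closed [intro]:
  assumes P: "P \<in> carrier (poly_alg R I)" and y: "y \<in> I \<rightarrow> carrier S"
  shows "peval R S y P \<in> carrier S"
  unfolding peval_def
  by (rule S.add.finprod_closed)
    (use y R.pa_carrierD[OF P] in \<open>auto intro!: smult_closed S.mpow_closed\<close>)

lemma peval_zero [simp]: "peval R S y (\<lambda>_. \<zero>) = \<zero>\<^bsub>S\<^esub>"
  by (simp add: peval_def)

lemma peval_pmonom: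
  assumes c: "c \<in> carrier R" and y: "\<And>i. i \<in># m \<Longrightarrow> y i \<in> carrier S"
  shows "peval R S y (pmonom R c m) = c \<odot>\<^bsub>S\<^esub> mpow S y m"
proof -
  have "peval R S y (pmonom R c m) = (\<Oplus>\<^bsub>S\<^esub>m'\<in>{m}. pmonom R c m m' \<odot>\<^bsub>S\<^esub> mpow S y m')"
    using assms by (intro peval_eq_finsum[of _ "set_mset m"]) (auto simp: pmonom_def intro: R.pmonom_closed[unfolded pmonom_def])
  then show ?thesis using assms by (simp add: pmonom_def)
qed

lemma peval_const: "c \<in> carrier R \<Longrightarrow> peval R S y (R.indexed_const c) = c \<odot>\<^bsub>S\<^esub> \<one>\<^bsub>S\<^esub>"
  using peval_pmonom[of c "{#}" y] by (simp add: R.indexed_const_pmonom)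

lemma peval_var: "y i \<in> carrier S \<Longrightarrow> peval R S y (R.indexed_var i) = y i"
  using S.mpow_add_mset[of i "{#}" y] peval_pmonom[of \<one> "{#i#}" y] by (simp add: R.indexed_var_pmonom)

lemma peval_add:
  assumes P: "P \<in> carrier (poly_alg R I)" and Q: "Q \<in> carrier (poly_alg R I)"
    and y: "y \<in> I \<rightarrow> carrier S"
  shows "peval R S y (P \<oplus>\<^bsub>poly_alg R I\<^esub> Q) = peval R S y P \<oplus>\<^bsub>S\<^esub> peval R S y Q"
proof -
  define A where "A = {m. P m \<noteq> \<zero>} \<union> {m. Q m \<noteq> \<zero>}"
  note D = R.pa_carrierD[OF P] R.pa_carrierD[OF Q]
  have A: "finite A" "\<And>m. m \<in> A \<Longrightarrow> set_mset m \<subseteq> I" using D unfolding A_def by blast+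
  have m: "mpow S y m \<in> carrier S" if "m \<in> A" for m using A(2)[OF that] y by (auto intro!: S.mpow_closed)
  have "peval R S y (P \<oplus>\<^bsub>poly_alg R I\<^esub> Q) = (\<Oplus>\<^bsub>S\<^esub>m\<in>A. (P m \<oplus> Q m) \<odot>\<^bsub>S\<^esub> mpow S y m)"
    using A P Q y by (subst peval_eq_finsum[of _ I _ A]) (auto simp: R.pa_add A_def intro!: R.pa_add_closed[unfolded R.pa_add])
  also have "\<dots> = (\<Oplus>\<^bsub>S\<^esub>m\<in>A. P m \<odot>\<^bsub>S\<^esub> mpow S y m \<oplus>\<^bsub>S\<^esub> Q m \<odot>\<^bsub>S\<^esub> mpow S y m)"
    using D m by (intro S.add.finprod_cong') (auto simp: smult_l_distr)
  also have "\<dots> = (\<Oplus>\<^bsub>S\<^esub>m\<in>A. P m \<odot>\<^bsub>S\<^esub> mpow S y m) \<oplus>\<^bsub>S\<^esub> (\<Oplus>\<^bsub>S\<^esub>m\<in>A. Q m \<odot>\<^bsub>S\<^esub> mpow S y m)"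
    using D m by (intro S.add.finprod_multf) auto
  also have "(\<Oplus>\<^bsub>S\<^esub>m\<in>A. P m \<odot>\<^bsub>S\<^esub> mpow S y m) = peval R S y P"
    using A P y by (intro peval_eq_finsum[symmetric, of _ I]) (auto simp: A_def)
  also have "(\<Oplus>\<^bsub>S\<^esub>m\<in>A. Q m \<odot>\<^bsub>S\<^esub> mpow S y m) = peval R S y Q"
    using A Q y by (intro peval_eq_finsum[symmetric, of _ I]) (auto simp: A_def)
  finally show ?thesis .
qed

lemma peval_smult:
  assumes P: "P \<in> carrier (poly_alg R I)" and y: "y \<in> I \<rightarrow> carrier S" and r: "r \<in> carrier R"
  shows "peval R S y (r \<odot>\<^bsub>poly_alg R I\<^esub> P) = r \<odot>\<^bsub>S\<^esub> peval R S y P"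
proof -
  note D = R.pa_carrierD[OF P]
  let ?A = "{m. P m \<noteq> \<zero>}"
  have m: "mpow S y m \<in> carrier S" if "m \<in> ?A" for m using D(3)[of m] that y by (auto intro!: S.mpow_closed)
  have "peval R S y (r \<odot>\<^bsub>poly_alg R I\<^esub> P) = (\<Oplus>\<^bsub>S\<^esub>m\<in>?A. (r \<otimes> P m) \<odot>\<^bsub>S\<^esub> mpow S y m)"
    using D r y R.pa_smult_closed[OF r P]
    by (subst peval_eq_finsum[of _ I _ ?A]) (auto simp: R.pa_smult)
  also have "\<dots> = (\<Oplus>\<^bsub>S\<^esub>m\<in>?A. r \<odot>\<^bsub>S\<^esub> (P m \<odot>\<^bsub>S\<^esub> mpow S y m))"
    using D m r by (intro S.add.finprod_cong') (auto simp: smult_assoc1)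
  also have "\<dots> = r \<odot>\<^bsub>S\<^esub> peval R S y P"
    unfolding peval_def using D m r by (intro finsum_smult_ldistr[symmetric]) auto
  finally show ?thesis .
qed

lemma peval_pmult:
  assumes P: "P \<in> carrier (poly_alg R I)" and y: "y \<in> I \<rightarrow> carrier S" and i: "i \<in> I"
  shows "peval R S y (R.indexed_pmult P i) = peval R S y P \<otimes>\<^bsub>S\<^esub> y i"
  using P
proof (induction rule: R.pa_induct)
  case zero
  have "R.indexed_pmult (\<lambda>_. \<zero>) i = (\<lambda>_. \<zero>)" by (auto simp: R.indexed_pmult_def)
  moreover have "y i \<in> carrier S" using y i by auto
  ultimately show ?case by simp
next
  case (add m P')
  have c: "P m \<in> carrier R" and m: "set_mset m \<subseteq> I" using R.pa_carrierD[OF P] add by auto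
  have pm: "pmonom R (P m) m \<in> carrier (poly_alg R I)"
    "pmonom R (P m) (add_mset i m) \<in> carrier (poly_alg R I)"
    using c m i by (auto intro!: R.pmonom_closed)
  have yi: "y i \<in> carrier S" "\<And>j. j \<in># m \<Longrightarrow> y j \<in> carrier S" using y i m by auto
  have pe: "peval R S y (pmonom R (P m) (add_mset i m)) = P m \<odot>\<^bsub>S\<^esub> (y i \<otimes>\<^bsub>S\<^esub> mpow S y m)"
  proof -
    have "mpow S y (add_mset i m) = y i \<otimes>\<^bsub>S\<^esub> mpow S y m"
      using yi by (intro S.mpow_add_mset) auto
    then show ?thesis using c yi by (subst peval_pmonom) auto
  qed
  have "R.indexed_pmult (pmonom R (P m) m \<oplus>\<^bsub>poly_alg R I\<^esub> P') i
      = pmonom R (P m) (add_mset i m) \<oplus>\<^bsub>poly_alg R I\<^esub> R.indexed_pmult P' i"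
    by (auto simp: R.indexed_pmult_def pmonom_def R.pa_add fun_eq_iff dest: multi_member_split)
  then have "peval R S y (R.indexed_pmult (pmonom R (P m) m \<oplus>\<^bsub>poly_alg R I\<^esub> P') i)
      = P m \<odot>\<^bsub>S\<^esub> (mpow S y m \<otimes>\<^bsub>S\<^esub> y i) \<oplus>\<^bsub>S\<^esub> peval R S y P' \<otimes>\<^bsub>S\<^esub> y i"
    using add pm c yi y i
    by (auto simp: peval_add[of _ I] R.pa_pmult_closed pe S.m_comm)
  also have "\<dots> = (P m \<odot>\<^bsub>S\<^esub> mpow S y m \<oplus>\<^bsub>S\<^esub> peval R S y P') \<otimes>\<^bsub>S\<^esub> y i"
    using c yi peval_closed[OF add(2) y] by (simp add: S.l_distr smult_assoc2)
  also have "\<dots> = peval R S y (pmonom R (P m) m \<oplus>\<^bsub>poly_alg R I\<^esub> P') \<otimes>\<^bsub>S\<^esub> y i"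
    using add pm c yi y by (simp add: peval_add[of _ I] peval_pmonom)
  finally show ?case .
qed

lemma peval_mult:
  assumes P: "P \<in> carrier (poly_alg R I)" and Q: "Q \<in> carrier (poly_alg R I)"
    and y: "y \<in> I \<rightarrow> carrier S"
  shows "peval R S y (P \<otimes>\<^bsub>poly_alg R I\<^esub> Q) = peval R S y P \<otimes>\<^bsub>S\<^esub> peval R S y Q"
  using Q
proof (induction rule: R.pa_carrier_induct)
  case (const k)
  have "P \<otimes>\<^bsub>poly_alg R I\<^esub> R.indexed_const k = k \<odot>\<^bsub>poly_alg R I\<^esub> P"
    using R.pa_mult_const[of P k I] R.pa_carrierD[OF P] const by (simp add: R.pa_smult)
  then show ?case using const peval_closed[OF P y]
    by (simp add: peval_smult[OF P y] peval_const smult_assoc2_right)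
next
  case (add Q Q')
  then show ?case using P y
    by (simp add: R.pa_mult_add R.pa_carrierD(1)[of _ I] peval_add[of _ I] R.pa_mult_closed S.r_distr
        peval_closed[of _ I])
next
  case (pmult Q i)
  have "y i \<in> carrier S" using y pmult by auto
  then show ?case using P y pmult
    by (simp add: R.pa_mult_pmult R.pa_carrierD(1)[of _ I] peval_pmult[of _ I] R.pa_mult_closed S.m_assoc peval_closed[of _ I])
qed

lemma peval_alg_hom: "y \<in> I \<rightarrow> carrier S \<Longrightarrow> peval R S y \<in> alg_hom R (poly_alg R I) S"
  by (rule alg_homI)
    (auto simp: peval_add peval_mult peval_smult R.pa_one peval_const R.indexed_const_pmonom[symmetric])

lemma pa_alg_hom_unique:
  assumes h: "h \<in> alg_hom R (poly_alg R I) S" and k: "k \<in> alg_hom R (poly_alg R I) S"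
    and eq: "\<And>i. i \<in> I \<Longrightarrow> h (R.indexed_var i) = k (R.indexed_var i)"
    and P: "P \<in> carrier (poly_alg R I)"
  shows "h P = k P"
  using P
proof (induction rule: R.pa_carrier_induct)
  case (const c)
  have "R.indexed_const c = c \<odot>\<^bsub>poly_alg R I\<^esub> \<one>\<^bsub>poly_alg R I\<^esub>"
    using const by (auto simp: R.pa_smult R.pa_one R.indexed_const_def pmonom_def)
  moreover have "\<one>\<^bsub>poly_alg R I\<^esub> \<in> carrier (poly_alg R I)"
    by (auto simp: R.pa_one)
  ultimately show ?case using const by (simp add: alg_homD[OF h] alg_homD[OF k])
next
  case (add P P')
  then show ?case by (simp add: alg_homD[OF h] alg_homD[OF k])
next
  case (pmult P i)
  have v: "R.indexed_var i \<in> carrier (poly_alg R I)"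
    using pmult by (auto simp: R.indexed_var_pmonom)
  have "R.indexed_pmult P i = P \<otimes>\<^bsub>poly_alg R I\<^esub> R.indexed_var i"
    unfolding R.indexed_var_def using R.pa_carrierD[OF pmult(1)]
    by (subst R.pa_mult_pmult) (simp_all add: R.pa_mult_const, simp add: R.indexed_const_def)
  then show ?case using pmult v by (simp add: alg_homD[OF h] alg_homD[OF k] eq)
qed

lemma peval_unique:
  assumes "h \<in> alg_hom R (poly_alg R I) S" and "y \<in> I \<rightarrow> carrier S"
    and "\<And>i. i \<in> I \<Longrightarrow> h (R.indexed_var i) = y i" and "P \<in> carrier (poly_alg R I)"
  shows "h P = peval R S y P"
  by (rule pa_alg_hom_unique[of _ I])
    (use assms in \<open>auto simp: Pi_iff peval_var intro!: peval_alg_hom\<close>)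

lemma peval_cong:
  assumes "P \<in> carrier (poly_alg R I)" and "y' \<in> I \<rightarrow> carrier S" and "\<And>i. i \<in> I \<Longrightarrow> y i = y' i"
  shows "peval R S y P = peval R S y' P"
  by (rule peval_unique[of _ I]) (use assms in \<open>auto simp: Pi_iff peval_var intro!: peval_alg_hom\<close>)

end

lemma (in cring) pa_alg: "alg R (poly_alg R I)"
  using pa_algebra[of I] by (intro alg.intro alg_axioms.intro is_cring) (simp_all add: algebra_def)

text \<open>Both sides are homomorphisms in \<open>P\<close> with the same values on the variables.
  When \<open>S\<close> and \<open>T\<close> are polynomial algebras this is associativity of
  substitution.\<close>

lemma peval_comp:
  assumes "alg R S" and "alg R T" and h: "h \<in> alg_hom R S T"
    and y: "y \<in> I \<rightarrow> carrier S" and P: "P \<in> carrier (poly_alg R I)"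
  shows "h (peval R S y P) = peval R T (\<lambda>i. h (y i)) P"
proof -
  interpret S: alg R S by fact
  interpret T: alg R T by fact
  show ?thesis
    using alg_hom_comp[OF S.peval_alg_hom[OF y] h] y P
    by (intro T.peval_unique[of _ I])
      (auto simp: Pi_iff S.peval_var intro!: alg_homD(1)[OF h])
qed

section \<open>Monomials\<close>

context cring
begin

lemma pmonom_mult_coeff:
  assumes c: "c \<in> carrier R" and P: "\<And>m. P m \<in> carrier R"
  shows "(pmonom R c m \<otimes>\<^bsub>poly_alg R I\<^esub> P) (m + k) = c \<otimes> P k"
    and "\<not> m \<subseteq># m' \<Longrightarrow> (pmonom R c m \<otimes>\<^bsub>poly_alg R I\<^esub> P) m' = \<zero>"
proof -
  have "(\<Oplus>a\<in>{a. a \<subseteq># m + k}. pmonom R c m a \<otimes> P (m + k - a))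
      = (\<Oplus>a\<in>{a. a \<subseteq># m + k}. if m = a then c \<otimes> P (m + k - a) else \<zero>)"
    using assms by (intro add.finprod_cong') (auto simp: pmonom_def)
  also have "\<dots> = c \<otimes> P (m + k - m)"
    using assms by (intro add.finprod_singleton) (auto simp: finite_submsets)
  finally show "(pmonom R c m \<otimes>\<^bsub>poly_alg R I\<^esub> P) (m + k) = c \<otimes> P k" by (simp add: pa_mult)
next
  assume "\<not> m \<subseteq># m'"
  then have "(\<Oplus>a\<in>{a. a \<subseteq># m'}. pmonom R c m a \<otimes> P (m' - a)) = \<zero>"
    using assms by (intro add.finprod_one_eqI) (auto simp: pmonom_def)
  then show "(pmonom R c m \<otimes>\<^bsub>poly_alg R I\<^esub> P) m' = \<zero>" by (simp add: pa_mult)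
qed

lemma pmonom_mult:
  assumes "c \<in> carrier R" "d \<in> carrier R"
  shows "pmonom R c m \<otimes>\<^bsub>poly_alg R I\<^esub> pmonom R d k = pmonom R (c \<otimes> d) (m + k)"
proof
  fix m'
  have P: "\<And>m. pmonom R d k m \<in> carrier R" using assms by (simp add: pmonom_def)
  show "(pmonom R c m \<otimes>\<^bsub>poly_alg R I\<^esub> pmonom R d k) m' = pmonom R (c \<otimes> d) (m + k) m'"
  proof (cases "m \<subseteq># m'")
    case True
    then obtain k' where m': "m' = m + k'" by (auto simp: mset_subset_eq_exists_conv)
    have "(pmonom R c m \<otimes>\<^bsub>poly_alg R I\<^esub> pmonom R d k) (m + k') = c \<otimes> pmonom R d k k'"
      by (rule pmonom_mult_coeff(1)[OF assms(1) P])
    then show ?thesis unfolding m' using assms by (simp add: pmonom_def)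
  next
    case False
    then have "m' \<noteq> m + k" by auto
    then show ?thesis using assms pmonom_mult_coeff(2)[OF assms(1) P False] by (simp add: pmonom_def)
  qed
qed

lemma pmonom_smult: "r \<in> carrier R \<Longrightarrow> r \<odot>\<^bsub>poly_alg R I\<^esub> pmonom R c m = pmonom R (r \<otimes> c) m"
  by (auto simp: pa_smult pmonom_def)

lemma var_closed [intro]: "i \<in> I \<Longrightarrow> indexed_var i \<in> carrier (poly_alg R I)"
  by (auto simp: indexed_var_pmonom)

text \<open>The resulting form admits the coefficient zero. It therefore also covers variables with
  image zero, and it survives substitutions that annihilate a monomial.\<close>

lemma is_monomial_pmonom:
  assumes "is_monomial R I P" and "finite I"
  obtains c m where "c \<in> carrier R" "set_mset m \<subseteq> I" "P = pmonom R c m"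
proof -
  interpret B: alg R "poly_alg R I" by (rule pa_alg)
  let ?pm = "\<lambda>Q. \<exists>m. set_mset m \<subseteq> I \<and> Q = pmonom R \<one> m"
  obtain c a where c: "c \<in> carrier R" and P: "P = c \<odot>\<^bsub>poly_alg R I\<^esub>
      (\<Otimes>\<^bsub>poly_alg R I\<^esub>i\<in>I. indexed_var i [^]\<^bsub>poly_alg R I\<^esub> (a i :: nat))"
    using assms(1) by (auto simp: is_monomial_def)
  have mult: "?pm (Q \<otimes>\<^bsub>poly_alg R I\<^esub> Q')" if "?pm Q" "?pm Q'" for Q Q'
  proof -
    from that obtain m m' where "set_mset m \<subseteq> I" "Q = pmonom R \<one> m" "set_mset m' \<subseteq> I" "Q' = pmonom R \<one> m'"
      by blast
    then show ?thesis by (intro exI[of _ "m + m'"]) (auto simp: pmonom_mult)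
  qed
  have one: "?pm \<one>\<^bsub>poly_alg R I\<^esub>" by (auto simp: pa_one intro!: exI[of _ "{#}"])
  have pow: "?pm (indexed_var i [^]\<^bsub>poly_alg R I\<^esub> (k :: nat))" if "i \<in> I" for i k
  proof (induction k)
    case (Suc k)
    have "?pm (indexed_var i)" using that by (auto simp: indexed_var_pmonom intro!: exI[of _ "{#_#}"])
    with mult Suc show ?case by simp
  qed (simp add: one)
  have "?pm (\<Otimes>\<^bsub>poly_alg R I\<^esub>i\<in>A. indexed_var i [^]\<^bsub>poly_alg R I\<^esub> a i)" if "A \<subseteq> I" for A
    using finite_subset[OF that assms(2)] that
  proof (induction A rule: finite_induct)
    case (insert i A)
    have cl: "(\<lambda>i. indexed_var i [^]\<^bsub>poly_alg R I\<^esub> a i) \<in> insert i A \<rightarrow> carrier (poly_alg R I)"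
      using insert.prems by auto
    then show ?case using insert mult[OF pow[of i "a i"]] by (subst B.S.finprod_insert) auto
  qed (simp add: one)
  then obtain m where "set_mset m \<subseteq> I"
    "(\<Otimes>\<^bsub>poly_alg R I\<^esub>i\<in>I. indexed_var i [^]\<^bsub>poly_alg R I\<^esub> a i) = pmonom R \<one> m" by blast
  with that[of c m] c P show thesis by (simp add: pmonom_smult)
qed

lemma mpow_pmonom:
  assumes "\<And>i. i \<in># m \<Longrightarrow> \<kappa> i \<in> carrier R" and "\<And>i. i \<in># m \<Longrightarrow> set_mset (\<mu> i) \<subseteq> I"
  shows "mpow (poly_alg R I) (\<lambda>i. pmonom R (\<kappa> i) (\<mu> i)) m = pmonom R (mpow R \<kappa> m) (\<Sum>i\<in>#m. \<mu> i)"
  using assms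
proof (induction m)
  case empty
  interpret B: alg R "poly_alg R I" by (rule pa_alg)
  show ?case by (simp add: pa_one)
next
  case (add i m)
  interpret B: alg R "poly_alg R I" by (rule pa_alg)
  have *: "\<kappa> i \<in> carrier R" "\<And>j. j \<in># m \<Longrightarrow> \<kappa> j \<in> carrier R" "set_mset (\<mu> i) \<subseteq> I"
    "\<And>j. j \<in># m \<Longrightarrow> set_mset (\<mu> j) \<subseteq> I" using add.prems by auto
  have "mpow (poly_alg R I) (\<lambda>i. pmonom R (\<kappa> i) (\<mu> i)) (add_mset i m)
      = pmonom R (\<kappa> i) (\<mu> i) \<otimes>\<^bsub>poly_alg R I\<^esub> mpow (poly_alg R I) (\<lambda>i. pmonom R (\<kappa> i) (\<mu> i)) m"
    using add.prems by (intro B.S.mpow_add_mset) auto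
  also have "\<dots> = pmonom R (\<kappa> i \<otimes> mpow R \<kappa> m) (\<mu> i + (\<Sum>i\<in>#m. \<mu> i))"
    using add.IH * by (simp add: pmonom_mult mpow_closed)
  also have "\<kappa> i \<otimes> mpow R \<kappa> m = mpow R \<kappa> (add_mset i m)"
    using add.prems by (intro mpow_add_mset[symmetric]) auto
  finally show ?case by simp
qed

text \<open>Injectivity of the exponent map keeps distinct monomials of \<open>P\<close> from
  colliding after the substitution, so each coefficient is merely scaled.\<close>

lemma peval_pmonom_coeff:
  assumes P: "P \<in> carrier (poly_alg R I)"
    and \<kappa>: "\<And>i. i \<in> I \<Longrightarrow> \<kappa> i \<in> carrier R" and \<mu>: "\<And>i. i \<in> I \<Longrightarrow> set_mset (\<mu> i) \<subseteq> J"
    and inj: "inj_on (\<lambda>m. \<Sum>i\<in>#m. \<mu> i) {m. set_mset m \<subseteq> I}" and m: "set_mset m \<subseteq> I"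
  shows "peval R (poly_alg R J) (\<lambda>i. pmonom R (\<kappa> i) (\<mu> i)) P (\<Sum>i\<in>#m. \<mu> i) = P m \<otimes> mpow R \<kappa> m"
  using P
proof (induction rule: pa_induct)
  case zero
  interpret B: alg R "poly_alg R J" by (rule pa_alg)
  have "mpow R \<kappa> m \<in> carrier R" using \<kappa> m by (auto intro!: mpow_closed)
  then show ?case by (simp add: pa_zero)
next
  case (add k P')
  interpret B: alg R "poly_alg R J" by (rule pa_alg)
  have y: "(\<lambda>i. pmonom R (\<kappa> i) (\<mu> i)) \<in> I \<rightarrow> carrier (poly_alg R J)" using \<kappa> \<mu> by auto
  have k: "P k \<in> carrier R" "set_mset k \<subseteq> I" using pa_carrierD[OF P] add(1) by auto
  have c: "mpow R \<kappa> k \<in> carrier R" "mpow R \<kappa> m \<in> carrier R" using \<kappa> k m by (auto intro!: mpow_closed)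
  have eq: "(\<Sum>i\<in>#m. \<mu> i) = (\<Sum>i\<in>#k. \<mu> i) \<longleftrightarrow> m = k" using inj m k by (auto dest: inj_onD)
  have "peval R (poly_alg R J) (\<lambda>i. pmonom R (\<kappa> i) (\<mu> i)) (pmonom R (P k) k)
      = pmonom R (P k \<otimes> mpow R \<kappa> k) (\<Sum>i\<in>#k. \<mu> i)"
  proof -
    have "mpow (poly_alg R J) (\<lambda>i. pmonom R (\<kappa> i) (\<mu> i)) k = pmonom R (mpow R \<kappa> k) (\<Sum>i\<in>#k. \<mu> i)"
      using k \<kappa> \<mu> by (intro mpow_pmonom) auto
    then show ?thesis using k y by (subst B.peval_pmonom) (auto simp: pmonom_smult)
  qed
  moreover have "peval R (poly_alg R J) (\<lambda>i. pmonom R (\<kappa> i) (\<mu> i)) (pmonom R (P k) k \<oplus>\<^bsub>poly_alg R I\<^esub> P')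
     = peval R (poly_alg R J) (\<lambda>i. pmonom R (\<kappa> i) (\<mu> i)) (pmonom R (P k) k) \<oplus>\<^bsub>poly_alg R J\<^esub>
       peval R (poly_alg R J) (\<lambda>i. pmonom R (\<kappa> i) (\<mu> i)) P'"
    using k add y by (intro B.peval_add) auto
  ultimately show ?case using add.IH c k pa_carrierD(1)[OF add(2)]
    by (simp add: pa_add pmonom_def eq l_distr)
qed

end

section \<open>The order filtration\<close>

lemma (in cring) add_diff_add:
  "\<lbrakk>a \<in> carrier R; b \<in> carrier R; c \<in> carrier R; d \<in> carrier R\<rbrakk> \<Longrightarrow>
   (a \<oplus> b) \<ominus> (c \<oplus> d) = (a \<ominus> c) \<oplus> (b \<ominus> d)"
  by (simp add: minus_eq) algebra

text \<open>This is the \<open>d\<close>-th power of the ideal generated by the variables satisfying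
  \<open>q\<close>. The constant predicate True gives the usual order, and exclusion of one variable
  gives the order in the remaining ones.\<close>

definition pfilt ::
    "('a, 'r) ring_scheme \<Rightarrow> 'v set \<Rightarrow> ('v \<Rightarrow> bool) \<Rightarrow> nat \<Rightarrow> ('v multiset \<Rightarrow> 'a) set"
  where "pfilt R I q d =
    {P \<in> carrier (poly_alg R I). \<forall>m. P m \<noteq> \<zero>\<^bsub>R\<^esub> \<longrightarrow> d \<le> size (filter_mset q m)}"

context cring
begin

lemma pfilt_carrier: "P \<in> pfilt R I q d \<Longrightarrow> P \<in> carrier (poly_alg R I)"
  by (simp add: pfilt_def)

lemma pfiltD: "P \<in> pfilt R I q d \<Longrightarrow> size (filter_mset q m) < d \<Longrightarrow> P m = \<zero>"
  unfolding pfilt_def using not_le by blast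

lemma pfiltI:
  "P \<in> carrier (poly_alg R I) \<Longrightarrow> (\<And>m. size (filter_mset q m) < d \<Longrightarrow> P m = \<zero>) \<Longrightarrow> P \<in> pfilt R I q d"
  unfolding pfilt_def using not_le by blast

lemma pfilt_0: "P \<in> carrier (poly_alg R I) \<Longrightarrow> P \<in> pfilt R I q 0"
  by (simp add: pfilt_def)

lemma pfilt_mono: "P \<in> pfilt R I q d \<Longrightarrow> d' \<le> d \<Longrightarrow> P \<in> pfilt R I q d'"
  unfolding pfilt_def by force

lemma pfilt_zero: "(\<lambda>_. \<zero>) \<in> pfilt R I q d"
  by (rule pfiltI) (auto intro: pa_carrierI)

lemma pfilt_add:
  "P \<in> pfilt R I q d \<Longrightarrow> Q \<in> pfilt R I q d \<Longrightarrow> P \<oplus>\<^bsub>poly_alg R I\<^esub> Q \<in> pfilt R I q d"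
  by (rule pfiltI) (auto simp: pfiltD pa_add intro: pa_add_closed[unfolded pa_add] pfilt_carrier)

lemma pfilt_smult:
  "r \<in> carrier R \<Longrightarrow> P \<in> pfilt R I q d \<Longrightarrow> r \<odot>\<^bsub>poly_alg R I\<^esub> P \<in> pfilt R I q d"
  by (rule pfiltI) (auto simp: pfiltD pa_smult intro: pa_smult_closed[unfolded pa_smult] pfilt_carrier)

lemma pfilt_mult:
  fixes P Q :: "'v multiset \<Rightarrow> 'a"
  assumes "P \<in> pfilt R I q d" and "Q \<in> pfilt R I q e"
  shows "P \<otimes>\<^bsub>poly_alg R I\<^esub> Q \<in> pfilt R I q (d + e)"
proof (rule pfiltI)
  note c = pfilt_carrier[OF assms(1)] pfilt_carrier[OF assms(2)]
  show "P \<otimes>\<^bsub>poly_alg R I\<^esub> Q \<in> carrier (poly_alg R I)" using c by (rule pa_mult_closed)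
  fix m :: "'v multiset"
  assume m: "size (filter_mset q m) < d + e"
  have "P a \<otimes> Q (m - a) = \<zero>" if "a \<subseteq># m" for a
  proof -
    have "m = a + (m - a)" using that by simp
    then obtain b where b: "m = a + b" ..
    then have "size (filter_mset q a) < d \<or> size (filter_mset q b) < e" using m by auto
    then show ?thesis using pfiltD[OF assms(1), of a] pfiltD[OF assms(2), of b] b
      pa_carrierD(1)[OF c(1)] pa_carrierD(1)[OF c(2)] by auto
  qed
  then show "(P \<otimes>\<^bsub>poly_alg R I\<^esub> Q) m = \<zero>"
    unfolding pa_mult by (intro add.finprod_one_eqI) auto
qed

lemma mpow_pfilt:
  assumes "\<And>i. i \<in># m \<Longrightarrow> y i \<in> pfilt R I q (if q i then 1 else 0)"
  shows "mpow (poly_alg R I) y m \<in> pfilt R I q (size (filter_mset q m))"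
  using assms
proof (induction m)
  case empty
  interpret B: alg R "poly_alg R I" by (rule pa_alg)
  show ?case using B.S.one_closed by (simp add: pfilt_0)
next
  case (add i m)
  interpret B: alg R "poly_alg R I" by (rule pa_alg)
  have "mpow (poly_alg R I) y (add_mset i m) = y i \<otimes>\<^bsub>poly_alg R I\<^esub> mpow (poly_alg R I) y m"
    using add.prems by (intro B.S.mpow_add_mset) (auto intro: pfilt_carrier)
  moreover have "y i \<otimes>\<^bsub>poly_alg R I\<^esub> mpow (poly_alg R I) y m
      \<in> pfilt R I q ((if q i then 1 else 0) + size (filter_mset q m))"
    using add by (intro pfilt_mult) auto
  ultimately show ?case by (auto split: if_splits)
qed

text \<open>By a b - a' b' = a (b - b') + (a - a') b', an error that exceeds the order of one factor
  by d also exceeds the order of the whole product by d. The variables outside \<open>q\<close> have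
  order zero, so an error there counts with d alone.\<close>

lemma mpow_diff_pfilt:
  assumes "\<And>i. i \<in># m \<Longrightarrow> y i \<in> pfilt R I q (if q i then 1 else 0)"
    and "\<And>i. i \<in># m \<Longrightarrow> y' i \<in> pfilt R I q (if q i then 1 else 0)"
    and "\<And>i. i \<in># m \<Longrightarrow> y i \<ominus>\<^bsub>poly_alg R I\<^esub> y' i \<in> pfilt R I q ((if q i then 1 else 0) + d)"
  shows "mpow (poly_alg R I) y m \<ominus>\<^bsub>poly_alg R I\<^esub> mpow (poly_alg R I) y' m
    \<in> pfilt R I q (size (filter_mset q m) + d)"
  using assms
proof (induction m)
  case empty
  interpret B: alg R "poly_alg R I" by (rule pa_alg)
  show ?case using pfilt_zero by (simp add: B.S.minus_eq B.S.r_neg) (simp add: pa_zero)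
next
  case (add i m)
  interpret B: alg R "poly_alg R I" by (rule pa_alg)
  let ?B = "poly_alg R I"
  note c = pfilt_carrier[of _ I q]
  have cl: "y i \<in> carrier ?B" "y' i \<in> carrier ?B"
    "mpow ?B y m \<in> carrier ?B" "mpow ?B y' m \<in> carrier ?B"
    using add.prems by (auto intro!: c B.S.mpow_closed)
  have eq: "mpow ?B y (add_mset i m) = y i \<otimes>\<^bsub>?B\<^esub> mpow ?B y m"
    "mpow ?B y' (add_mset i m) = y' i \<otimes>\<^bsub>?B\<^esub> mpow ?B y' m"
    using add.prems by (intro B.S.mpow_add_mset; auto intro: pfilt_carrier)+
  have "y i \<otimes>\<^bsub>?B\<^esub> mpow ?B y m \<ominus>\<^bsub>?B\<^esub> y' i \<otimes>\<^bsub>?B\<^esub> mpow ?B y' m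
     = y i \<otimes>\<^bsub>?B\<^esub> (mpow ?B y m \<ominus>\<^bsub>?B\<^esub> mpow ?B y' m) \<oplus>\<^bsub>?B\<^esub> (y i \<ominus>\<^bsub>?B\<^esub> y' i) \<otimes>\<^bsub>?B\<^esub> mpow ?B y' m"
    using cl by (simp add: B.S.minus_eq) algebra
  moreover have "y i \<otimes>\<^bsub>?B\<^esub> (mpow ?B y m \<ominus>\<^bsub>?B\<^esub> mpow ?B y' m)
      \<in> pfilt R I q ((if q i then 1 else 0) + (size (filter_mset q m) + d))"
    using add by (intro pfilt_mult) auto
  moreover have "(y i \<ominus>\<^bsub>?B\<^esub> y' i) \<otimes>\<^bsub>?B\<^esub> mpow ?B y' m
      \<in> pfilt R I q (((if q i then 1 else 0) + d) + size (filter_mset q m))"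
    using add by (intro pfilt_mult mpow_pfilt) auto
  moreover have "((if q i then 1 else 0) + d) + size (filter_mset q m) = size (filter_mset q (add_mset i m)) + d"
    "(if q i then 1 else 0) + (size (filter_mset q m) + d) = size (filter_mset q (add_mset i m)) + d" by auto
  ultimately show ?case unfolding eq by (simp only: pfilt_add)
qed

lemma peval_diff_pfilt:
  assumes P: "P \<in> carrier (poly_alg R J)"
    and y: "y \<in> J \<rightarrow> carrier (poly_alg R I)" "y' \<in> J \<rightarrow> carrier (poly_alg R I)"
    and m: "\<And>m. P m \<noteq> \<zero> \<Longrightarrow>
      mpow (poly_alg R I) y m \<ominus>\<^bsub>poly_alg R I\<^esub> mpow (poly_alg R I) y' m \<in> pfilt R I q d"
  shows "peval R (poly_alg R I) y P \<ominus>\<^bsub>poly_alg R I\<^esub> peval R (poly_alg R I) y' P \<in> pfilt R I q d"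
  using P
proof (induction rule: pa_induct)
  case zero
  interpret B: alg R "poly_alg R I" by (rule pa_alg)
  show ?case using pfilt_zero by (simp add: B.S.minus_eq B.S.r_neg) (simp add: pa_zero)
next
  case (add k P')
  let ?B = "poly_alg R I"
  interpret B: alg R ?B by (rule pa_alg)
  have k: "P k \<in> carrier R" "set_mset k \<subseteq> J" using pa_carrierD[OF P] add(1) by auto
  have e: "peval R ?B z (pmonom R (P k) k) = P k \<odot>\<^bsub>?B\<^esub> mpow ?B z k" if "z \<in> J \<rightarrow> carrier ?B" for z
    using k that by (intro B.peval_pmonom) auto
  have a: "peval R ?B z (pmonom R (P k) k \<oplus>\<^bsub>poly_alg R J\<^esub> P') = P k \<odot>\<^bsub>?B\<^esub> mpow ?B z k \<oplus>\<^bsub>?B\<^esub> peval R ?B z P'"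
    if "z \<in> J \<rightarrow> carrier ?B" for z
    using k that add e by (subst B.peval_add[of _ J]) auto
  have cl: "mpow ?B y k \<in> carrier ?B" "mpow ?B y' k \<in> carrier ?B" using y k by (auto intro!: B.S.mpow_closed)
  have cl': "peval R ?B y P' \<in> carrier ?B" "peval R ?B y' P' \<in> carrier ?B"
    using y add by (auto intro!: B.peval_closed)
  have "(P k \<odot>\<^bsub>?B\<^esub> mpow ?B y k \<oplus>\<^bsub>?B\<^esub> peval R ?B y P') \<ominus>\<^bsub>?B\<^esub> (P k \<odot>\<^bsub>?B\<^esub> mpow ?B y' k \<oplus>\<^bsub>?B\<^esub> peval R ?B y' P')
    = P k \<odot>\<^bsub>?B\<^esub> (mpow ?B y k \<ominus>\<^bsub>?B\<^esub> mpow ?B y' k) \<oplus>\<^bsub>?B\<^esub> (peval R ?B y P' \<ominus>\<^bsub>?B\<^esub> peval R ?B y' P')"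
    using cl cl' k(1) B.smult_closed[OF k(1) cl(1)] B.smult_closed[OF k(1) cl(2)]
    by (simp add: B.S.add_diff_add B.smult_r_distr B.smult_r_minus B.S.minus_eq[of "_ \<odot>\<^bsub>?B\<^esub> _"]
        B.S.minus_eq[of "mpow ?B y k"])
  then show ?case unfolding a[OF y(1)] a[OF y(2)]
    using add m[OF add(1)] k by (auto intro!: pfilt_add pfilt_smult)
qed

end

section \<open>Retractions of polynomial rings in one variable\<close>

lemma alg_hom_minus:
  assumes "alg R S" and "alg R T" and h: "h \<in> alg_hom R S T"
    and "x \<in> carrier S" "y \<in> carrier S"
  shows "h \<zero>\<^bsub>S\<^esub> = \<zero>\<^bsub>T\<^esub>" and "h (x \<ominus>\<^bsub>S\<^esub> y) = h x \<ominus>\<^bsub>T\<^esub> h y"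
proof -
  interpret S: alg R S by fact
  interpret T: alg R T by fact
  interpret h: ring_hom_cring S T h
    using h S.S.is_cring T.S.is_cring
    by (auto simp: alg_hom_def ring_hom_cring_def ring_hom_cring_axioms_def)
  show "h \<zero>\<^bsub>S\<^esub> = \<zero>\<^bsub>T\<^esub>" by simp
  show "h (x \<ominus>\<^bsub>S\<^esub> y) = h x \<ominus>\<^bsub>T\<^esub> h y"
    using assms(4,5) by (simp add: S.S.minus_eq T.S.minus_eq)
qed

context cring
begin

lemma minus_add_cancel: "a \<in> carrier R \<Longrightarrow> b \<in> carrier R \<Longrightarrow> a \<ominus> b \<oplus> b = a"
  by (simp add: minus_eq a_assoc l_neg)

lemma pa_uminus_coeff:
  assumes "P \<in> carrier (poly_alg R I)"
  shows "(\<ominus>\<^bsub>poly_alg R I\<^esub> P) m = \<ominus> P m"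
proof -
  interpret B: alg R "poly_alg R I" by (rule pa_alg)
  have "P \<oplus>\<^bsub>poly_alg R I\<^esub> \<ominus>\<^bsub>poly_alg R I\<^esub> P = \<zero>\<^bsub>poly_alg R I\<^esub>"
    using assms by (rule B.S.r_neg)
  then have "P m \<oplus> (\<ominus>\<^bsub>poly_alg R I\<^esub> P) m = \<zero>" by (simp add: pa_add pa_zero fun_eq_iff)
  moreover have "P m \<in> carrier R" "(\<ominus>\<^bsub>poly_alg R I\<^esub> P) m \<in> carrier R"
    using assms B.S.a_inv_closed[OF assms] by (auto intro: pa_carrierD)
  ultimately show ?thesis using minus_equality[of "(\<ominus>\<^bsub>poly_alg R I\<^esub> P) m" "P m"] by (simp add: a_comm)
qed

lemma pa_minus_coeff:
  assumes "P \<in> carrier (poly_alg R I)" and "Q \<in> carrier (poly_alg R I)"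
  shows "(P \<ominus>\<^bsub>poly_alg R I\<^esub> Q) m = P m \<ominus> Q m"
  using pa_uminus_coeff[OF assms(2)] by (simp add: a_minus_def pa_add)

lemma pa_incl: "I \<subseteq> J \<Longrightarrow> (\<lambda>P. P) \<in> alg_hom R (poly_alg R I) (poly_alg R J)"
  by (rule alg_homI) (auto simp: pa_add pa_mult pa_one pa_smult intro: pa_mono)

lemma peval_pa_mono:
  assumes "I \<subseteq> J" and "y \<in> K \<rightarrow> carrier (poly_alg R I)" and "P \<in> carrier (poly_alg R K)"
  shows "peval R (poly_alg R J) y P = peval R (poly_alg R I) y P"
  using peval_comp[OF pa_alg pa_alg pa_incl[OF assms(1)] assms(2,3)] by simp

lemma sum_mset_single: "(\<Sum>i\<in>#m. {#i#}) = m"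
  by (induction m) auto

lemma sum_mset_const_single: "set_mset m \<subseteq> {v} \<Longrightarrow> (\<Sum>i\<in>#m. {#v#}) = m"
  by (induction m) auto

lemma mpow_idem:
  assumes "e \<in> carrier R" "e \<otimes> e = e"
  shows "m \<noteq> {#} \<Longrightarrow> mpow R (\<lambda>_. e) m = e"
proof (induction m)
  case (add i m)
  then show ?case using assms by (cases "m = {#}") (auto simp: mpow_add_mset)
qed simp

lemma mpow_zero:
  assumes "i \<in># m" "y i = \<zero>" "\<And>j. j \<in># m \<Longrightarrow> y j \<in> carrier R"
  shows "mpow R y m = \<zero>"
proof -
  obtain k where k: "m = add_mset i k" using assms(1) by (auto dest: multi_member_split)
  have "mpow R y (add_mset i k) = y i \<otimes> mpow R y k"
    using assms unfolding k by (intro mpow_add_mset) auto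
  moreover have "mpow R y k \<in> carrier R" using assms k by (auto intro!: mpow_closed)
  ultimately show ?thesis using assms k by simp
qed

lemma peval_single_pmonom_coeff:
  assumes "P \<in> carrier (poly_alg R {v})" and "e \<in> carrier R" and "set_mset m \<subseteq> {v}"
  shows "peval R (poly_alg R {v}) (\<lambda>_. pmonom R e {#v#}) P m = P m \<otimes> mpow R (\<lambda>_. e) m"
proof -
  have "inj_on (\<lambda>m. \<Sum>i\<in>#m. {#v#}) {m. set_mset m \<subseteq> {v}}"
    by (rule inj_on_inverseI[of _ "\<lambda>m. m"]) (simp only: sum_mset_const_single mem_Collect_eq)
  from peval_pmonom_coeff[OF assms(1) _ _ this assms(3), of "\<lambda>_. e" "{v}"] assms(2,3)
  show ?thesis by (simp only: sum_mset_const_single) simp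
qed

text \<open>Compare \<open>P\<close> with its linear part L = e X. Degree one of P(P) = P says e e =
  e. If P - L has order at least d, where d is at least 2, its coefficient a in degree d satisfies a
  = a e + e a: the first term comes from (P - L)(P), the second from L(P) = e P. Multiplication by e
  gives e a = 2 e a, hence e a = 0 and a = 0.\<close>

lemma uni_retract_origin:
  fixes v :: 'v
  assumes P: "P \<in> carrier (poly_alg R {v})" and P0: "P {#} = \<zero>"
    and PP: "peval R (poly_alg R {v}) (\<lambda>_. P) P = P"
  shows "P {#v#} \<otimes> P {#v#} = P {#v#}" and "P = pmonom R (P {#v#}) {#v#}"
proof -
  let ?B = "poly_alg R {v}"
  let ?q = "\<lambda>_::'v. True"
  interpret B: alg R ?B by (rule pa_alg)
  define e where "e = P {#v#}"
  have e: "e \<in> carrier R" and c: "\<And>m. P m \<in> carrier R" using pa_carrierD(1)[OF P] by (auto simp: e_def)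
  define L where "L = pmonom R e {#v#}"
  have L: "L \<in> carrier ?B" using e by (auto simp: L_def)
  have PL: "P \<ominus>\<^bsub>?B\<^esub> L \<in> carrier ?B" using P L by simp
  have sup: "P m = \<zero>" if "\<not> set_mset m \<subseteq> {v}" for m using pa_carrierD(3)[OF P] that by blast
  have PLm: "(P \<ominus>\<^bsub>?B\<^esub> L) m = P m \<ominus> (if m = {#v#} then e else \<zero>)" for m
    using pa_minus_coeff[OF P L] by (simp add: L_def pmonom_def)
  have PL2: "P \<ominus>\<^bsub>?B\<^esub> L \<in> pfilt R {v} ?q 2"
  proof (rule pfiltI[OF PL])
    fix m :: "'v multiset"
    assume "size (filter_mset ?q m) < 2"
    then have "size m = 0 \<or> size m = 1" by (simp del: size_eq_0_iff_empty) linarith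
    then consider "m = {#}" | "m = {#v#}" | i where "m = {#i#}" "i \<noteq> v"
      using size_1_singleton_mset[of m] by auto
    then show "(P \<ominus>\<^bsub>?B\<^esub> L) m = \<zero>"
      by cases (use sup e P0 in \<open>auto simp: PLm e_def minus_eq r_neg\<close>)
  qed
  have P1: "P \<in> pfilt R {v} ?q 1" using P P0 by (intro pfiltI) auto
  have L1: "L \<in> pfilt R {v} ?q 1" using L by (intro pfiltI) (auto simp: L_def pmonom_def)
  \<comment> \<open>\<open>P\<close> and \<open>L\<close> have order 1 and differ in order 2, so
    exchanging them in a monomial of degree k produces an error of order k + 1.\<close>
  have approx: "peval R ?B (\<lambda>_. P) Q \<ominus>\<^bsub>?B\<^esub> peval R ?B (\<lambda>_. L) Q \<in> pfilt R {v} ?q (d + 1)"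
    if Q: "Q \<in> pfilt R {v} ?q d" for Q d
  proof (rule peval_diff_pfilt[OF pfilt_carrier[OF Q]])
    fix m
    assume "Q m \<noteq> \<zero>"
    then have "d \<le> size m" using Q by (auto simp: pfilt_def)
    moreover have "mpow ?B (\<lambda>_. P) m \<ominus>\<^bsub>?B\<^esub> mpow ?B (\<lambda>_. L) m \<in> pfilt R {v} ?q (size (filter_mset ?q m) + 1)"
      using P1 L1 PL2 by (intro mpow_diff_pfilt) (auto simp: numeral_2_eq_2)
    ultimately show "mpow ?B (\<lambda>_. P) m \<ominus>\<^bsub>?B\<^esub> mpow ?B (\<lambda>_. L) m \<in> pfilt R {v} ?q (d + 1)"
      by (auto intro: pfilt_mono)
  qed (use P L in auto)
  \<comment> \<open>Hence the lowest coefficients of Q(P) are those of Q(e X), where they can be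
    read off.\<close>
  have coeff: "peval R ?B (\<lambda>_. P) Q m = Q m \<otimes> mpow R (\<lambda>_. e) m"
    if Q: "Q \<in> pfilt R {v} ?q d" and m: "size m = d" "set_mset m \<subseteq> {v}" for Q d m
  proof -
    note Qc = pfilt_carrier[OF Q]
    have cl: "peval R ?B (\<lambda>_. P) Q \<in> carrier ?B" "peval R ?B (\<lambda>_. L) Q \<in> carrier ?B"
      using Qc P L by (auto intro!: B.peval_closed)
    have "(peval R ?B (\<lambda>_. P) Q \<ominus>\<^bsub>?B\<^esub> peval R ?B (\<lambda>_. L) Q) m = \<zero>"
      using m by (intro pfiltD[OF approx[OF Q]]) auto
    then have "peval R ?B (\<lambda>_. P) Q m = peval R ?B (\<lambda>_. L) Q m"
      using pa_carrierD(1)[OF cl(1)] pa_carrierD(1)[OF cl(2)] by (simp add: pa_minus_coeff[OF cl])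
    then show ?thesis unfolding L_def using peval_single_pmonom_coeff[OF Qc e m(2)] by simp
  qed
  have "P {#v#} = P {#v#} \<otimes> mpow R (\<lambda>_. e) {#v#}"
    using coeff[OF P1, of "{#v#}"] PP by simp
  moreover have "mpow R (\<lambda>_. e) {#v#} = e" using e mpow_add_mset[of v "{#}" "\<lambda>_. e"] by simp
  ultimately have ee: "e \<otimes> e = e" by (simp add: e_def)
  have ePL: "peval R ?B (\<lambda>_. P) L = e \<odot>\<^bsub>?B\<^esub> P"
    using e P B.S.mpow_add_mset[of v "{#}" "\<lambda>_. P"] by (simp add: L_def B.peval_pmonom)
  have step: "P \<ominus>\<^bsub>?B\<^esub> L \<in> pfilt R {v} ?q (Suc d)" if d: "2 \<le> d" and h: "P \<ominus>\<^bsub>?B\<^esub> L \<in> pfilt R {v} ?q d" for d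
  proof (rule pfiltI[OF PL])
    fix m :: "'v multiset"
    assume "size (filter_mset ?q m) < Suc d"
    then consider "size m < d" | "size m = d" "\<not> set_mset m \<subseteq> {v}" | "size m = d" "set_mset m \<subseteq> {v}"
      unfolding filter_mset_True by linarith
    then show "(P \<ominus>\<^bsub>?B\<^esub> L) m = \<zero>"
    proof cases
      case 1
      then show ?thesis using pfiltD[OF h] by simp
    next
      case 2
      then show ?thesis using pa_carrierD(3)[OF PL] by blast
    next
      case 3
      have "m \<noteq> {#}" "m \<noteq> {#v#}" using 3 d by auto
      then have hm: "(P \<ominus>\<^bsub>?B\<^esub> L) m = P m" and em: "mpow R (\<lambda>_. e) m = e"
        using c e ee by (auto simp: PLm minus_eq mpow_idem)
      have hom: "peval R ?B (\<lambda>_. P) \<in> alg_hom R ?B ?B" using P by (intro B.peval_alg_hom) auto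
      have "peval R ?B (\<lambda>_. P) (P \<ominus>\<^bsub>?B\<^esub> L \<oplus>\<^bsub>?B\<^esub> L)
          = peval R ?B (\<lambda>_. P) (P \<ominus>\<^bsub>?B\<^esub> L) \<oplus>\<^bsub>?B\<^esub> e \<odot>\<^bsub>?B\<^esub> P"
        using PL L by (simp add: alg_homD(2)[OF hom] ePL)
      moreover have "P \<ominus>\<^bsub>?B\<^esub> L \<oplus>\<^bsub>?B\<^esub> L = P" using P L by (simp add: B.S.minus_add_cancel)
      ultimately have "P m = peval R ?B (\<lambda>_. P) (P \<ominus>\<^bsub>?B\<^esub> L) m \<oplus> e \<otimes> P m"
        using PP by (simp add: pa_add pa_smult fun_eq_iff)
      also have "peval R ?B (\<lambda>_. P) (P \<ominus>\<^bsub>?B\<^esub> L) m = P m \<otimes> e"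
        using coeff[OF h 3] hm em by simp
      finally have *: "P m = P m \<otimes> e \<oplus> e \<otimes> P m" .
      have "e \<otimes> P m = e \<otimes> (P m \<otimes> e \<oplus> e \<otimes> P m)" by (rule arg_cong[OF *])
      also have "\<dots> = (e \<otimes> e) \<otimes> P m \<oplus> (e \<otimes> e) \<otimes> P m" using c[of m] e by (simp add: r_distr m_assoc m_comm m_lcomm)
      finally have "e \<otimes> P m = e \<otimes> P m \<oplus> e \<otimes> P m" by (simp add: ee)
      then have "e \<otimes> P m = \<zero>" using c[of m] e using add.l_cancel_one[of "e \<otimes> P m" "e \<otimes> P m"] by simp
      moreover have "P m \<otimes> e = e \<otimes> P m" using c[of m] e by (simp add: m_comm)
      ultimately have "P m = \<zero> \<oplus> \<zero>" using * by metis
      then show ?thesis by (simp add: hm)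
    qed
  qed
  have all: "P \<ominus>\<^bsub>?B\<^esub> L \<in> pfilt R {v} ?q (d + 2)" for d
  proof (induction d)
    case (Suc d)
    then show ?case using step[of "d + 2"] by simp
  qed (use PL2 in \<open>simp add: numeral_2_eq_2\<close>)
  have "P m = L m" for m
  proof -
    have "(P \<ominus>\<^bsub>?B\<^esub> L) m = \<zero>" by (rule pfiltD[OF all[of "size m"]]) simp
    then show ?thesis using c pa_carrierD(1)[OF L] by (simp add: pa_minus_coeff[OF P L])
  qed
  then have "P = L" by (rule ext)
  then show "P = pmonom R (P {#v#}) {#v#}" unfolding L_def e_def .
  show "P {#v#} \<otimes> P {#v#} = P {#v#}" using ee by (simp add: e_def)
qed

text \<open>The constant term \<open>q {#}\<close> is a fixed point of \<open>q\<close>; translating it to the origin reduces to the previous lemma.\<close>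

lemma uni_retract:
  fixes v :: 'v
  assumes q: "q \<in> carrier (poly_alg R {v})" and qq: "peval R (poly_alg R {v}) (\<lambda>_. q) q = q"
  shows "q {#v#} \<otimes> q {#v#} = q {#v#}" and "q {#v#} \<otimes> q {#} = \<zero>"
    and "2 \<le> size m \<Longrightarrow> q m = \<zero>"
proof -
  let ?B = "poly_alg R {v}"
  interpret B: alg R ?B by (rule pa_alg)
  define V where "V = (indexed_var v :: 'v multiset \<Rightarrow> 'a)"
  define c where "c = (pmonom R (q {#}) {#} :: 'v multiset \<Rightarrow> 'a)"
  define ev where "ev u = peval R ?B (\<lambda>_::'v. u)" for u
  have q0: "q {#} \<in> carrier R" using pa_carrierD(1)[OF q] .
  have V: "V \<in> carrier ?B" and c: "c \<in> carrier ?B" using q0 by (auto simp: V_def c_def)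
  have hom: "ev u \<in> alg_hom R ?B ?B" if "u \<in> carrier ?B" for u
    unfolding ev_def using that by (intro B.peval_alg_hom) auto
  note hD = alg_homD[OF hom]
  have comp: "ev u (ev w Q) = ev (ev u w) Q"
    if "u \<in> carrier ?B" "w \<in> carrier ?B" "Q \<in> carrier ?B" for u w Q
    using peval_comp[OF pa_alg pa_alg hom[OF that(1)], of "\<lambda>_. w" "{v}" Q] that by (simp add: ev_def)
  have evV: "ev u V = u" if "u \<in> carrier ?B" for u
    using that B.peval_var[of "\<lambda>_. u" v] by (simp add: ev_def V_def)
  have evc: "ev u c = c" if "u \<in> carrier ?B" for u
    using that q0 B.peval_pmonom[of "q {#}" "{#}" "\<lambda>_. u"]
    by (simp add: ev_def c_def pa_one pmonom_smult)
  have minus: "ev u (P \<ominus>\<^bsub>?B\<^esub> Q) = ev u P \<ominus>\<^bsub>?B\<^esub> ev u Q"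
    if "u \<in> carrier ?B" "P \<in> carrier ?B" "Q \<in> carrier ?B" for u P Q
    using that alg_hom_minus[OF pa_alg pa_alg hom[OF that(1)]] by simp
  have z: "\<zero>\<^bsub>?B\<^esub> \<in> carrier ?B" by (rule B.S.zero_closed)
  have ev0: "ev \<zero>\<^bsub>?B\<^esub> Q m = (if m = {#} then Q {#} else \<zero>)" if Q: "Q \<in> carrier ?B" for Q m
  proof (cases "set_mset m \<subseteq> {v}")
    case True
    have "pmonom R \<zero> {#v#} = \<zero>\<^bsub>?B\<^esub>" by (auto simp: pmonom_def pa_zero)
    with peval_single_pmonom_coeff[OF Q zero_closed True]
    have "ev \<zero>\<^bsub>?B\<^esub> Q m = Q m \<otimes> mpow R (\<lambda>_. \<zero>) m" unfolding ev_def by simp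
    then show ?thesis using pa_carrierD(1)[OF Q] by (auto simp: mpow_idem)
  next
    case False
    then show ?thesis using pa_carrierD(3)[OF hD(1)[OF z Q], of m] by auto
  qed
  have ev0q: "ev \<zero>\<^bsub>?B\<^esub> q = c" using ev0[OF q] by (auto simp: c_def pmonom_def)
  have "ev c q = c"
    using comp[OF z q q] qq by (simp add: ev_def[of q] ev0q)
  \<comment> \<open>Conjugating \<open>q\<close> by the translation by \<open>c\<close> preserves
    the equation q(q) = q, and p(0) = q(c) - c = 0.\<close>
  define p where "p = ev (V \<oplus>\<^bsub>?B\<^esub> c) q \<ominus>\<^bsub>?B\<^esub> c"
  have Vc: "V \<oplus>\<^bsub>?B\<^esub> c \<in> carrier ?B" using V c by simp
  have eq: "ev (V \<oplus>\<^bsub>?B\<^esub> c) q \<in> carrier ?B" using hD(1)[OF Vc q] .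
  have p: "p \<in> carrier ?B" using eq c by (simp add: p_def)
  have pc: "p \<oplus>\<^bsub>?B\<^esub> c = ev (V \<oplus>\<^bsub>?B\<^esub> c) q"
    using eq c by (simp add: p_def B.S.minus_add_cancel)
  have "ev p p = ev p (ev (V \<oplus>\<^bsub>?B\<^esub> c) q) \<ominus>\<^bsub>?B\<^esub> c"
    using minus[OF p eq c] evc[OF p] by (simp add: p_def)
  also have "ev p (ev (V \<oplus>\<^bsub>?B\<^esub> c) q) = ev (p \<oplus>\<^bsub>?B\<^esub> c) q"
    using comp[OF p Vc q] by (simp add: hD(2)[OF p V c] evV[OF p] evc[OF p])
  also have "\<dots> = ev (V \<oplus>\<^bsub>?B\<^esub> c) (ev q q)" using comp[OF Vc q q] by (simp add: pc)
  also have "ev q q = q" using qq by (simp add: ev_def)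
  finally have pp: "ev p p = p" by (simp add: p_def)
  have "ev \<zero>\<^bsub>?B\<^esub> p = ev (ev \<zero>\<^bsub>?B\<^esub> (V \<oplus>\<^bsub>?B\<^esub> c)) q \<ominus>\<^bsub>?B\<^esub> c"
    unfolding p_def using minus[OF z eq c] comp[OF z Vc q] evc[OF z] by simp
  also have "ev \<zero>\<^bsub>?B\<^esub> (V \<oplus>\<^bsub>?B\<^esub> c) = c"
    using c by (simp only: hD(2)[OF z V c] evV[OF z] evc[OF z] B.S.l_zero)
  finally have "ev \<zero>\<^bsub>?B\<^esub> p = \<zero>\<^bsub>?B\<^esub>" using \<open>ev c q = c\<close> c by (simp add: B.S.minus_eq B.S.r_neg)
  then have p0: "p {#} = \<zero>" using ev0[OF p, of "{#}"] by (simp add: pa_zero)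
  define e where "e = p {#v#}"
  note pe = uni_retract_origin[OF p p0 pp[unfolded ev_def], folded e_def]
  have e: "e \<in> carrier R" "e \<otimes> e = e" using pa_carrierD(1)[OF p] pe(1) by (auto simp: e_def)
  have Vmc: "V \<ominus>\<^bsub>?B\<^esub> c \<in> carrier ?B" using V c by simp
  \<comment> \<open>Undoing the translation yields q = e (V - c) + c; its constant term then forces
    e c = 0.\<close>
  have "q = ev (V \<ominus>\<^bsub>?B\<^esub> c) (ev (V \<oplus>\<^bsub>?B\<^esub> c) q)"
  proof -
    have "ev (V \<ominus>\<^bsub>?B\<^esub> c) (V \<oplus>\<^bsub>?B\<^esub> c) = V"
      using V c by (simp add: hD(2)[OF Vmc V c] evV[OF Vmc] evc[OF Vmc] B.S.minus_add_cancel)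
    moreover have "ev V q = q"
      unfolding ev_def
      by (rule B.peval_unique[of "\<lambda>P. P" "{v}", symmetric]) (use q V in \<open>auto simp: V_def pa_incl\<close>)
    ultimately show ?thesis using comp[OF Vmc Vc q] by simp
  qed
  also have "\<dots> = ev (V \<ominus>\<^bsub>?B\<^esub> c) p \<oplus>\<^bsub>?B\<^esub> c"
    using pc hD(2)[OF Vmc p c] evc[OF Vmc] by simp
  also have "ev (V \<ominus>\<^bsub>?B\<^esub> c) p = e \<odot>\<^bsub>?B\<^esub> (V \<ominus>\<^bsub>?B\<^esub> c)"
  proof -
    have "p = e \<odot>\<^bsub>?B\<^esub> V" using pe(2) e by (simp add: V_def indexed_var_pmonom pmonom_smult)
    then show ?thesis using hD(5)[OF Vmc e(1) V] evV[OF Vmc] by simp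
  qed
  finally have "q = e \<odot>\<^bsub>?B\<^esub> (V \<ominus>\<^bsub>?B\<^esub> c) \<oplus>\<^bsub>?B\<^esub> c" .
  then have qm: "q m = e \<otimes> (V m \<ominus> c m) \<oplus> c m" for m
    using pa_minus_coeff[OF V c, of m] by (simp add: fun_eq_iff pa_add pa_smult)
  have Vm: "V m = (if m = {#v#} then \<one> else \<zero>)" for m by (simp add: V_def indexed_var_pmonom pmonom_def)
  have cm: "c m = (if m = {#} then q {#} else \<zero>)" for m by (simp add: c_def pmonom_def)
  have "q {#v#} = e" using e qm[of "{#v#}"] by (simp add: Vm cm minus_eq)
  moreover have "e \<otimes> q {#} = \<zero>"
  proof -
    have "q {#} = e \<otimes> (\<zero> \<ominus> q {#}) \<oplus> q {#}" using qm[of "{#}"] Vm[of "{#}"] cm[of "{#}"] by simp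
    moreover have cl: "e \<otimes> (\<zero> \<ominus> q {#}) \<in> carrier R" using e q0 by simp
    ultimately have "e \<otimes> (\<zero> \<ominus> q {#}) = \<zero>"
      using add.r_cancel_one'[OF q0 cl] by (simp only:)
    moreover have "e \<otimes> q {#} = \<ominus> (e \<otimes> (\<zero> \<ominus> q {#}))" using e q0 by (simp add: minus_eq r_minus)
    ultimately show ?thesis by simp
  qed
  ultimately show "q {#v#} \<otimes> q {#v#} = q {#v#}" "q {#v#} \<otimes> q {#} = \<zero>" using e by auto
  show "q m = \<zero>" if "2 \<le> size m"
  proof -
    have "m \<noteq> {#}" "m \<noteq> {#v#}" using that by auto
    then show ?thesis using e qm[of m] by (simp add: Vm cm minus_eq)
  qed
qed

end

section \<open>Algebras presented by idempotents\<close>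

text \<open>This describes \<open>C\<close> as R[X_i | i in J] modulo the elements (1 -
  \<epsilon>_i) X_i. In that quotient the coefficient of a monomial counts only up to the product of
  the idempotents of its variables, which is what the last clause expresses. The values of
  \<open>\<epsilon>\<close> lie in \<open>R\<close> at every index, so
  \<open>mpow R \<epsilon> m\<close> is an element of \<open>R\<close> for every
  \<open>m\<close>.\<close>

definition idem_presentation ::
    "('a, 'r) ring_scheme \<Rightarrow> ('a, 'b, 'm) module_scheme \<Rightarrow> 'v set \<Rightarrow> ('v \<Rightarrow> 'a) \<Rightarrow> ('v \<Rightarrow> 'b) \<Rightarrow> bool"
  where "idem_presentation R C J \<epsilon> w \<longleftrightarrow>
    (\<forall>i. \<epsilon> i \<in> carrier R) \<and>
    (\<forall>i\<in>J. \<epsilon> i \<otimes>\<^bsub>R\<^esub> \<epsilon> i = \<epsilon> i \<and> w i \<in> carrier C \<and> \<epsilon> i \<odot>\<^bsub>C\<^esub> w i = w i) \<and>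
    peval R C w ` carrier (poly_alg R J) = carrier C \<and>
    (\<forall>P\<in>carrier (poly_alg R J). peval R C w P = \<zero>\<^bsub>C\<^esub> \<longrightarrow> (\<forall>m. P m \<otimes>\<^bsub>R\<^esub> mpow R \<epsilon> m = \<zero>\<^bsub>R\<^esub>))"

lemma (in comm_monoid) mpow_multf:
  assumes "\<And>i. i \<in># m \<Longrightarrow> y i \<in> carrier G" and "\<And>i. i \<in># m \<Longrightarrow> z i \<in> carrier G"
  shows "mpow G (\<lambda>i. y i \<otimes> z i) m = mpow G y m \<otimes> mpow G z m"
  using assms
proof (induction m)
  case (add i m)
  then have "y i \<in> carrier G" "z i \<in> carrier G" "mpow G y m \<in> carrier G" "mpow G z m \<in> carrier G"
    by (auto intro!: mpow_closed)
  moreover have "mpow G (\<lambda>i. y i \<otimes> z i) (add_mset i m) = (y i \<otimes> z i) \<otimes> mpow G (\<lambda>i. y i \<otimes> z i) m"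
    "mpow G y (add_mset i m) = y i \<otimes> mpow G y m" "mpow G z (add_mset i m) = z i \<otimes> mpow G z m"
    using add.prems by (auto intro!: mpow_add_mset)
  ultimately show ?case using add by (simp add: m_ac)
qed simp

lemma (in cring) mpow_idem_fun:
  assumes "\<And>i. i \<in># m \<Longrightarrow> \<epsilon> i \<in> carrier R" and "\<And>i. i \<in># m \<Longrightarrow> \<epsilon> i \<otimes> \<epsilon> i = \<epsilon> i"
  shows "mpow R \<epsilon> m \<otimes> mpow R \<epsilon> m = mpow R \<epsilon> m"
proof -
  have "mpow R \<epsilon> m \<otimes> mpow R \<epsilon> m = mpow R (\<lambda>i. \<epsilon> i \<otimes> \<epsilon> i) m"
    using assms by (intro mpow_multf[symmetric]) auto
  also have "\<dots> = mpow R \<epsilon> m" using assms by (intro mpow_cong) auto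
  finally show ?thesis .
qed

context alg
begin

lemma smult_mult_smult:
  assumes "r \<in> carrier R" "s \<in> carrier R" "x \<in> carrier S" "z \<in> carrier S"
  shows "(r \<odot>\<^bsub>S\<^esub> x) \<otimes>\<^bsub>S\<^esub> (s \<odot>\<^bsub>S\<^esub> z) = (r \<otimes> s) \<odot>\<^bsub>S\<^esub> (x \<otimes>\<^bsub>S\<^esub> z)"
  using assms by (simp add: smult_assoc2 smult_assoc2_right smult_assoc1[symmetric] R.m_comm)

lemma mpow_smult:
  assumes "\<And>i. i \<in># m \<Longrightarrow> \<epsilon> i \<in> carrier R" and "\<And>i. i \<in># m \<Longrightarrow> w i \<in> carrier S"
  shows "mpow S (\<lambda>i. \<epsilon> i \<odot>\<^bsub>S\<^esub> w i) m = mpow R \<epsilon> m \<odot>\<^bsub>S\<^esub> mpow S w m"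
  using assms
proof (induction m)
  case (add i m)
  then have "\<epsilon> i \<in> carrier R" "w i \<in> carrier S" "mpow R \<epsilon> m \<in> carrier R" "mpow S w m \<in> carrier S"
    by (auto intro!: R.mpow_closed S.mpow_closed)
  moreover have "mpow S (\<lambda>i. \<epsilon> i \<odot>\<^bsub>S\<^esub> w i) (add_mset i m)
      = (\<epsilon> i \<odot>\<^bsub>S\<^esub> w i) \<otimes>\<^bsub>S\<^esub> mpow S (\<lambda>i. \<epsilon> i \<odot>\<^bsub>S\<^esub> w i) m"
    "mpow R \<epsilon> (add_mset i m) = \<epsilon> i \<otimes> mpow R \<epsilon> m" "mpow S w (add_mset i m) = w i \<otimes>\<^bsub>S\<^esub> mpow S w m"
    using add.prems by (auto intro!: R.mpow_add_mset S.mpow_add_mset)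
  ultimately show ?case using add by (simp add: smult_mult_smult)
qed simp

lemma peval_idem_cong:
  assumes P: "P \<in> carrier (poly_alg R I)" and y: "y \<in> I \<rightarrow> carrier S" "y' \<in> I \<rightarrow> carrier S"
    and u: "u \<in> carrier R" "\<And>m. P m \<otimes> u = P m" "\<And>i. i \<in> I \<Longrightarrow> u \<odot>\<^bsub>S\<^esub> y i = u \<odot>\<^bsub>S\<^esub> y' i"
  shows "peval R S y P = peval R S y' P"
proof -
  have m: "u \<odot>\<^bsub>S\<^esub> mpow S y m = u \<odot>\<^bsub>S\<^esub> mpow S y' m" if "set_mset m \<subseteq> I" for m
    using that
  proof (induction m)
    case (add i m)
    have cl: "y i \<in> carrier S" "y' i \<in> carrier S" "mpow S y m \<in> carrier S" "mpow S y' m \<in> carrier S"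
      using add.prems y by (auto intro!: S.mpow_closed)
    have eq: "mpow S y (add_mset i m) = y i \<otimes>\<^bsub>S\<^esub> mpow S y m" "mpow S y' (add_mset i m) = y' i \<otimes>\<^bsub>S\<^esub> mpow S y' m"
      by (rule S.mpow_add_mset, use add.prems y in auto)+
    have "u \<odot>\<^bsub>S\<^esub> (y i \<otimes>\<^bsub>S\<^esub> mpow S y m) = (u \<odot>\<^bsub>S\<^esub> y i) \<otimes>\<^bsub>S\<^esub> mpow S y m"
      using cl u(1) by (simp add: smult_assoc2)
    also have "\<dots> = (u \<odot>\<^bsub>S\<^esub> y' i) \<otimes>\<^bsub>S\<^esub> mpow S y m" using add.prems u(3)[of i] by simp
    also have "\<dots> = y' i \<otimes>\<^bsub>S\<^esub> (u \<odot>\<^bsub>S\<^esub> mpow S y m)"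
      using cl u(1) by (simp add: smult_assoc2 smult_assoc2_right)
    also have "\<dots> = y' i \<otimes>\<^bsub>S\<^esub> (u \<odot>\<^bsub>S\<^esub> mpow S y' m)" using add by simp
    also have "\<dots> = u \<odot>\<^bsub>S\<^esub> (y' i \<otimes>\<^bsub>S\<^esub> mpow S y' m)" using cl u(1) by (simp add: smult_assoc2_right)
    finally show ?case by (simp add: eq)
  qed simp
  have "P m \<odot>\<^bsub>S\<^esub> mpow S y m = P m \<odot>\<^bsub>S\<^esub> mpow S y' m \<and> P m \<odot>\<^bsub>S\<^esub> mpow S y' m \<in> carrier S" if "P m \<noteq> \<zero>" for m
  proof -
    have Pm: "P m \<in> carrier R" "set_mset m \<subseteq> I" using R.pa_carrierD[OF P] that by auto
    have cl: "mpow S y m \<in> carrier S" "mpow S y' m \<in> carrier S" using Pm y by (auto intro!: S.mpow_closed)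
    have "(P m \<otimes> u) \<odot>\<^bsub>S\<^esub> mpow S y m = (P m \<otimes> u) \<odot>\<^bsub>S\<^esub> mpow S y' m"
      using Pm u(1) cl m[OF Pm(2)] by (simp add: smult_assoc1)
    then show ?thesis using u(2) Pm cl by simp
  qed
  then show ?thesis unfolding peval_def by (intro S.add.finprod_cong') auto
qed

text \<open>The monomial in \<open>w\<close> absorbs the product of its idempotents. This gives a
  normal form: coefficients may be projected to the ideals in which they matter, without a change of
  value.\<close>

lemma peval_mult_mpow:
  assumes P: "P \<in> carrier (poly_alg R I)"
    and \<epsilon>: "\<And>i. \<epsilon> i \<in> carrier R" and w: "\<And>i. i \<in> I \<Longrightarrow> w i \<in> carrier S"
    and \<epsilon>w: "\<And>i. i \<in> I \<Longrightarrow> \<epsilon> i \<odot>\<^bsub>S\<^esub> w i = w i"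
  shows "(\<lambda>m. P m \<otimes> mpow R \<epsilon> m) \<in> carrier (poly_alg R I)"
    and "peval R S w (\<lambda>m. P m \<otimes> mpow R \<epsilon> m) = peval R S w P"
proof -
  let ?Q = "\<lambda>m. P m \<otimes> mpow R \<epsilon> m"
  note D = R.pa_carrierD[OF P]
  have em: "mpow R \<epsilon> m \<in> carrier R" for m using \<epsilon> by auto
  have e: "mpow S w m \<in> carrier S" "mpow R \<epsilon> m \<odot>\<^bsub>S\<^esub> mpow S w m = mpow S w m"
    if "set_mset m \<subseteq> I" for m
  proof -
    show "mpow S w m \<in> carrier S" using that w by (auto intro!: S.mpow_closed)
    have "mpow R \<epsilon> m \<odot>\<^bsub>S\<^esub> mpow S w m = mpow S (\<lambda>i. \<epsilon> i \<odot>\<^bsub>S\<^esub> w i) m"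
      using that \<epsilon> w by (intro mpow_smult[symmetric]) auto
    also have "\<dots> = mpow S w m" using that \<epsilon>w w by (intro S.mpow_cong) auto
    finally show "mpow R \<epsilon> m \<odot>\<^bsub>S\<^esub> mpow S w m = mpow S w m" .
  qed
  have sub: "{m. ?Q m \<noteq> \<zero>} \<subseteq> {m. P m \<noteq> \<zero>}" using em by auto
  show Q: "?Q \<in> carrier (poly_alg R I)"
    using sub D em finite_subset[OF sub D(2)] by (intro R.pa_carrierI) auto
  have y: "w \<in> I \<rightarrow> carrier S" using w by auto
  have "peval R S w ?Q = (\<Oplus>\<^bsub>S\<^esub>m\<in>{m. P m \<noteq> \<zero>}. ?Q m \<odot>\<^bsub>S\<^esub> mpow S w m)"
    using sub D by (intro peval_eq_finsum[OF Q y]) auto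
  also have "\<dots> = peval R S w P"
    unfolding peval_def
  proof (intro S.add.finprod_cong')
    fix m
    assume "m \<in> {m. P m \<noteq> \<zero>}"
    then have m: "set_mset m \<subseteq> I" using D(3) by auto
    show "?Q m \<odot>\<^bsub>S\<^esub> mpow S w m = P m \<odot>\<^bsub>S\<^esub> mpow S w m"
      using D em e[OF m] by (simp add: smult_assoc1)
  qed (use D e(1) in auto)
  finally show "peval R S w ?Q = peval R S w P" .
qed

end

section \<open>Retracts of polynomial algebras\<close>

text \<open>A retract up to isomorphism: \<open>\<iota>\<close> is a section of evaluation at
  \<open>y\<close>, and following evaluation by \<open>\<iota>\<close> is a retraction of the
  polynomial ring. Since \<open>C\<close> is kept apart from that ring, \<open>J\<close> can shrink
  while \<open>C\<close> stays.\<close>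

locale poly_retract = alg R C
  for R :: "('a, 'r) ring_scheme" (structure) and C :: "('a, 'b, 'm) module_scheme" +
  fixes J :: "'v set" and y :: "'v \<Rightarrow> 'b" and \<iota> :: "'b \<Rightarrow> 'v multiset \<Rightarrow> 'a"
  assumes y: "y \<in> J \<rightarrow> carrier C"
    and hom: "\<iota> \<in> alg_hom R C (poly_alg R J)"
    and sect: "\<And>z. z \<in> carrier C \<Longrightarrow> peval R C y (\<iota> z) = z"
begin

abbreviation "B \<equiv> poly_alg R J"

sublocale B: alg R B by (rule R.pa_alg)

definition "f i = \<iota> (y i)"

lemma algC: "alg R C" ..

lemma f_closed [intro]: "i \<in> J \<Longrightarrow> f i \<in> carrier B"
  using y alg_homD(1)[OF hom] by (auto simp: f_def)

lemma f_Pi: "f \<in> J \<rightarrow> carrier B"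
  by auto

lemma \<iota>_inj: "z \<in> carrier C \<Longrightarrow> z' \<in> carrier C \<Longrightarrow> \<iota> z = \<iota> z' \<Longrightarrow> z = z'"
  by (metis sect)

lemma \<iota>_peval:
  assumes "w \<in> I \<rightarrow> carrier C" and "P \<in> carrier (poly_alg R I)"
  shows "\<iota> (peval R C w P) = peval R B (\<lambda>i. \<iota> (w i)) P"
  by (rule peval_comp[OF algC R.pa_alg hom assms])

text \<open>Idempotence of the retraction, read off at a single variable. All information on the
  \<open>f i\<close> is extracted from this equation.\<close>

lemma peval_f: "i \<in> J \<Longrightarrow> peval R B f (f i) = f i"
  using \<iota>_peval[OF y, of "f i"] sect y unfolding f_def[symmetric, abs_def]
  by (metis PiE f_closed f_def)

end

text \<open>The state in which elimination stops: each remaining monomial image is nonzero and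
  contains its own variable.\<close>

locale reduced_retract = poly_retract +
  fixes i0
  assumes i0: "i0 \<in> J"
    and mono: "\<And>i. i \<in> J - {i0} \<Longrightarrow>
      \<exists>c m. c \<in> carrier R \<and> c \<noteq> \<zero> \<and> i \<in># m \<and> set_mset m \<subseteq> J \<and> \<iota> (y i) = pmonom R c m"
begin

text \<open>Write the exponent as \<open>i\<close> plus \<open>m'\<close> and let Q be the product
  of the images along \<open>m'\<close>. Then f_i(f) = f_i reads f_i = c f_i Q, and the coefficient
  at \<open>m\<close> gives c = c^2 Q(0), so \<open>mu\<close> is the constant term of Q. If
  \<open>m'\<close> contained some j other than \<open>i0\<close>, the factor f_j, which has no
  constant term, would make Q(0) and hence c zero.\<close>

lemma monomial_form:
  assumes i: "i \<in> J - {i0}"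
  shows "\<exists>lam mu b. lam \<in> carrier R \<and> mu \<in> carrier R \<and> lam = lam \<otimes> (lam \<otimes> mu) \<and>
    f i = pmonom R lam (add_mset i (replicate_mset b i0))"
proof -
  obtain c m where c: "c \<in> carrier R" "c \<noteq> \<zero>" and m: "i \<in># m" "set_mset m \<subseteq> J"
    and fi: "f i = pmonom R c m"
    using mono[OF i] by (auto simp: f_def)
  obtain m' where m': "m = add_mset i m'" using m(1) by (auto dest: multi_member_split)
  define Q where "Q = mpow B f m'"
  have Q: "Q \<in> carrier B" using m m' unfolding Q_def by (intro B.S.mpow_closed) auto
  have "f i = peval R B f (f i)" using i by (simp add: peval_f)
  also have "\<dots> = c \<odot>\<^bsub>B\<^esub> mpow B f m" unfolding fi using c m by (intro B.peval_pmonom) auto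
  also have "mpow B f m = f i \<otimes>\<^bsub>B\<^esub> Q"
    using m unfolding m' Q_def by (intro B.S.mpow_add_mset) auto
  finally have "f i m = c \<otimes> (f i \<otimes>\<^bsub>B\<^esub> Q) m" by (simp add: R.pa_smult fun_eq_iff)
  moreover have "(f i \<otimes>\<^bsub>B\<^esub> Q) m = c \<otimes> Q {#}"
    using R.pmonom_mult_coeff(1)[OF c(1) R.pa_carrierD(1)[OF Q], where m = m and k = "{#}" and I = J] by (simp add: fi)
  moreover have "f i m = c" by (simp add: fi pmonom_def)
  ultimately have cQ: "c = c \<otimes> (c \<otimes> Q {#})" by (simp only:)
  have "j = i0" if j: "j \<in># m'" for j
  proof (rule ccontr)
    assume "j \<noteq> i0"
    then have jJ: "j \<in> J - {i0}" using j m m' by auto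
    obtain d k where d: "d \<in> carrier R" and k: "j \<in># k" and fj: "f j = pmonom R d k"
      using mono[OF jJ] by (auto simp: f_def)
    obtain m'' where m'': "m' = add_mset j m''" using j by (auto dest: multi_member_split)
    have Q': "mpow B f m'' \<in> carrier B" using m m' m'' by (intro B.S.mpow_closed) auto
    have "Q = f j \<otimes>\<^bsub>B\<^esub> mpow B f m''"
      using m m' unfolding m'' Q_def by (intro B.S.mpow_add_mset) auto
    moreover have "(pmonom R d k \<otimes>\<^bsub>B\<^esub> mpow B f m'') {#} = \<zero>"
      using k by (intro R.pmonom_mult_coeff(2)[OF d R.pa_carrierD(1)[OF Q']]) auto
    ultimately have "Q {#} = \<zero>" by (simp add: fj)
    then have "c \<otimes> (c \<otimes> Q {#}) = \<zero>" using c by simp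
    with cQ c(2) show False by (simp only:)
  qed
  then have "m' = replicate_mset (size m') i0"
    by (intro set_mset_subset_singletonD) auto
  then have "f i = pmonom R c (add_mset i (replicate_mset (size m') i0))" using fi m' by simp
  then show ?thesis using c(1) cQ R.pa_carrierD(1)[OF Q]
    by (intro exI[of _ c] exI[of _ "Q {#}"] exI[of _ "size m'"] conjI)
qed

text \<open>The three witnesses depend on each other, so each is chosen for the existential
  statement that the previous choice leaves.\<close>

definition "lam = (\<lambda>i. SOME c. \<exists>mu b. c \<in> carrier R \<and> mu \<in> carrier R \<and> c = c \<otimes> (c \<otimes> mu) \<and>
    f i = pmonom R c (add_mset i (replicate_mset b i0)))"

definition "mu = (\<lambda>i. SOME mu. \<exists>b. lam i \<in> carrier R \<and> mu \<in> carrier R \<and> lam i = lam i \<otimes> (lam i \<otimes> mu) \<and>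
    f i = pmonom R (lam i) (add_mset i (replicate_mset b i0)))"

definition "b = (\<lambda>i. SOME b. lam i \<in> carrier R \<and> mu i \<in> carrier R \<and> lam i = lam i \<otimes> (lam i \<otimes> mu i) \<and>
    f i = pmonom R (lam i) (add_mset i (replicate_mset b i0)))"

lemma f_monomial:
  assumes "i \<in> J - {i0}"
  shows "lam i \<in> carrier R" "mu i \<in> carrier R" "lam i = lam i \<otimes> (lam i \<otimes> mu i)"
    "f i = pmonom R (lam i) (add_mset i (replicate_mset (b i) i0))"
proof -
  have "\<exists>mu b. lam i \<in> carrier R \<and> mu \<in> carrier R \<and> lam i = lam i \<otimes> (lam i \<otimes> mu) \<and>
      f i = pmonom R (lam i) (add_mset i (replicate_mset b i0))"
    unfolding lam_def by (rule someI_ex) (rule monomial_form[OF assms])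
  then have "\<exists>b. lam i \<in> carrier R \<and> mu i \<in> carrier R \<and> lam i = lam i \<otimes> (lam i \<otimes> mu i) \<and>
      f i = pmonom R (lam i) (add_mset i (replicate_mset b i0))"
    unfolding mu_def by (rule someI_ex)
  then have *: "lam i \<in> carrier R \<and> mu i \<in> carrier R \<and> lam i = lam i \<otimes> (lam i \<otimes> mu i) \<and>
      f i = pmonom R (lam i) (add_mset i (replicate_mset (b i) i0))"
    unfolding b_def by (rule someI_ex)
  show "lam i \<in> carrier R" by (rule conjunct1[OF *])
  show "mu i \<in> carrier R" by (rule conjunct1[OF conjunct2[OF *]])
  show "lam i = lam i \<otimes> (lam i \<otimes> mu i)" by (rule conjunct1[OF conjunct2[OF conjunct2[OF *]]])
  show "f i = pmonom R (lam i) (add_mset i (replicate_mset (b i) i0))"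
    by (rule conjunct2[OF conjunct2[OF conjunct2[OF *]]])
qed

abbreviation "F \<equiv> pfilt R J (\<lambda>i. i \<noteq> i0)"

lemma f_F:
  assumes "i \<in> J" "i \<noteq> i0"
  shows "f i \<in> F 1"
proof (rule R.pfiltI)
  show "f i \<in> carrier B" using assms by auto
  fix m
  assume "size (filter_mset (\<lambda>i. i \<noteq> i0) m) < 1"
  then have "m \<noteq> add_mset i (replicate_mset (b i) i0)" using assms by auto
  then have "pmonom R (lam i) (add_mset i (replicate_mset (b i) i0)) m = \<zero>"
    unfolding pmonom_def by (rule if_not_P)
  then show "f i m = \<zero>" using f_monomial(4)[of i] assms by simp
qed

definition "g = f i0"
definition "e = g {#i0#}"

lemma g_closed [simp, intro]: "g \<in> carrier B"
  using i0 by (auto simp: g_def)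

text \<open>Setting all variables but \<open>i0\<close> to zero turns \<open>g\<close> into a retraction in one variable.\<close>

lemma g_pure:
  shows "e \<otimes> e = e" and "e \<otimes> g {#} = \<zero>"
    and "set_mset m \<subseteq> {i0} \<Longrightarrow> 2 \<le> size m \<Longrightarrow> g m = \<zero>"
proof -
  \<comment> \<open>\<open>E\<close> fixes the variable \<open>i0\<close> and kills the others. It
    is written as a substitution of monomials so that its effect on coefficients is known.\<close>
  define \<kappa> where "\<kappa> i = (if i = i0 then \<one> else \<zero>)" for i
  define E where "E = peval R B (\<lambda>i. pmonom R (\<kappa> i) {#i#})"
  have \<kappa>: "\<kappa> i \<in> carrier R" for i by (simp add: \<kappa>_def)
  have Epi: "(\<lambda>i. pmonom R (\<kappa> i) {#i#}) \<in> J \<rightarrow> carrier B" using \<kappa> by auto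
  have hom: "E \<in> alg_hom R B B" unfolding E_def by (rule B.peval_alg_hom[OF Epi])
  have Ecl: "E P \<in> carrier B" if "P \<in> carrier B" for P using that by (rule alg_homD(1)[OF hom])
  have k1: "mpow R \<kappa> m = \<one>" if "set_mset m \<subseteq> {i0}" for m
    using that
  proof (induction m)
    case (add i m)
    have "mpow R \<kappa> (add_mset i m) = \<kappa> i \<otimes> mpow R \<kappa> m" using \<kappa> by (intro R.mpow_add_mset)
    moreover have "\<kappa> i = \<one>" using add.prems by (simp add: \<kappa>_def)
    ultimately show ?case using add by simp
  qed simp
  have k0: "mpow R \<kappa> m = \<zero>" if "\<not> set_mset m \<subseteq> {i0}" for m
  proof -
    from that obtain i where "i \<in># m" "i \<noteq> i0" by auto
    then show ?thesis using \<kappa> by (intro R.mpow_zero[of i]) (auto simp: \<kappa>_def)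
  qed
  have coeff: "E P m = (if set_mset m \<subseteq> {i0} then P m else \<zero>)" if P: "P \<in> carrier B" for P m
  proof (cases "set_mset m \<subseteq> J")
    case True
    have "inj_on (\<lambda>m. \<Sum>i\<in>#m. {#i#}) {m. set_mset m \<subseteq> J}"
      by (rule inj_on_inverseI[of _ "\<lambda>m. m"]) (simp only: R.sum_mset_single)
    from R.peval_pmonom_coeff[OF P _ _ this True, of \<kappa> J] \<kappa>
    have "E P (\<Sum>i\<in>#m. {#i#}) = P m \<otimes> mpow R \<kappa> m" by (simp add: E_def)
    then have "E P m = P m \<otimes> mpow R \<kappa> m" by (simp only: R.sum_mset_single)
    then show ?thesis using k0 k1 R.pa_carrierD(1)[OF P] by auto
  next
    case False
    then show ?thesis using i0 R.pa_carrierD(3)[OF P, of m] R.pa_carrierD(3)[OF Ecl[OF P], of m] by auto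
  qed
  define g0 where "g0 = E g"
  have g0: "g0 \<in> carrier B" unfolding g0_def by (rule Ecl) simp
  have "g0 \<in> carrier (poly_alg R {i0})"
  proof (rule R.pa_carrierI)
    show "finite {m. g0 m \<noteq> \<zero>}" "\<And>m. g0 m \<in> carrier R" using R.pa_carrierD[OF g0] by auto
    show "set_mset m \<subseteq> {i0}" if "g0 m \<noteq> \<zero>" for m
      using that by (auto simp: g0_def coeff split: if_splits)
  qed
  note g0' = this
  have Ef: "E (f i) = (if i = i0 then g0 else \<zero>\<^bsub>B\<^esub>)" if "i \<in> J" for i
  proof (cases "i = i0")
    case False
    have "E (f i) m = \<zero>" for m
    proof (cases "set_mset m \<subseteq> {i0}")
      case True
      then have "size (filter_mset (\<lambda>i. i \<noteq> i0) m) = 0" by auto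
      then have "f i m = \<zero>" by (intro R.pfiltD[OF f_F]) (use that False in auto)
      then show ?thesis using coeff[OF f_closed[OF that]] by simp
    next
      case ne: False
      then show ?thesis using coeff[OF f_closed[OF that]] by simp
    qed
    then show ?thesis using False by (auto simp: R.pa_zero)
  qed (simp add: g0_def g_def)
  \<comment> \<open>Apply \<open>E\<close> to g = g(f). Every \<open>f i\<close> with
    \<open>i \<noteq> i0\<close> has positive order and is killed, so the right side is
    \<open>g0\<close> substituted into \<open>E g\<close>, that is, into itself.\<close>
  have "g0 = E (peval R B f g)" using peval_f[OF i0] by (simp add: g0_def g_def)
  also have "\<dots> = peval R B (\<lambda>i. E (f i)) g" by (rule peval_comp[OF R.pa_alg R.pa_alg hom f_Pi]) simp
  also have "\<dots> = peval R B (\<lambda>i. peval R B (\<lambda>_. g0) (pmonom R (\<kappa> i) {#i#})) g"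
  proof (rule B.peval_cong[of _ J])
    show "(\<lambda>i. peval R B (\<lambda>_. g0) (pmonom R (\<kappa> i) {#i#})) \<in> J \<rightarrow> carrier B"
      using g0 \<kappa> by (auto intro!: B.peval_closed[of _ J])
    show "E (f i) = peval R B (\<lambda>_. g0) (pmonom R (\<kappa> i) {#i#})" if "i \<in> J" for i
      using that g0 \<kappa> B.S.mpow_add_mset[of i "{#}" "\<lambda>_. g0"]
      by (simp add: Ef B.peval_pmonom) (simp add: \<kappa>_def)
  qed simp
  also have "\<dots> = peval R B (\<lambda>_. g0) (E g)"
    unfolding E_def using g0 Epi
    by (intro peval_comp[OF R.pa_alg R.pa_alg, symmetric] B.peval_alg_hom) auto
  finally have "g0 = peval R B (\<lambda>_. g0) (E g)" .
  then have "peval R B (\<lambda>_. g0) g0 = g0" unfolding g0_def by (rule sym)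
  then have "peval R (poly_alg R {i0}) (\<lambda>_. g0) g0 = g0"
    using R.peval_pa_mono[of "{i0}" J "\<lambda>_. g0" "{i0}" g0] i0 g0' by simp
  note u = R.uni_retract[OF g0' this]
  have eq: "g0 m = g m" if "set_mset m \<subseteq> {i0}" for m using that by (simp add: g0_def coeff)
  have "g0 {#i0#} = e" "g0 {#} = g {#}" by (simp_all add: eq e_def)
  then show "e \<otimes> e = e" "e \<otimes> g {#} = \<zero>" using u(1,2) by simp_all
  show "g m = \<zero>" if "set_mset m \<subseteq> {i0}" "2 \<le> size m"
    using u(3)[OF that(2)] eq[OF that(1)] by simp
qed

end

section \<open>The part of g complementary to e is a polynomial in the monomial images\<close>

context reduced_retract
begin

definition "u = \<one> \<ominus> e"
definition "z = u \<odot>\<^bsub>B\<^esub> g"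

lemma e_closed [simp, intro]: "e \<in> carrier R"
  using R.pa_carrierD(1)[OF g_closed] by (simp add: e_def)

lemma u_closed [simp, intro]: "u \<in> carrier R"
  by (simp add: u_def)

lemma u_e: "u \<otimes> e = \<zero>" and u_u: "u \<otimes> u = u" and e_u: "e \<oplus> u = \<one>"
proof -
  have "u \<otimes> e = e \<ominus> e \<otimes> e" 
    unfolding u_def R.minus_eq using e_closed R.one_closed by algebra
  then show ue: "u \<otimes> e = \<zero>" by (simp add: g_pure(1) R.minus_eq R.r_neg)
  have "u \<otimes> u = u \<ominus> u \<otimes> e" using e_closed u_closed
    by (subst (2) u_def) (simp add: R.minus_eq R.r_distr R.r_minus)
  then show "u \<otimes> u = u" by (simp add: ue R.minus_eq)
  show "e \<oplus> u = \<one>" unfolding u_def R.minus_eq using e_closed R.one_closed by algebra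
qed

lemma z_closed [simp, intro]: "z \<in> carrier B"
  by (simp add: z_def)

text \<open>The factor \<open>u\<close> kills the coefficient \<open>e\<close> of the linear term,
  and \<open>g\<close> has no higher terms in \<open>i0\<close> alone.\<close>

lemma z_pure:
  assumes "set_mset m \<subseteq> {i0}" "m \<noteq> {#}"
  shows "z m = \<zero>"
proof -
  have zm: "z m = u \<otimes> g m" by (simp add: z_def R.pa_smult)
  have "m = replicate_mset (size m) i0" using assms(1) by (rule set_mset_subset_singletonD)
  moreover have "size m \<noteq> 0" using assms(2) by simp
  ultimately consider "m = {#i0#}" | "2 \<le> size m"
    by (metis One_nat_def Suc_lessI less_2_cases_iff linorder_not_less replicate_mset_Suc
        replicate_mset_0 not_gr_zero)
  then show ?thesis
  proof cases
    case 1
    then have "g m = e" by (simp add: e_def)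
    with zm show ?thesis by (simp add: u_e)
  next
    case 2
    with zm show ?thesis by (simp add: g_pure(3)[OF assms(1)])
  qed
qed

text \<open>The coefficients of \<open>z\<close> are fixed by \<open>u\<close>, and u z = u g, so
  \<open>g\<close> may be exchanged for \<open>z\<close> among the arguments in z(f) = z. In the
  resulting equation \<open>z\<close> depends only on itself and on the monomial images, which makes
  iteration possible.\<close>

lemma z_fixed: "peval R B (f(i0 := z)) z = z"
proof -
  have "peval R B f z = u \<odot>\<^bsub>B\<^esub> peval R B f g"
    unfolding z_def by (rule B.peval_smult[of _ J]) (auto simp: f_Pi)
  also have "peval R B f g = g" unfolding g_def by (rule peval_f[OF i0])
  finally have 1: "peval R B f z = z" by (simp add: z_def)
  have "peval R B (f(i0 := z)) z = peval R B f z"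
  proof (rule B.peval_idem_cong[OF z_closed, of _ _ u])
    show "z m \<otimes> u = z m" for m
    proof -
      have "g m \<in> carrier R" by (rule R.pa_carrierD(1)[OF g_closed])
      then have "u \<otimes> g m \<otimes> u = (u \<otimes> u) \<otimes> g m" by (simp add: R.m_ac)
      then show ?thesis by (simp add: z_def R.pa_smult u_u)
    qed
    have "u \<odot>\<^bsub>B\<^esub> z = (u \<otimes> u) \<odot>\<^bsub>B\<^esub> g" unfolding z_def by (simp add: B.smult_assoc1)
    then have "u \<odot>\<^bsub>B\<^esub> z = u \<odot>\<^bsub>B\<^esub> f i0" by (simp only: u_u g_def)
    then show "u \<odot>\<^bsub>B\<^esub> (f(i0 := z)) i = u \<odot>\<^bsub>B\<^esub> f i" for i by simp
  qed (auto simp: f_Pi)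
  with 1 show ?thesis by simp
qed

abbreviation "J' \<equiv> J - {i0}"

text \<open>Successive approximation: substituting an approximation \<open>t\<close> for \<open>z\<close> on the left of \<open>z_fixed\<close>
  gains one order of accuracy, because the monomials of \<open>z\<close> in \<open>i0\<close> alone are constant.\<close>

lemma z_approx: "\<exists>U\<in>carrier (poly_alg R J'). z \<ominus>\<^bsub>B\<^esub> peval R B f U \<in> F d"
proof (induction d)
  case 0
  have "(\<lambda>_. \<zero>) \<in> carrier (poly_alg R J')" by (rule R.pa_carrierI) auto
  then show ?case by (intro bexI[of _ "\<lambda>_. \<zero>"] R.pfilt_0) auto
next
  case (Suc d)
  then obtain U where U: "U \<in> carrier (poly_alg R J')" and d: "z \<ominus>\<^bsub>B\<^esub> peval R B f U \<in> F d" by blast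
  define t where "t = peval R B f U"
  have fJ': "f \<in> J' \<rightarrow> carrier B" by auto
  have t: "t \<in> carrier B" unfolding t_def using U fJ' by (rule B.peval_closed)
  interpret B': alg R "poly_alg R J'" by (rule R.pa_alg)
  \<comment> \<open>Putting \<open>U\<close> for the variable \<open>i0\<close> in \<open>z\<close>
    gives the next polynomial \<open>U'\<close>; its value at \<open>f\<close> is \<open>z\<close>
    evaluated with the old approximation \<open>t\<close> in place of \<open>z\<close>.\<close>
  define y' where "y' = R.indexed_var(i0 := U)"
  have y': "y' \<in> J \<rightarrow> carrier (poly_alg R J')" using U by (auto simp: y'_def)
  define U' where "U' = peval R (poly_alg R J') y' z"
  have "peval R B f U' = peval R B (\<lambda>i. peval R B f (y' i)) z"
    unfolding U'_def using fJ' y' by (intro peval_comp[OF R.pa_alg R.pa_alg] B.peval_alg_hom) auto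
  also have "\<dots> = peval R B (f(i0 := t)) z"
  proof (rule B.peval_cong[of _ J])
    show "peval R B f (y' i) = (f(i0 := t)) i" if "i \<in> J" for i
      using that by (auto simp: y'_def t_def f_closed intro!: B.peval_var)
  qed (use t in auto)
  finally have U't: "peval R B f U' = peval R B (f(i0 := t)) z" .
  have "peval R B (f(i0 := z)) z \<ominus>\<^bsub>B\<^esub> peval R B (f(i0 := t)) z \<in> F (Suc d)"
  proof (rule R.peval_diff_pfilt[OF z_closed])
    fix m
    assume nz: "z m \<noteq> \<zero>"
    then have mJ: "set_mset m \<subseteq> J" by (rule R.pa_carrierD(3)[OF z_closed])
    show "mpow B (f(i0 := z)) m \<ominus>\<^bsub>B\<^esub> mpow B (f(i0 := t)) m \<in> F (Suc d)"
    proof (cases "m = {#}")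
      case True
      then show ?thesis using R.pfilt_zero[of J] by (simp add: B.S.minus_eq B.S.r_neg) (simp add: R.pa_zero)
    next
      case False
      then have "\<not> set_mset m \<subseteq> {i0}" using nz z_pure by blast
      then have "filter_mset (\<lambda>i. i \<noteq> i0) m \<noteq> {#}" by auto
      \<comment> \<open>A nonconstant monomial of \<open>z\<close> involves a variable other than
        \<open>i0\<close>, so its value already has order at least 1; the error of order
        \<open>d\<close> is added to that.\<close>
      then have pos: "1 \<le> size (filter_mset (\<lambda>i. i \<noteq> i0) m)"
        by (metis One_nat_def Suc_leI nonempty_has_size)
      have "mpow B (f(i0 := z)) m \<ominus>\<^bsub>B\<^esub> mpow B (f(i0 := t)) m \<in> F (size (filter_mset (\<lambda>i. i \<noteq> i0) m) + d)"
      proof (rule R.mpow_diff_pfilt)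
        fix i
        assume "i \<in># m"
        then have i: "i \<in> J" using mJ by auto
        show "(f(i0 := z)) i \<in> F (if i \<noteq> i0 then 1 else 0)" "(f(i0 := t)) i \<in> F (if i \<noteq> i0 then 1 else 0)"
          using f_F[OF i] t by (auto intro: R.pfilt_0)
        show "(f(i0 := z)) i \<ominus>\<^bsub>B\<^esub> (f(i0 := t)) i \<in> F ((if i \<noteq> i0 then 1 else 0) + d)"
        proof (cases "i = i0")
          case True
          then show ?thesis using d by (simp add: t_def)
        next
          case False
          have "f i \<ominus>\<^bsub>B\<^esub> f i = \<zero>\<^bsub>B\<^esub>" using f_closed[OF i] by (simp add: B.S.minus_eq B.S.r_neg)
          then show ?thesis using False R.pfilt_zero[of J] by (simp add: R.pa_zero)
        qed
      qed
      then show ?thesis by (rule R.pfilt_mono) (use pos in simp)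
    qed
  qed (use t in auto)
  then have "z \<ominus>\<^bsub>B\<^esub> peval R B f U' \<in> F (Suc d)" by (simp only: z_fixed U't)
  moreover have "U' \<in> carrier (poly_alg R J')" unfolding U'_def using z_closed y' by (rule B'.peval_closed)
  ultimately show ?case by blast
qed

text \<open>Each monomial of \<open>U\<close> is sent to a single monomial, so dropping those
  monomials whose image has order at least \<open>d\<close> truncates the value exactly. This turns
  an approximation into an equality.\<close>

lemma truncate:
  assumes U: "U \<in> carrier (poly_alg R J')"
  shows "\<exists>U'\<in>carrier (poly_alg R J'). \<forall>m. peval R B f U' m =
    (if size (filter_mset (\<lambda>i. i \<noteq> i0) m) < d then peval R B f U m else \<zero>)"
  using U
proof (induction rule: R.pa_induct)
  case zero
  have "(\<lambda>_. \<zero>) \<in> carrier (poly_alg R J')" by (rule R.pa_carrierI) auto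
  then show ?case by (intro bexI[of _ "\<lambda>_. \<zero>"]) (auto simp: R.pa_zero)
next
  case (add k P)
  have fJ': "f \<in> J' \<rightarrow> carrier B" by auto
  let ?wt = "\<lambda>m. size (filter_mset (\<lambda>i. i \<noteq> i0) m)"
  interpret B': alg R "poly_alg R J'" by (rule R.pa_alg)
  obtain P' where P': "P' \<in> carrier (poly_alg R J')"
    and tr: "\<And>m. peval R B f P' m = (if ?wt m < d then peval R B f P m else \<zero>)"
    using add.IH by blast
  have k: "U k \<in> carrier R" "set_mset k \<subseteq> J'" using R.pa_carrierD[OF U] add(1) by auto
  have M: "pmonom R (U k) k \<in> carrier (poly_alg R J')" using k by auto
  \<comment> \<open>The exponent of the image of the monomial \<open>k\<close>.\<close>
  define k' where "k' = (\<Sum>i\<in>#k. add_mset i (replicate_mset (b i) i0))"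
  define c where "c = mpow R lam k"
  have lamk: "lam i \<in> carrier R" if "i \<in># k" for i using f_monomial(1)[of i] k that by auto
  have c: "c \<in> carrier R" unfolding c_def using lamk by auto
  have "mpow B f k = mpow B (\<lambda>i. pmonom R (lam i) (add_mset i (replicate_mset (b i) i0))) k"
  proof (rule B.S.mpow_cong)
    fix i
    assume "i \<in># k"
    then have i: "i \<in> J'" using k by auto
    from i show fi: "f i = pmonom R (lam i) (add_mset i (replicate_mset (b i) i0))" by (rule f_monomial)
    from i show "pmonom R (lam i) (add_mset i (replicate_mset (b i) i0)) \<in> carrier B"
      unfolding fi[symmetric] by auto
  qed
  also have "\<dots> = pmonom R c k'"
    unfolding c_def k'_def
  proof (rule R.mpow_pmonom)
    fix i
    assume i: "i \<in># k"
    then show "lam i \<in> carrier R" by (rule lamk)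
    from i k have "i \<in> J" by auto
    with i0 show "set_mset (add_mset i (replicate_mset (b i) i0)) \<subseteq> J" by (auto split: if_splits)
  qed
  finally have "peval R B f (pmonom R (U k) k) = U k \<odot>\<^bsub>B\<^esub> pmonom R c k'"
    using k fJ' by (subst B.peval_pmonom) auto
  then have ek: "peval R B f (pmonom R (U k) k) m = (if m = k' then U k \<otimes> c else \<zero>)" for m
    using k c by (simp add: R.pa_smult pmonom_def)
  have e1: "peval R B f (pmonom R (U k) k \<oplus>\<^bsub>poly_alg R J'\<^esub> Q) m
      = (if m = k' then U k \<otimes> c else \<zero>) \<oplus> peval R B f Q m"
    if "Q \<in> carrier (poly_alg R J')" for Q m
    using that M fJ' by (subst B.peval_add[of _ J']) (auto simp: R.pa_add ek)
  have cl: "peval R B f Q m \<in> carrier R" if "Q \<in> carrier (poly_alg R J')" for Q m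
    using R.pa_carrierD(1)[OF B.peval_closed[OF that fJ']] .
  show ?case
  proof (cases "?wt k' < d")
    case True
    show ?thesis
    proof (intro bexI[of _ "pmonom R (U k) k \<oplus>\<^bsub>poly_alg R J'\<^esub> P'"] allI)
      show "pmonom R (U k) k \<oplus>\<^bsub>poly_alg R J'\<^esub> P' \<in> carrier (poly_alg R J')" using M P' by simp
      show "peval R B f (pmonom R (U k) k \<oplus>\<^bsub>poly_alg R J'\<^esub> P') m
        = (if ?wt m < d then peval R B f (pmonom R (U k) k \<oplus>\<^bsub>poly_alg R J'\<^esub> P) m else \<zero>)" for m
        unfolding e1[OF P'] e1[OF add(2)] tr using True by auto
    qed
  next
    case False
    show ?thesis
    proof (intro bexI[of _ P'] allI P')
      show "peval R B f P' m
        = (if ?wt m < d then peval R B f (pmonom R (U k) k \<oplus>\<^bsub>poly_alg R J'\<^esub> P) m else \<zero>)" for m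
        unfolding e1[OF add(2)] tr using False cl[OF add(2)] by auto
    qed
  qed
qed

lemma z_generated: "\<exists>U\<in>carrier (poly_alg R J'). peval R B f U = z"
proof -
  let ?wt = "\<lambda>m. size (filter_mset (\<lambda>i. i \<noteq> i0) m)"
  have fin: "finite (?wt ` {m. z m \<noteq> \<zero>})" using R.pa_carrierD(2)[OF z_closed] by simp
  \<comment> \<open>For \<open>z = 0\<close> the maximum is taken over the empty set, and any value
    of \<open>D\<close> serves.\<close>
  define D where "D = Suc (Max (?wt ` {m. z m \<noteq> \<zero>}))"
  have D: "z m = \<zero>" if "\<not> ?wt m < D" for m
  proof (rule ccontr)
    assume "z m \<noteq> \<zero>"
    then have "?wt m \<le> Max (?wt ` {m. z m \<noteq> \<zero>})" using fin by (intro Max_ge) auto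
    then show False using that by (simp add: D_def)
  qed
  obtain U where U: "U \<in> carrier (poly_alg R J')" and d: "z \<ominus>\<^bsub>B\<^esub> peval R B f U \<in> F D"
    using z_approx by blast
  obtain U' where U': "U' \<in> carrier (poly_alg R J')"
    and tr: "\<And>m. peval R B f U' m = (if ?wt m < D then peval R B f U m else \<zero>)"
    using truncate[OF U] by blast
  have fJ': "f \<in> J' \<rightarrow> carrier B" by auto
  have cl: "peval R B f U \<in> carrier B" using U fJ' by (rule B.peval_closed)
  have "peval R B f U' m = z m" for m
  proof (cases "?wt m < D")
    case True
    then have "(z \<ominus>\<^bsub>B\<^esub> peval R B f U) m = \<zero>" by (rule R.pfiltD[OF d])
    then have "z m = peval R B f U m"
      using R.pa_carrierD(1)[OF cl] R.pa_carrierD(1)[OF z_closed]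
      by (simp add: R.pa_minus_coeff[OF z_closed cl])
    then show ?thesis using tr True by simp
  next
    case False
    then show ?thesis using tr D by simp
  qed
  then have "peval R B f U' = z" by (rule ext)
  with U' show ?thesis by blast
qed

section \<open>Generators of the retract and their relations\<close>

definition "w = y(i0 := e \<odot>\<^bsub>C\<^esub> y i0)"
text \<open>The equation lam = lam^2 mu makes lam mu an idempotent that generates the same ideal as
  lam.\<close>

definition "\<epsilon> i = (if i = i0 then e else if i \<in> J then lam i \<otimes> mu i else \<zero>)"

lemma w_Pi: "w \<in> J \<rightarrow> carrier C"
  using y i0 by (auto simp: w_def Pi_iff)

text \<open>The only generator that was changed splits as \<open>y i0\<close> = e y_i0 + u y_i0. The
  first summand is \<open>w i0\<close>. The second has image \<open>z\<close> under the injective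
  \<open>\<iota>\<close>, so it is a polynomial in the other generators.\<close>

lemma w_generates: "peval R C w ` carrier B = carrier C"
proof
  show "peval R C w ` carrier B \<subseteq> carrier C" using w_Pi by (auto intro: peval_closed)
  show "carrier C \<subseteq> peval R C w ` carrier B"
  proof
    fix x
    assume x: "x \<in> carrier C"
    obtain U where U: "U \<in> carrier (poly_alg R J')" and Uz: "peval R B f U = z"
      using z_generated by blast
    have UB: "U \<in> carrier B" using U by (rule R.pa_mono) auto
    have yJ': "y \<in> J' \<rightarrow> carrier C" using y by auto
    have yi0: "y i0 \<in> carrier C" using y i0 by auto
    have "\<iota> (peval R C y U) = z"
      using \<iota>_peval[OF yJ' U] Uz by (simp add: f_def[abs_def])
    moreover have "\<iota> (u \<odot>\<^bsub>C\<^esub> y i0) = z"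
      using alg_homD(5)[OF hom u_closed yi0] by (simp add: z_def g_def f_def)
    ultimately have yU: "peval R C y U = u \<odot>\<^bsub>C\<^esub> y i0"
      using peval_closed[OF U yJ'] yi0 by (intro \<iota>_inj) auto
    have "peval R C w U = peval R C y U"
      using U yJ' by (intro peval_cong[of _ J']) (auto simp: w_def)
    then have wU: "peval R C w U = u \<odot>\<^bsub>C\<^esub> y i0" by (simp add: yU)
    \<comment> \<open>The substitution that expresses \<open>y\<close> through \<open>w\<close>:
      evaluated at \<open>w\<close>, the entry at \<open>i0\<close> becomes e y_i0 + u y_i0.\<close>
    define s where "s = R.indexed_var(i0 := R.indexed_var i0 \<oplus>\<^bsub>B\<^esub> U)"
    have s: "s \<in> J \<rightarrow> carrier B"
      using UB i0 R.var_closed[of _ J] by (auto simp: s_def intro!: B.S.a_closed)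
    have ix: "\<iota> x \<in> carrier B" using x by (rule alg_homD(1)[OF hom])
    have whom: "peval R C w \<in> alg_hom R B C" using w_Pi by (rule peval_alg_hom)
    have "peval R C w (peval R B s (\<iota> x)) = peval R C (\<lambda>i. peval R C w (s i)) (\<iota> x)"
      by (rule peval_comp[OF R.pa_alg algC whom s ix])
    also have "\<dots> = peval R C y (\<iota> x)"
    proof (rule peval_cong[OF ix y])
      fix i
      assume i: "i \<in> J"
      show "peval R C w (s i) = y i"
      proof (cases "i = i0")
        case True
        have V: "R.indexed_var i0 \<in> carrier B" using i0 by auto
        have "peval R C w (s i) = peval R C w (R.indexed_var i0) \<oplus>\<^bsub>C\<^esub> peval R C w U"
          using True by (simp add: s_def peval_add[OF V UB w_Pi])
        also have "peval R C w (R.indexed_var i0) = e \<odot>\<^bsub>C\<^esub> y i0"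
          using yi0 by (subst peval_var) (auto simp: w_def)
        also have "e \<odot>\<^bsub>C\<^esub> y i0 \<oplus>\<^bsub>C\<^esub> peval R C w U = (e \<oplus> u) \<odot>\<^bsub>C\<^esub> y i0"
          using yi0 by (simp add: wU smult_l_distr)
        also have "\<dots> = y i" using yi0 True by (simp add: e_u)
        finally show ?thesis .
      next
        case False
        have "peval R C w (R.indexed_var i) = w i" using i w_Pi by (intro peval_var) auto
        then show ?thesis using False by (simp add: s_def w_def)
      qed
    qed
    also have "\<dots> = x" using x by (rule sect)
    finally show "x \<in> peval R C w ` carrier B"
      using B.peval_closed[OF ix s] by (metis imageI)
  qed
qed

lemma \<epsilon>_closed: "\<epsilon> i \<in> carrier R"
  using f_monomial(1,2)[of i] by (auto simp: \<epsilon>_def)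

lemma \<epsilon>_idem: "\<epsilon> i \<otimes> \<epsilon> i = \<epsilon> i"
proof (cases "i \<in> J'")
  case True
  note m = f_monomial[OF True]
  have "(lam i \<otimes> mu i) \<otimes> (lam i \<otimes> mu i) = (lam i \<otimes> (lam i \<otimes> mu i)) \<otimes> mu i"
    using m(1,2) by (simp add: R.m_ac)
  also have "\<dots> = lam i \<otimes> mu i" by (simp only: m(3)[symmetric])
  finally show ?thesis using True by (simp add: \<epsilon>_def)
next
  case False
  then show ?thesis by (auto simp: \<epsilon>_def g_pure(1))
qed

lemma \<epsilon>_w:
  assumes i: "i \<in> J"
  shows "\<epsilon> i \<odot>\<^bsub>C\<^esub> w i = w i"
proof (cases "i = i0")
  case True
  have "y i0 \<in> carrier C" using y i0 by auto
  then have "e \<odot>\<^bsub>C\<^esub> (e \<odot>\<^bsub>C\<^esub> y i0) = (e \<otimes> e) \<odot>\<^bsub>C\<^esub> y i0" by (simp add: smult_assoc1)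
  then show ?thesis using True by (simp add: \<epsilon>_def w_def g_pure(1))
next
  case False
  then have iJ: "i \<in> J'" using i by simp
  note m = f_monomial[OF iJ]
  have yi: "y i \<in> carrier C" using y i by auto
  have em: "lam i \<otimes> mu i \<in> carrier R" using m by simp
  have "\<iota> ((lam i \<otimes> mu i) \<odot>\<^bsub>C\<^esub> y i) = (lam i \<otimes> mu i) \<odot>\<^bsub>B\<^esub> f i"
    using alg_homD(5)[OF hom em yi] by (simp add: f_def)
  also have "\<dots> = pmonom R ((lam i \<otimes> mu i) \<otimes> lam i) (add_mset i (replicate_mset (b i) i0))"
    unfolding m(4) using em by (rule R.pmonom_smult)
  also have "(lam i \<otimes> mu i) \<otimes> lam i = lam i \<otimes> (lam i \<otimes> mu i)" using m(1,2) by (simp add: R.m_ac)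
  also have "\<dots> = lam i" by (rule m(3)[symmetric])
  also have "pmonom R (lam i) (add_mset i (replicate_mset (b i) i0)) = \<iota> (y i)"
    using m(4) by (simp add: f_def)
  finally have "(lam i \<otimes> mu i) \<odot>\<^bsub>C\<^esub> y i = y i"
    using yi em by (intro \<iota>_inj) auto
  then show ?thesis using False i by (simp add: \<epsilon>_def w_def)
qed

text \<open>To lowest order in the variables other than \<open>i0\<close>, the generators \<open>w\<close> are monomials whose
  products are pairwise distinct.\<close>

lemma w_independent:
  assumes P: "P \<in> carrier B" and P0: "peval R C w P = \<zero>\<^bsub>C\<^esub>"
  shows "P m \<otimes> mpow R \<epsilon> m = \<zero>"
proof -
  let ?wt = "\<lambda>m. size (filter_mset (\<lambda>i. i \<noteq> i0) m)"
  \<comment> \<open>In normal form the claim is \<open>Q = 0\<close>, and the value at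
    \<open>w\<close> is still zero.\<close>
  define Q where "Q = (\<lambda>m. P m \<otimes> mpow R \<epsilon> m)"
  define v where "v = f(i0 := e \<odot>\<^bsub>B\<^esub> g)"
  have v: "v \<in> J \<rightarrow> carrier B" by (auto simp: v_def)
  have wJ: "\<And>i. i \<in> J \<Longrightarrow> w i \<in> carrier C" using w_Pi by auto
  have Q: "Q \<in> carrier B" "peval R C w Q = peval R C w P"
    unfolding Q_def by (rule peval_mult_mpow[OF P \<epsilon>_closed wJ \<epsilon>_w]; assumption)+
  have "\<iota> (peval R C w Q) = peval R B (\<lambda>i. \<iota> (w i)) Q" by (rule \<iota>_peval[OF w_Pi Q(1)])
  also have "\<dots> = peval R B v Q"
  proof (rule B.peval_cong[OF Q(1) v])
    show "\<iota> (w i) = v i" if "i \<in> J" for i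
      using that y i0 alg_homD(5)[OF hom e_closed, of "y i0"] by (auto simp: w_def v_def f_def g_def)
  qed
  also have "peval R C w Q = \<zero>\<^bsub>C\<^esub>" using Q(2) P0 by simp
  also have "\<iota> \<zero>\<^bsub>C\<^esub> = \<zero>\<^bsub>B\<^esub>" using alg_hom_minus(1)[OF algC R.pa_alg hom] by auto
  finally have Qv: "peval R B v Q = \<zero>\<^bsub>B\<^esub>" by (rule sym)
  \<comment> \<open>\<open>v'\<close> replaces e g by its order-zero part, which is \<open>e\<close>
    times the variable \<open>i0\<close>, and agrees with \<open>v\<close> at all other
    indices.\<close>
  define \<kappa> where "\<kappa> i = (if i = i0 then e else lam i)" for i
  define \<mu> where "\<mu> i = (if i = i0 then {#i0#} else add_mset i (replicate_mset (b i) i0))" for i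
  define v' where "v' = (\<lambda>i. pmonom R (\<kappa> i) (\<mu> i))"
  have \<kappa>: "\<kappa> i \<in> carrier R" if "i \<in> J" for i using that f_monomial(1)[of i] by (auto simp: \<kappa>_def)
  have \<mu>: "set_mset (\<mu> i) \<subseteq> J" if "i \<in> J" for i using that i0 by (auto simp: \<mu>_def)
  have v': "v' \<in> J \<rightarrow> carrier B" using \<kappa> \<mu> by (auto simp: v'_def)
  \<comment> \<open>The exponent map adds copies of \<open>i0\<close> whose number depends only on
    the other variables of \<open>m\<close>. Those variables are left unchanged, so \<open>m\<close>
    can be recovered.\<close>
  define \<beta> where "\<beta> k = (\<Sum>i\<in>#k. b i)" for k
  have \<phi>: "(\<Sum>i\<in>#m. \<mu> i) = m + replicate_mset (\<beta> (filter_mset (\<lambda>i. i \<noteq> i0) m)) i0" for m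
  proof (induction m)
    case empty
    then show ?case by (simp add: \<beta>_def)
  next
    case (add i m)
    then show ?case
      by (cases "i = i0") (simp_all add: \<mu>_def \<beta>_def multiset_eq_iff)
  qed
  have fil: "filter_mset (\<lambda>i. i \<noteq> i0) (\<Sum>i\<in>#m. \<mu> i) = filter_mset (\<lambda>i. i \<noteq> i0) m" for m
    unfolding \<phi> by (auto simp: multiset_eq_iff)
  have inj: "inj_on (\<lambda>m. \<Sum>i\<in>#m. \<mu> i) {m. set_mset m \<subseteq> J}"
  proof (rule inj_onI)
    fix m m'
    assume eq: "(\<Sum>i\<in>#m. \<mu> i) = (\<Sum>i\<in>#m'. \<mu> i)"
    then have "filter_mset (\<lambda>i. i \<noteq> i0) m = filter_mset (\<lambda>i. i \<noteq> i0) m'" using fil by metis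
    with eq show "m = m'" unfolding \<phi> by simp
  qed
  \<comment> \<open>In order zero only the terms of \<open>g\<close> in \<open>i0\<close> alone
    matter: \<open>e\<close> kills the constant term, the linear coefficient is e e = e, and there
    are no higher terms.\<close>
  have diff0: "v i0 \<ominus>\<^bsub>B\<^esub> v' i0 \<in> F 1"
  proof (rule R.pfiltI)
    have c: "v i0 \<in> carrier B" "v' i0 \<in> carrier B" using v v' i0 by auto
    show "v i0 \<ominus>\<^bsub>B\<^esub> v' i0 \<in> carrier B" using c by simp
    fix m
    assume "?wt m < 1"
    then have m: "set_mset m \<subseteq> {i0}" by auto
    have vm: "v i0 m = e \<otimes> g m" by (simp add: v_def R.pa_smult)
    have v'm: "v' i0 m = (if m = {#i0#} then e else \<zero>)" by (simp add: v'_def \<kappa>_def \<mu>_def pmonom_def)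
    have mr: "m = replicate_mset (size m) i0" using m by (rule set_mset_subset_singletonD)
    consider "m = {#}" | "m = {#i0#}" | "2 \<le> size m"
    proof -
      have "size m = 0 \<or> size m = 1 \<or> 2 \<le> size m" by linarith
      then show thesis using that mr by (metis One_nat_def replicate_mset_0 replicate_mset_Suc)
    qed
    then have "v i0 m = v' i0 m"
    proof cases
      case 1
      then show ?thesis using vm v'm by (simp add: g_pure(2))
    next
      case 2
      then have "g m = e" by (simp add: e_def)
      then show ?thesis using vm v'm 2 by (simp add: g_pure(1))
    next
      case 3
      then have "m \<noteq> {#i0#}" by auto
      then show ?thesis using vm v'm g_pure(3)[OF m 3] by simp
    qed
    then show "(v i0 \<ominus>\<^bsub>B\<^esub> v' i0) m = \<zero>"
      using R.pa_carrierD(1)[OF c(2)] by (simp add: R.pa_minus_coeff[OF c] R.minus_eq R.r_neg)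
  qed
  have veq: "v i = v' i" if "i \<in> J'" for i
    using f_monomial(4)[OF that] that by (simp add: v_def v'_def \<kappa>_def \<mu>_def)
  have vF: "v i \<in> F (if i \<noteq> i0 then 1 else 0)" "v' i \<in> F (if i \<noteq> i0 then 1 else 0)"
    "v i \<ominus>\<^bsub>B\<^esub> v' i \<in> F ((if i \<noteq> i0 then 1 else 0) + 1)" if i: "i \<in> J" for i
  proof (atomize (full), cases "i = i0")
    case True
    then show "v i \<in> F (if i \<noteq> i0 then 1 else 0) \<and> v' i \<in> F (if i \<noteq> i0 then 1 else 0) \<and>
        v i \<ominus>\<^bsub>B\<^esub> v' i \<in> F ((if i \<noteq> i0 then 1 else 0) + 1)"
      using diff0 v v' i by (auto intro!: R.pfilt_0)
  next
    case False
    have "v i = f i" using False by (simp add: v_def)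
    moreover have "f i \<ominus>\<^bsub>B\<^esub> f i = \<zero>\<^bsub>B\<^esub>" using f_closed[OF i] by (simp add: B.S.minus_eq B.S.r_neg)
    moreover have "v' i = f i" using veq[of i] False i \<open>v i = f i\<close> by simp
    ultimately show "v i \<in> F (if i \<noteq> i0 then 1 else 0) \<and> v' i \<in> F (if i \<noteq> i0 then 1 else 0) \<and>
        v i \<ominus>\<^bsub>B\<^esub> v' i \<in> F ((if i \<noteq> i0 then 1 else 0) + 1)"
      using False f_F[OF i] R.pfilt_zero[of J] by (simp add: R.pa_zero)
  qed
  \<comment> \<open>If \<open>Q\<close> has order \<open>d\<close>, passing from \<open>v\<close> to
    \<open>v'\<close> changes its value only from order d + 1 on. The coefficients of order
    \<open>d\<close> are thus read off at the monomials \<open>v'\<close>.\<close>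
  have step: "Q \<in> F (Suc d)" if d: "Q \<in> F d" for d
  proof (rule R.pfiltI[OF Q(1)])
    fix m
    assume "?wt m < Suc d"
    then consider "?wt m < d" | "\<not> set_mset m \<subseteq> J" | "?wt m = d" "set_mset m \<subseteq> J"
      by (auto simp: less_Suc_eq)
    then show "Q m = \<zero>"
    proof cases
      case 1
      then show ?thesis by (rule R.pfiltD[OF d])
    next
      case 2
      then show ?thesis using R.pa_carrierD(3)[OF Q(1)] by blast
    next
      case 3
      have "peval R B v Q \<ominus>\<^bsub>B\<^esub> peval R B v' Q \<in> F (d + 1)"
      proof (rule R.peval_diff_pfilt[OF Q(1) v v'])
        fix k
        assume nz: "Q k \<noteq> \<zero>"
        then have kJ: "set_mset k \<subseteq> J" by (rule R.pa_carrierD(3)[OF Q(1)])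
        have "d \<le> ?wt k" using nz R.pfiltD[OF d, of k] by (meson linorder_not_less)
        moreover have "mpow B v k \<ominus>\<^bsub>B\<^esub> mpow B v' k \<in> F (?wt k + 1)"
          using kJ by (intro R.mpow_diff_pfilt vF) auto
        ultimately show "mpow B v k \<ominus>\<^bsub>B\<^esub> mpow B v' k \<in> F (d + 1)"
          using R.pfilt_mono[of _ J _ "?wt k + 1" "d + 1"] by simp
      qed
      moreover have "?wt (\<Sum>i\<in>#m. \<mu> i) < d + 1" using 3 fil by simp
      ultimately have "(peval R B v Q \<ominus>\<^bsub>B\<^esub> peval R B v' Q) (\<Sum>i\<in>#m. \<mu> i) = \<zero>" by (rule R.pfiltD)
      moreover have c: "peval R B v' Q \<in> carrier B" using Q(1) v' by (rule B.peval_closed)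
      ultimately have "peval R B v' Q (\<Sum>i\<in>#m. \<mu> i) = \<zero>"
        using R.pa_carrierD(1)[OF c] R.pa_minus_coeff[OF B.S.zero_closed c]
        by (simp add: Qv) (simp add: R.pa_zero R.minus_eq)
      moreover have "peval R B v' Q (\<Sum>i\<in>#m. \<mu> i) = Q m \<otimes> mpow R \<kappa> m"
        unfolding v'_def by (rule R.peval_pmonom_coeff[OF Q(1) \<kappa> \<mu> inj 3(2)])
      ultimately have Q\<kappa>: "Q m \<otimes> mpow R \<kappa> m = \<zero>" by simp
      \<comment> \<open>\<open>\<rho>\<close> completes \<open>\<kappa>\<close> to
        \<open>\<epsilon>\<close>: the missing factor is \<open>mu\<close>, and at \<open>i0\<close>
        it is one. Since \<open>Q m\<close> equals its multiple by
        \<open>mpow R \<epsilon> m\<close>, it vanishes together with its multiple by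
        \<open>mpow R \<kappa> m\<close>.\<close>
      define \<rho> where "\<rho> i = (if i = i0 then \<one> else mu i)" for i
      have \<rho>: "\<rho> i \<in> carrier R" if "i \<in> J" for i using that f_monomial(2)[of i] by (auto simp: \<rho>_def)
      have cm: "mpow R \<kappa> m \<in> carrier R" "mpow R \<rho> m \<in> carrier R" "mpow R \<epsilon> m \<in> carrier R"
        using \<kappa> \<rho> 3 by (auto intro!: R.mpow_closed \<epsilon>_closed)
      have "mpow R \<epsilon> m = mpow R (\<lambda>i. \<kappa> i \<otimes> \<rho> i) m"
      proof (rule R.mpow_cong)
        fix i
        assume "i \<in># m"
        then have i: "i \<in> J" using 3 by auto
        then show "\<epsilon> i = \<kappa> i \<otimes> \<rho> i" by (simp add: \<epsilon>_def \<kappa>_def \<rho>_def)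
        from i show "\<kappa> i \<otimes> \<rho> i \<in> carrier R" using \<kappa> \<rho> by simp
      qed
      also have "\<dots> = mpow R \<kappa> m \<otimes> mpow R \<rho> m" using \<kappa> \<rho> 3 by (intro R.mpow_multf) auto
      finally have \<epsilon>\<kappa>: "mpow R \<epsilon> m = mpow R \<kappa> m \<otimes> mpow R \<rho> m" .
      have \<epsilon>\<epsilon>: "mpow R \<epsilon> m \<otimes> mpow R \<epsilon> m = mpow R \<epsilon> m"
        using \<epsilon>_closed \<epsilon>_idem by (rule R.mpow_idem_fun)
      have Pm: "P m \<in> carrier R" using P by (rule R.pa_carrierD)
      have Qm: "Q m \<in> carrier R" using Q(1) by (rule R.pa_carrierD)
      have "Q m = Q m \<otimes> mpow R \<epsilon> m" unfolding Q_def using Pm cm by (simp add: R.m_assoc \<epsilon>\<epsilon>)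
      also have "\<dots> = (Q m \<otimes> mpow R \<kappa> m) \<otimes> mpow R \<rho> m" unfolding \<epsilon>\<kappa> using Qm cm by (simp add: R.m_assoc)
      finally show ?thesis using Q\<kappa> cm by simp
    qed
  qed
  have "Q \<in> F d" for d by (induction d) (use Q(1) step in \<open>auto intro: R.pfilt_0\<close>)
  then have "Q m = \<zero>" by (rule R.pfiltD[of _ _ _ "Suc (?wt m)"]) simp
  then show ?thesis by (simp add: Q_def)
qed

lemma idem_presentation: "idem_presentation R C J \<epsilon> w"
  unfolding idem_presentation_def
  using \<epsilon>_closed \<epsilon>_idem \<epsilon>_w w_Pi w_generates w_independent by auto

end

section \<open>Elimination of variables\<close>

context poly_retract
begin

text \<open>Evaluation at \<open>y\<close> sends \<open>f i\<close> back to \<open>y i\<close>, so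
  substituting \<open>f i\<close> for the variable \<open>i\<close> does not change values at
  \<open>y\<close>. As \<open>f i\<close> is free of that variable, the substitution lands in the
  smaller ring.\<close>

lemma eliminate:
  assumes i: "i \<in> J" and fi: "f i \<in> carrier (poly_alg R (J - {i}))"
  shows "poly_retract R C (J - {i}) y
    (\<lambda>x. peval R (poly_alg R (J - {i})) (R.indexed_var(i := f i)) (\<iota> x))"
proof -
  let ?B' = "poly_alg R (J - {i})"
  interpret B': alg R ?B' by (rule R.pa_alg)
  define s where "s = R.indexed_var(i := f i)"
  have s: "s \<in> J \<rightarrow> carrier ?B'"
    using fi by (auto simp: s_def intro!: R.var_closed)
  have y': "y \<in> J - {i} \<rightarrow> carrier C" using y by auto
  have "poly_retract R C (J - {i}) y (\<lambda>x. peval R ?B' s (\<iota> x))"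
  proof (intro poly_retract.intro algC poly_retract_axioms.intro y')
    show "(\<lambda>x. peval R ?B' s (\<iota> x)) \<in> alg_hom R C ?B'"
      by (rule alg_hom_comp[OF hom B'.peval_alg_hom[OF s]])
    fix x
    assume x: "x \<in> carrier C"
    then have ix: "\<iota> x \<in> carrier B" by (rule alg_homD(1)[OF hom])
    have "peval R C y (peval R ?B' s (\<iota> x)) = peval R C (\<lambda>j. peval R C y (s j)) (\<iota> x)"
      by (rule peval_comp[OF R.pa_alg algC peval_alg_hom[OF y'] s ix])
    also have "\<dots> = peval R C y (\<iota> x)"
    proof (rule peval_cong[OF ix y])
      fix j
      assume "j \<in> J"
      then have yj: "y j \<in> carrier C" using y by auto
      show "peval R C y (s j) = y j"
      proof (cases "j = i")
        case True
        then show ?thesis using sect[OF yj] by (simp add: s_def f_def)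
      next
        case False
        then show ?thesis using yj by (simp add: s_def peval_var)
      qed
    qed
    also have "\<dots> = x" using x by (rule sect)
    finally show "peval R C y (peval R ?B' s (\<iota> x)) = x" .
  qed
  then show ?thesis by (simp add: s_def)
qed

text \<open>Keeps the hypothesis of the induction alive: monomials substituted into a monomial give
  a monomial, possibly with coefficient zero.\<close>

lemma eliminate_monomial:
  assumes i: "i \<in> J" and fi: "f i = pmonom R d k" "d \<in> carrier R" "set_mset k \<subseteq> J - {i}"
    and c: "c \<in> carrier R" and m: "set_mset m \<subseteq> J"
  shows "\<exists>c'\<in>carrier R. \<exists>m'. set_mset m' \<subseteq> J - {i} \<and>
    peval R (poly_alg R (J - {i})) (R.indexed_var(i := f i)) (pmonom R c m) = pmonom R c' m'"
proof -
  let ?B' = "poly_alg R (J - {i})"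
  interpret B': alg R ?B' by (rule R.pa_alg)
  define \<kappa> where "\<kappa> j = (if j = i then d else \<one>)" for j
  define \<mu> where "\<mu> j = (if j = i then k else {#j#})" for j
  have s: "R.indexed_var(i := f i) = (\<lambda>j. pmonom R (\<kappa> j) (\<mu> j))"
    by (rule ext) (simp add: fi(1) \<kappa>_def \<mu>_def R.indexed_var_pmonom)
  have \<kappa>: "\<kappa> j \<in> carrier R" for j using fi by (simp add: \<kappa>_def)
  have \<mu>: "set_mset (\<mu> j) \<subseteq> J - {i}" if "j \<in># m" for j using that m fi by (auto simp: \<mu>_def)
  have "mpow ?B' (\<lambda>j. pmonom R (\<kappa> j) (\<mu> j)) m = pmonom R (mpow R \<kappa> m) (\<Sum>j\<in>#m. \<mu> j)"
    using \<kappa> \<mu> by (intro R.mpow_pmonom) auto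
  then have "peval R ?B' (R.indexed_var(i := f i)) (pmonom R c m)
      = c \<odot>\<^bsub>?B'\<^esub> pmonom R (mpow R \<kappa> m) (\<Sum>j\<in>#m. \<mu> j)"
    unfolding s using c \<kappa> \<mu> by (subst B'.peval_pmonom) auto
  also have "\<dots> = pmonom R (c \<otimes> mpow R \<kappa> m) (\<Sum>j\<in>#m. \<mu> j)" using c by (rule R.pmonom_smult)
  finally show ?thesis
    using c \<kappa> \<mu> by (intro bexI[of _ "c \<otimes> mpow R \<kappa> m"] exI[of _ "\<Sum>j\<in>#m. \<mu> j"]) auto
qed

text \<open>Covers \<open>n = 0\<close>, where there is no index to play the role of
  \<open>i0\<close>. Homomorphisms out of the polynomial ring are then determined on constants,
  which makes \<open>\<iota>\<close> inverse to evaluation.\<close>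

lemma idem_presentation_no_variables:
  assumes "J = {}"
  shows "idem_presentation R C J (\<lambda>_. \<zero>) w"
proof -
  have cong: "peval R C w P = peval R C y P" if "P \<in> carrier B" for P
    using that y assms by (intro peval_cong[of _ J]) auto
  have surj: "peval R C w ` carrier B = carrier C"
  proof
    show "peval R C w ` carrier B \<subseteq> carrier C" using cong y by (auto intro: peval_closed)
    show "carrier C \<subseteq> peval R C w ` carrier B"
    proof
      fix x
      assume x: "x \<in> carrier C"
      have "\<iota> x \<in> carrier B" using x by (rule alg_homD(1)[OF hom])
      moreover have "x = peval R C w (\<iota> x)" using cong[OF \<open>\<iota> x \<in> carrier B\<close>] sect[OF x] by simp
      ultimately show "x \<in> peval R C w ` carrier B" by blast
    qed
  qed
  have "P m \<otimes> mpow R (\<lambda>_. \<zero>) m = \<zero>" if P: "P \<in> carrier B" and P0: "peval R C w P = \<zero>\<^bsub>C\<^esub>" for P m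
  proof -
    have "P = peval R B f P"
      by (rule B.peval_unique[of "\<lambda>P. P" J]) (use P assms in \<open>auto simp: R.pa_incl\<close>)
    also have "\<dots> = \<iota> (peval R C y P)" using \<iota>_peval[OF y P] by (simp add: f_def[abs_def])
    also have "\<dots> = \<zero>\<^bsub>B\<^esub>" using P0 cong[OF P] alg_hom_minus(1)[OF algC R.pa_alg hom] by auto
    finally have "P m = \<zero>" by (simp add: R.pa_zero)
    moreover have "mpow R (\<lambda>_. \<zero>) m \<in> carrier R" by (rule R.mpow_closed) auto
    ultimately show ?thesis by simp
  qed
  then show ?thesis unfolding idem_presentation_def using surj assms by auto
qed

end

text \<open>Readmits eliminated variables with idempotent and generator zero, which keeps the
  original index set; they will correspond to zero summands.\<close>

lemma (in alg) idem_presentation_extend: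
  assumes pr: "idem_presentation R S J' \<epsilon> w" and sub: "J' \<subseteq> J"
  shows "idem_presentation R S J (\<lambda>i. if i \<in> J' then \<epsilon> i else \<zero>) (\<lambda>i. if i \<in> J' then w i else \<zero>\<^bsub>S\<^esub>)"
proof -
  define \<epsilon>' where "\<epsilon>' i = (if i \<in> J' then \<epsilon> i else \<zero>)" for i
  define w' where "w' i = (if i \<in> J' then w i else \<zero>\<^bsub>S\<^esub>)" for i
  note d = pr[unfolded idem_presentation_def]
  have \<epsilon>: "\<And>i. \<epsilon> i \<in> carrier R" "\<And>i. i \<in> J' \<Longrightarrow> \<epsilon> i \<otimes> \<epsilon> i = \<epsilon> i"
    and w: "\<And>i. i \<in> J' \<Longrightarrow> w i \<in> carrier S" "\<And>i. i \<in> J' \<Longrightarrow> \<epsilon> i \<odot>\<^bsub>S\<^esub> w i = w i"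
    and gen: "peval R S w ` carrier (poly_alg R J') = carrier S"
    and ind: "\<And>P m. P \<in> carrier (poly_alg R J') \<Longrightarrow> peval R S w P = \<zero>\<^bsub>S\<^esub> \<Longrightarrow> P m \<otimes> mpow R \<epsilon> m = \<zero>"
    using d by blast+
  have \<epsilon>': "\<epsilon>' i \<in> carrier R" "\<epsilon>' i \<otimes> \<epsilon>' i = \<epsilon>' i" for i using \<epsilon> by (auto simp: \<epsilon>'_def)
  have w': "w' i \<in> carrier S" "\<epsilon>' i \<odot>\<^bsub>S\<^esub> w' i = w' i" for i using w by (auto simp: w'_def \<epsilon>'_def)
  have w'Pi: "w' \<in> I \<rightarrow> carrier S" for I using w' by auto
  have cong: "peval R S w' P = peval R S w P" if "P \<in> carrier (poly_alg R J')" for P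
    using that w by (intro peval_cong[of _ J']) (auto simp: w'_def)
  have "peval R S w' ` carrier (poly_alg R J) = carrier S"
  proof
    show "peval R S w' ` carrier (poly_alg R J) \<subseteq> carrier S" using w'Pi by (auto intro: peval_closed)
    have "carrier S = peval R S w' ` carrier (poly_alg R J')" using gen cong by (auto simp: image_iff)
    also have "\<dots> \<subseteq> peval R S w' ` carrier (poly_alg R J)"
      using R.pa_mono[OF _ sub] by (intro image_mono subsetI)
    finally show "carrier S \<subseteq> peval R S w' ` carrier (poly_alg R J)" .
  qed
  moreover have "P m \<otimes> mpow R \<epsilon>' m = \<zero>"
    if P: "P \<in> carrier (poly_alg R J)" and P0: "peval R S w' P = \<zero>\<^bsub>S\<^esub>" for P m
  proof -
    \<comment> \<open>Weighting by the extended idempotents deletes all monomials with a readmitted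
      variable and preserves the value, so \<open>Q\<close> is a polynomial over
      \<open>J'\<close>.\<close>
    define Q where "Q = (\<lambda>m. P m \<otimes> mpow R \<epsilon>' m)"
    have Q: "Q \<in> carrier (poly_alg R J)" "peval R S w' Q = peval R S w' P"
      unfolding Q_def by (rule peval_mult_mpow[OF P \<epsilon>'(1) w'])+
    have z: "mpow R \<epsilon>' m = \<zero>" if "\<not> set_mset m \<subseteq> J'" for m
    proof -
      from that obtain i where "i \<in># m" "i \<notin> J'" by auto
      then show ?thesis using \<epsilon>' by (intro R.mpow_zero[of i]) (auto simp: \<epsilon>'_def)
    qed
    have eq: "mpow R \<epsilon>' m = mpow R \<epsilon> m" if "set_mset m \<subseteq> J'" for m
      using that \<epsilon> by (intro R.mpow_cong) (auto simp: \<epsilon>'_def)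
    have Q': "Q \<in> carrier (poly_alg R J')"
    proof (rule R.pa_carrierI)
      show "\<And>m. Q m \<in> carrier R" "finite {m. Q m \<noteq> \<zero>}" using R.pa_carrierD[OF Q(1)] by auto
      show "set_mset m \<subseteq> J'" if "Q m \<noteq> \<zero>" for m
      proof (rule ccontr)
        assume "\<not> set_mset m \<subseteq> J'"
        then have "Q m = \<zero>" using z R.pa_carrierD(1)[OF P] by (simp add: Q_def)
        with that show False by contradiction
      qed
    qed
    have "peval R S w Q = \<zero>\<^bsub>S\<^esub>" using cong[OF Q'] Q(2) P0 by simp
    then have Q0: "Q m \<otimes> mpow R \<epsilon> m = \<zero>" by (rule ind[OF Q'])
    show ?thesis
    proof (cases "set_mset m \<subseteq> J'")
      case True
      have e: "mpow R \<epsilon> m \<in> carrier R" "mpow R \<epsilon> m \<otimes> mpow R \<epsilon> m = mpow R \<epsilon> m"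
        using True \<epsilon> by (auto intro!: R.mpow_closed R.mpow_idem_fun)
      then have "Q m \<otimes> mpow R \<epsilon> m = P m \<otimes> mpow R \<epsilon> m"
        using R.pa_carrierD(1)[OF P] by (simp add: Q_def eq[OF True] R.m_assoc)
      with Q0 show ?thesis by (simp add: eq[OF True])
    next
      case False
      then show ?thesis using z R.pa_carrierD(1)[OF P] by simp
    qed
  qed
  ultimately have "idem_presentation R S J \<epsilon>' w'"
    unfolding idem_presentation_def using \<epsilon>' w' by blast
  then show ?thesis by (simp add: \<epsilon>'_def[abs_def] w'_def[abs_def])
qed

lemma poly_retract_presentation:
  fixes R :: "('a, 'r) ring_scheme" and C :: "('a, 'b, 'm) module_scheme"
  assumes "finite J" and "poly_retract R C J y \<iota>" and "i0 \<in> J"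
    and "\<And>i. i \<in> J - {i0} \<Longrightarrow> \<exists>c m. c \<in> carrier R \<and> set_mset m \<subseteq> J \<and> \<iota> (y i) = pmonom R c m"
  shows "\<exists>\<epsilon> w. idem_presentation R C J \<epsilon> w"
  using assms
proof (induction "card J" arbitrary: J \<iota> rule: less_induct)
  case less
  interpret poly_retract R C J y \<iota> by (rule less.prems(2))
  note mono = less.prems(4)
  show ?case
  proof (cases "\<exists>i\<in>J - {i0}. f i \<in> carrier (poly_alg R (J - {i}))")
    case True
    then obtain i where i: "i \<in> J - {i0}" and fi: "f i \<in> carrier (poly_alg R (J - {i}))" by blast
    let ?\<iota>' = "\<lambda>x. peval R (poly_alg R (J - {i})) (R.indexed_var(i := f i)) (\<iota> x)"
    obtain d k0 where d: "d \<in> carrier R" "f i = pmonom R d k0" using mono[OF i] by (auto simp: f_def)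
    \<comment> \<open>If \<open>f i\<close> is zero, the given exponent \<open>k0\<close> may still
      contain \<open>i\<close>; the empty exponent is taken instead.\<close>
    obtain k where k: "f i = pmonom R d k" "set_mset k \<subseteq> J - {i}"
    proof (cases "d = \<zero>\<^bsub>R\<^esub>")
      case True
      then have "f i = pmonom R d {#}" using d by (auto simp: pmonom_def)
      then show thesis using that by simp
    next
      case False
      then have "set_mset k0 \<subseteq> J - {i}"
        using d R.pa_carrierD(3)[OF fi, of k0] by (simp add: pmonom_def)
      then show thesis using that d by blast
    qed
    have iJ: "i \<in> J" using i by simp
    have "\<exists>\<epsilon> w. idem_presentation R C (J - {i}) \<epsilon> w"
    proof (rule less.hyps)
      show "card (J - {i}) < card J" using less.prems(1) iJ by (rule card_Diff1_less)
      show "poly_retract R C (J - {i}) y ?\<iota>'" using iJ fi by (rule eliminate)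
      show "i0 \<in> J - {i}" using i less.prems(3) by auto
      fix j
      assume "j \<in> J - {i} - {i0}"
      then have "j \<in> J - {i0}" by auto
      from mono[OF this] obtain c m where "c \<in> carrier R" "set_mset m \<subseteq> J" "\<iota> (y j) = pmonom R c m"
        by blast
      then show "\<exists>c m. c \<in> carrier R \<and> set_mset m \<subseteq> J - {i} \<and> ?\<iota>' (y j) = pmonom R c m"
        using eliminate_monomial[OF iJ k(1) d(1) k(2), of c m] by auto
    qed (use less.prems(1) in simp)
    then show ?thesis using idem_presentation_extend[of "J - {i}" _ _ J] by blast
  next
    case False
    \<comment> \<open>If the coefficient were zero or the exponent avoided \<open>i\<close>, the
      image would lie in the smaller ring and \<open>i\<close> could be eliminated.\<close>
    interpret reduced_retract R C J y \<iota> i0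
    proof
      show "i0 \<in> J" by (rule less.prems(3))
      fix i
      assume i: "i \<in> J - {i0}"
      obtain c m where c: "c \<in> carrier R" "set_mset m \<subseteq> J" "\<iota> (y i) = pmonom R c m"
        using mono[OF i] by blast
      have nc: "pmonom R c m \<notin> carrier (poly_alg R (J - {i}))" 
      proof -
        have "f i \<notin> carrier (poly_alg R (J - {i}))" using False i by blast
        then show ?thesis by (simp only: f_def c(3) not_False_eq_True)
      qed
      have "c \<noteq> \<zero>\<^bsub>R\<^esub>"
      proof
        assume "c = \<zero>\<^bsub>R\<^esub>"
        then have "pmonom R c m = pmonom R \<zero>\<^bsub>R\<^esub> {#}" by (auto simp: pmonom_def)
        moreover have "pmonom R \<zero>\<^bsub>R\<^esub> {#} \<in> carrier (poly_alg R (J - {i}))" by (rule R.pmonom_closed) auto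
        ultimately show False using nc by simp
      qed
      moreover have "i \<in># m"
      proof (rule ccontr)
        assume "i \<notin># m"
        then have "set_mset m \<subseteq> J - {i}" using c by auto
        then show False using nc R.pmonom_closed[OF c(1)] by blast
      qed
      ultimately show "\<exists>c m. c \<in> carrier R \<and> c \<noteq> \<zero>\<^bsub>R\<^esub> \<and> i \<in># m \<and> set_mset m \<subseteq> J \<and> \<iota> (y i) = pmonom R c m"
        using c by blast
    qed
    show ?thesis using idem_presentation by blast
  qed
qed

section \<open>From a retraction of a polynomial ring to a presentation by idempotents\<close>

lemma (in cring) retraction_image:
  assumes "retraction R (poly_alg R I) \<phi>"
  shows "alg R (image_alg \<phi> (poly_alg R I))"
    and "poly_retract R (image_alg \<phi> (poly_alg R I)) I (\<lambda>i. \<phi> (indexed_var i)) (\<lambda>P. P)"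
proof -
  let ?B = "poly_alg R I"
  let ?A = "image_alg \<phi> ?B"
  interpret B: alg R ?B by (rule pa_alg)
  have hom: "\<phi> \<in> alg_hom R ?B ?B" and idem: "\<And>x. x \<in> carrier ?B \<Longrightarrow> \<phi> (\<phi> x) = \<phi> x"
    using assms by (auto simp: retraction_def)
  interpret h: ring_hom_ring ?B ?B \<phi>
    using hom B.S.ring_axioms by (intro ring_hom_ringI2) (auto simp: alg_hom_def)
  have crA: "cring ?A" unfolding image_alg_def by (rule h.img_is_cring[OF B.S.is_cring])
  have sub: "carrier ?A \<subseteq> carrier ?B" by (auto simp: image_alg_def)
  have cA: "carrier ?A = \<phi> ` carrier ?B" by (simp add: image_alg_def)
  have ops: "x \<oplus>\<^bsub>?A\<^esub> x' = x \<oplus>\<^bsub>?B\<^esub> x'" "x \<otimes>\<^bsub>?A\<^esub> x' = x \<otimes>\<^bsub>?B\<^esub> x'" "\<one>\<^bsub>?A\<^esub> = \<one>\<^bsub>?B\<^esub>"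
    "r \<odot>\<^bsub>?A\<^esub> x = r \<odot>\<^bsub>?B\<^esub> x" for x x' r
    by (simp_all add: image_alg_def)
  have "algebra R ?A"
  proof (rule algebraI[OF is_cring crA])
    fix r x
    assume r: "r \<in> carrier R" and "x \<in> carrier ?A"
    then obtain x' where x': "x' \<in> carrier ?B" "x = \<phi> x'" by (auto simp: cA)
    then have "r \<odot>\<^bsub>?A\<^esub> x = \<phi> (r \<odot>\<^bsub>?B\<^esub> x')" using r by (simp add: ops alg_homD(5)[OF hom])
    then show "r \<odot>\<^bsub>?A\<^esub> x \<in> carrier ?A" using r x' by (simp add: cA)
  qed (use sub in \<open>auto simp: ops B.smult_l_distr B.smult_r_distr B.smult_assoc1 B.smult_assoc2 subset_iff\<close>)
  then show A: "alg R ?A" using is_cring crA by (intro alg.intro alg_axioms.intro)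
  interpret A: alg R ?A by (rule A)
  have incl: "(\<lambda>P. P) \<in> alg_hom R ?A ?B" by (rule alg_homI) (use sub in \<open>auto simp: ops\<close>)
  have y: "(\<lambda>i. \<phi> (indexed_var i)) \<in> I \<rightarrow> carrier ?A" by (auto simp: cA)
  \<comment> \<open>The section is the inclusion: evaluation at the images of the variables is
    \<open>\<phi>\<close>, which fixes its image.\<close>
  show "poly_retract R ?A I (\<lambda>i. \<phi> (indexed_var i)) (\<lambda>P. P)"
  proof (intro poly_retract.intro A poly_retract_axioms.intro y incl)
    fix P
    assume "P \<in> carrier ?A"
    then obtain P' where P': "P' \<in> carrier ?B" "P = \<phi> P'" by (auto simp: cA)
    then have P: "P \<in> carrier ?B" "\<phi> P = P" using idem by auto
    have "peval R ?A (\<lambda>i. \<phi> (indexed_var i)) P = peval R ?B (\<lambda>i. \<phi> (indexed_var i)) P"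
      using peval_comp[OF A pa_alg incl y P(1)] by simp
    also have "\<dots> = \<phi> P"
      using y sub hom P by (intro B.peval_unique[symmetric, of _ I]) auto
    finally show "peval R ?A (\<lambda>i. \<phi> (indexed_var i)) P = P" by (simp add: P)
  qed
qed

lemma (in cring) retraction_presentation:
  assumes "finite I" and \<phi>: "retraction R (poly_alg R I) \<phi>"
    and card: "card {i \<in> I. \<not> (\<phi> (indexed_var i) = \<zero>\<^bsub>poly_alg R I\<^esub> \<or>
                             is_monomial R I (\<phi> (indexed_var i)))} \<le> 1"
  shows "\<exists>\<epsilon> w. idem_presentation R (image_alg \<phi> (poly_alg R I)) I \<epsilon> w"
proof (cases "I = {}")
  case True
  then show ?thesis
    using poly_retract.idem_presentation_no_variables[OF retraction_image(2)[OF \<phi>]] by blast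
next
  case False
  define E where "E = {i \<in> I. \<not> (\<phi> (indexed_var i) = \<zero>\<^bsub>poly_alg R I\<^esub> \<or> is_monomial R I (\<phi> (indexed_var i)))}"
  have "finite E" using assms(1) by (simp add: E_def)
  \<comment> \<open>If there is no exceptional variable, any index may serve as
    \<open>i0\<close>.\<close>
  have "\<exists>i0\<in>I. E \<subseteq> {i0}"
  proof (cases "E = {}")
    case True
    then show ?thesis using False by auto
  next
    case ne: False
    then have "card E \<noteq> 0" using \<open>finite E\<close> by simp
    moreover have "card E \<le> 1" using card unfolding E_def .
    ultimately have "card E = 1" by linarith
    then obtain i0 where "E = {i0}" by (auto simp: card_1_singleton_iff)
    then show ?thesis by (auto simp: E_def)
  qed
  then obtain i0 where i0: "i0 \<in> I" "E \<subseteq> {i0}" by blast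
  show ?thesis
  proof (rule poly_retract_presentation[OF assms(1) retraction_image(2)[OF \<phi>] i0(1)])
    fix i
    assume "i \<in> I - {i0}"
    then have "i \<in> I" "i \<notin> E" using i0 by auto
    then consider "\<phi> (indexed_var i) = \<zero>\<^bsub>poly_alg R I\<^esub>" | "is_monomial R I (\<phi> (indexed_var i))"
      by (auto simp: E_def)
    then show "\<exists>c m. c \<in> carrier R \<and> set_mset m \<subseteq> I \<and> \<phi> (indexed_var i) = pmonom R c m"
    proof cases
      case 1
      then show ?thesis by (intro exI[of _ \<zero>] exI[of _ "{#}"]) (auto simp: pa_zero pmonom_def)
    next
      case 2
      then show ?thesis using assms(1) by (rule is_monomial_pmonom) blast
    qed
  qed
qed

section \<open>Ideals generated by an idempotent\<close>

definition idem_module :: "('a, 'r) ring_scheme \<Rightarrow> 'a \<Rightarrow> ('a, 'a) module"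
  where "idem_module R e = (regular_module R)\<lparr>carrier := (\<lambda>r. r \<otimes>\<^bsub>R\<^esub> e) ` carrier R\<rparr>"

context cring
begin

lemma idem_module_simps [simp]:
  "x \<oplus>\<^bsub>idem_module R e\<^esub> y = x \<oplus> y" "\<zero>\<^bsub>idem_module R e\<^esub> = \<zero>" "r \<odot>\<^bsub>idem_module R e\<^esub> x = r \<otimes> x"
  by (simp_all add: idem_module_def regular_module_def)

lemma idem_module_carrier:
  assumes "e \<in> carrier R" "e \<otimes> e = e"
  shows "x \<in> carrier (idem_module R e) \<longleftrightarrow> x \<in> carrier R \<and> e \<otimes> x = x"
proof
  assume "x \<in> carrier (idem_module R e)"
  then obtain r where "r \<in> carrier R" "x = r \<otimes> e" by (auto simp: idem_module_def)
  moreover have "e \<otimes> (r \<otimes> e) = r \<otimes> (e \<otimes> e)" using \<open>r \<in> carrier R\<close> assms(1) by (rule m_lcomm[OF assms(1)])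
  ultimately show "x \<in> carrier R \<and> e \<otimes> x = x" using assms by simp
next
  assume "x \<in> carrier R \<and> e \<otimes> x = x"
  then show "x \<in> carrier (idem_module R e)"
    using assms by (auto simp: idem_module_def m_comm intro!: image_eqI[of _ _ x])
qed

lemma idem_module_module:
  assumes e: "e \<in> carrier R" "e \<otimes> e = e"
  shows "module R (idem_module R e)"
proof (rule moduleI[OF is_cring])
  note c = idem_module_carrier[OF e]
  show "abelian_group (idem_module R e)"
  proof (rule abelian_groupI)
    fix x
    assume "x \<in> carrier (idem_module R e)"
    then have "x \<in> carrier R" "e \<otimes> x = x" by (auto simp: c)
    then show "\<exists>y\<in>carrier (idem_module R e). y \<oplus>\<^bsub>idem_module R e\<^esub> x = \<zero>\<^bsub>idem_module R e\<^esub>"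
      using e by (intro bexI[of _ "\<ominus> x"]) (auto simp: c l_neg r_minus)
  qed (use e in \<open>auto simp: c r_distr a_ac\<close>)
qed (use e in \<open>auto simp: idem_module_carrier[OF e] l_distr r_distr m_assoc m_lcomm\<close>)

lemma idem_module_cyclic:
  assumes e: "e \<in> carrier R" "e \<otimes> e = e"
  shows "cyclic_module R (idem_module R e)"
  unfolding cyclic_module_def
proof (intro conjI idem_module_module[OF e] bexI)
  show "e \<in> carrier (idem_module R e)" using e by (simp add: idem_module_carrier)
  show "carrier (idem_module R e) = (\<lambda>r. r \<odot>\<^bsub>idem_module R e\<^esub> e) ` carrier R"
    by (simp only: idem_module_simps) (simp add: idem_module_def)
qed

lemma free_module_simps:
  "carrier (free_module R {s}) = (\<lambda>a. \<lambda>i\<in>{s}. a) ` carrier R"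
  "(\<lambda>i\<in>{s}. a) \<oplus>\<^bsub>free_module R {s}\<^esub> (\<lambda>i\<in>{s}. b) = (\<lambda>i\<in>{s}. a \<oplus> b)"
  "\<zero>\<^bsub>free_module R {s}\<^esub> = (\<lambda>i\<in>{s}. \<zero>)"
  "r \<odot>\<^bsub>free_module R {s}\<^esub> (\<lambda>i\<in>{s}. a) = (\<lambda>i\<in>{s}. r \<otimes> a)"
proof -
  have "x \<in> (\<lambda>a. \<lambda>i\<in>{s}. a) ` carrier R" if "x \<in> {s} \<rightarrow>\<^sub>E carrier R" for x
  proof (rule image_eqI)
    show "x = (\<lambda>i\<in>{s}. x s)" using that by (intro extensionalityI[of _ "{s}"]) (auto simp: PiE_def)
    show "x s \<in> carrier R" using that by auto
  qed
  moreover have "(\<lambda>i\<in>{s}. a) \<in> {s} \<rightarrow>\<^sub>E carrier R" if "a \<in> carrier R" for a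
    using that by (simp add: restrict_PiE_iff)
  ultimately have "{s} \<rightarrow>\<^sub>E carrier R = (\<lambda>a. \<lambda>i\<in>{s}. a) ` carrier R" by blast
  then show "carrier (free_module R {s}) = (\<lambda>a. \<lambda>i\<in>{s}. a) ` carrier R"
    by (simp add: free_module_def direct_sum_def regular_module_def)
qed (auto simp: free_module_def direct_sum_def regular_module_def intro!: restrict_ext)

lemma restrict_singleton_eq_iff: "(\<lambda>i\<in>{s}. a) = (\<lambda>i\<in>{s}. b) \<longleftrightarrow> a = b"
  by (metis restrict_apply' singletonI)

lemma free_module_module: "module R (free_module R {s})"
proof (rule moduleI[OF is_cring])
  note c = free_module_simps restrict_singleton_eq_iff
  show "abelian_group (free_module R {s})"
  proof (rule abelian_groupI)
    fix x
    assume "x \<in> carrier (free_module R {s})"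
    then obtain a where a: "a \<in> carrier R" "x = (\<lambda>i\<in>{s}. a)" unfolding c by blast
    show "\<exists>y\<in>carrier (free_module R {s}). y \<oplus>\<^bsub>free_module R {s}\<^esub> x = \<zero>\<^bsub>free_module R {s}\<^esub>"
      using a by (intro bexI[of _ "\<lambda>i\<in>{s}. \<ominus> a"]) (simp_all add: c l_neg)
  qed (auto simp: c a_ac)
qed (auto simp: free_module_simps restrict_singleton_eq_iff l_distr r_distr m_assoc)

text \<open>The complement of e R in R is the annihilator of e, which is (1 - e) R. The free module
  of rank one is built on the basis \<open>{e}\<close> because bases are taken in the element type
  of the module.\<close>

lemma idem_module_projective:
  assumes e: "e \<in> carrier R" "e \<otimes> e = e"
  shows "projective_module R (idem_module R e)"
proof -
  let ?F = "free_module R {e}"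
  interpret F: module R ?F by (rule free_module_module)
  note c = free_module_simps restrict_singleton_eq_iff
  define h where "h a = (\<lambda>i\<in>{e}. a)" for a :: 'a
  have h: "carrier ?F = h ` carrier R" "h a \<oplus>\<^bsub>?F\<^esub> h b = h (a \<oplus> b)" "\<zero>\<^bsub>?F\<^esub> = h \<zero>"
    "r \<odot>\<^bsub>?F\<^esub> h a = h (r \<otimes> a)" "h a = h b \<longleftrightarrow> a = b" for a b r
    unfolding h_def by (simp_all only: c)
  define D where "D = {a \<in> carrier R. e \<otimes> a = a}"
  define D' where "D' = {a \<in> carrier R. e \<otimes> a = \<zero>}"
  have minv: "\<ominus>\<^bsub>?F\<^esub> x = (\<ominus> \<one>) \<odot>\<^bsub>?F\<^esub> x" if "x \<in> carrier ?F" for x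
    using that F.smult_l_minus[of \<one> x] by simp
  have sub: "submodule (h ` E) R ?F"
    if E: "E \<subseteq> carrier R" "\<zero> \<in> E" "\<And>a b. a \<in> E \<Longrightarrow> b \<in> E \<Longrightarrow> a \<oplus> b \<in> E"
      "\<And>r a. r \<in> carrier R \<Longrightarrow> a \<in> E \<Longrightarrow> r \<otimes> a \<in> E" for E
  proof (rule F.submoduleI)
    fix x
    assume x: "x \<in> h ` E"
    then have "x \<in> carrier ?F" using E(1) by (auto simp: h(1))
    then show "\<ominus>\<^bsub>?F\<^esub> x \<in> h ` E" using x E(4)[of "\<ominus> \<one>"] minv by (auto simp: h)
  qed (use E in \<open>auto simp: h\<close>)
  have sD: "submodule (h ` D) R ?F" "submodule (h ` D') R ?F"
    using e by (auto intro!: sub simp: D_def D'_def r_distr m_lcomm)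
  have sum: "h ` D <+>\<^bsub>?F\<^esub> h ` D' = carrier ?F"
  proof
    show "h ` D <+>\<^bsub>?F\<^esub> h ` D' \<subseteq> carrier ?F" by (auto simp: set_add_def' D_def D'_def h)
    show "carrier ?F \<subseteq> h ` D <+>\<^bsub>?F\<^esub> h ` D'"
    proof
      fix x
      assume "x \<in> carrier ?F"
      then obtain a where a: "a \<in> carrier R" "x = h a" by (auto simp: h)
      have ea: "e \<otimes> (e \<otimes> a) = e \<otimes> a" using e a by (simp add: m_assoc[symmetric])
      have "e \<otimes> a \<in> D" using e a ea by (simp add: D_def)
      moreover have "a \<ominus> e \<otimes> a \<in> D'"
        using e a ea by (simp add: D'_def minus_eq r_distr r_minus r_neg)
      moreover have "x = h (e \<otimes> a) \<oplus>\<^bsub>?F\<^esub> h (a \<ominus> e \<otimes> a)"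
        using e a minus_add_cancel[of a "e \<otimes> a"] by (simp add: h a_comm)
      ultimately show "x \<in> h ` D <+>\<^bsub>?F\<^esub> h ` D'" by (auto simp: set_add_def')
    qed
  qed
  have int: "h ` D \<inter> h ` D' = {\<zero>\<^bsub>?F\<^esub>}"
    using e by (auto simp: D_def D'_def h)
  have cD: "carrier (idem_module R e) = D" by (auto simp: idem_module_carrier[OF e] D_def)
  have "h \<in> module_hom R (idem_module R e) (?F\<lparr>carrier := h ` D\<rparr>)"
    by (auto simp: module_hom_def cD h)
  moreover have "bij_betw h (carrier (idem_module R e)) (h ` D)"
    by (auto simp: bij_betw_def inj_on_def cD h)
  ultimately have "module_isomorphic R (idem_module R e) (?F\<lparr>carrier := h ` D\<rparr>)"
    unfolding module_isomorphic_def by (intro bexI[of _ h]) simp_all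
  with sD sum int show ?thesis
    unfolding projective_module_def Let_def using idem_module_module[OF e] by blast
qed

end

section \<open>Symmetric algebras of direct sums\<close>

text \<open>Meant for maps into the quotient by an ideal, which is handled only as a ring there;
  agreement on constants replaces R-linearity.\<close>

lemma (in cring) pa_ring_hom_unique:
  assumes h: "h \<in> ring_hom (poly_alg R I) S" and k: "k \<in> ring_hom (poly_alg R I) S"
    and const: "\<And>c. c \<in> carrier R \<Longrightarrow> h (indexed_const c) = k (indexed_const c)"
    and var: "\<And>i. i \<in> I \<Longrightarrow> h (indexed_var i) = k (indexed_var i)"
    and P: "P \<in> carrier (poly_alg R I)"
  shows "h P = k P"
  using P
proof (induction rule: pa_carrier_induct)
  case (add P P')
  then show ?case by (simp add: ring_hom_add[OF h] ring_hom_add[OF k])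
next
  case (pmult P i)
  have "indexed_pmult P i = P \<otimes>\<^bsub>poly_alg R I\<^esub> indexed_var i"
    unfolding indexed_var_def using pa_carrierD[OF pmult(1)]
    by (subst pa_mult_pmult) (simp_all add: pa_mult_const, simp add: indexed_const_def)
  then show ?case using pmult var_closed[of i I]
    by (simp add: ring_hom_mult[OF h] ring_hom_mult[OF k] var)
qed (rule const)

text \<open>Let \<open>\<Psi>\<close> send the symbol [x] to the sum of the x_k w_k. It is onto
  because \<open>w\<close> generates, and it kills the defining relations because it is linear in x.
  Conversely, modulo the relations every [x] is the sum of the x_k t_k for fixed elements t_k, so
  each P is congruent to \<open>\<Theta> (ev P)\<close>, and the independence of \<open>w\<close>
  makes this zero whenever \<open>\<Psi> P\<close> is.\<close>

lemma (in alg) sym_alg_presentation: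
  assumes fin: "finite J" and pr: "idem_presentation R S J \<epsilon> w"
  shows "alg_isomorphic R S (sym_alg R (direct_sum J (\<lambda>k. idem_module R (\<epsilon> k))))"
proof -
  note d = pr[unfolded idem_presentation_def]
  have \<epsilon>: "\<And>i. \<epsilon> i \<in> carrier R" and \<epsilon>\<epsilon>: "\<And>i. i \<in> J \<Longrightarrow> \<epsilon> i \<otimes> \<epsilon> i = \<epsilon> i"
    and w: "\<And>i. i \<in> J \<Longrightarrow> w i \<in> carrier S" and \<epsilon>w: "\<And>i. i \<in> J \<Longrightarrow> \<epsilon> i \<odot>\<^bsub>S\<^esub> w i = w i"
    and gen: "peval R S w ` carrier (poly_alg R J) = carrier S"
    and ind: "\<And>P m. P \<in> carrier (poly_alg R J) \<Longrightarrow> peval R S w P = \<zero>\<^bsub>S\<^esub> \<Longrightarrow> P m \<otimes> mpow R \<epsilon> m = \<zero>"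
    using d by blast+
  have wPi: "w \<in> J \<rightarrow> carrier S" using w by auto
  define M where "M = direct_sum J (\<lambda>k. idem_module R (\<epsilon> k))"
  have cM: "x \<in> carrier M \<longleftrightarrow> x \<in> extensional J \<and> (\<forall>k\<in>J. x k \<in> carrier R \<and> \<epsilon> k \<otimes> x k = x k)" for x
    using fin by (auto simp: M_def direct_sum_def PiE_def Pi_def R.idem_module_carrier[OF \<epsilon> \<epsilon>\<epsilon>])
  have aM: "x \<oplus>\<^bsub>M\<^esub> x' = (\<lambda>k\<in>J. x k \<oplus> x' k)" and sM: "r \<odot>\<^bsub>M\<^esub> x = (\<lambda>k\<in>J. r \<otimes> x k)" for x x' r
    by (simp_all add: M_def direct_sum_def R.idem_module_simps)
  have aM_closed: "x \<oplus>\<^bsub>M\<^esub> x' \<in> carrier M" if "x \<in> carrier M" "x' \<in> carrier M" for x x'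
    using that \<epsilon> by (simp add: cM aM R.r_distr)
  have sM_closed: "r \<odot>\<^bsub>M\<^esub> x \<in> carrier M" if "r \<in> carrier R" "x \<in> carrier M" for r x
    using that \<epsilon> by (simp add: cM sM R.m_lcomm)
  define T where "T = poly_alg R (carrier M)"
  define B where "B = poly_alg R J"
  interpret T: alg R T unfolding T_def by (rule R.pa_alg)
  interpret B: alg R B unfolding B_def by (rule R.pa_alg)
  let ?g = "R.indexed_var"
  have g: "?g x \<in> carrier T" if "x \<in> carrier M" for x using that unfolding T_def by (rule R.var_closed)
  have V: "?g k \<in> carrier B" if "k \<in> J" for k using that unfolding B_def by (rule R.var_closed)
  define K where "K = genideal T (sym_relations R M)"
  have rel: "sym_relations R M \<subseteq> carrier T"
    unfolding sym_relations_def Let_def T_def[symmetric]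
    using g aM_closed sM_closed by auto
  have K: "ideal K T" unfolding K_def using rel by (rule T.S.genideal_ideal)
  have relK: "sym_relations R M \<subseteq> K" unfolding K_def using rel by (rule T.S.genideal_self)
  have rel_add: "?g (x \<oplus>\<^bsub>M\<^esub> x') \<ominus>\<^bsub>T\<^esub> (?g x \<oplus>\<^bsub>T\<^esub> ?g x') \<in> sym_relations R M"
    if "x \<in> carrier M" "x' \<in> carrier M" for x x'
    using that unfolding sym_relations_def Let_def T_def[symmetric] by blast
  have rel_smult: "?g (r \<odot>\<^bsub>M\<^esub> x) \<ominus>\<^bsub>T\<^esub> (r \<odot>\<^bsub>T\<^esub> ?g x) \<in> sym_relations R M"
    if "r \<in> carrier R" "x \<in> carrier M" for r x
    using that unfolding sym_relations_def Let_def T_def[symmetric] by blast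

  \<comment> \<open>The linear form with coefficient vector \<open>x\<close>; \<open>\<Psi>\<close>
    factors through the substitution of these forms for the symbols.\<close>
  define L where "L x = (\<Oplus>\<^bsub>B\<^esub>k\<in>J. x k \<odot>\<^bsub>B\<^esub> ?g k)" for x
  have LPi: "(\<lambda>k. x k \<odot>\<^bsub>B\<^esub> ?g k) \<in> J \<rightarrow> carrier B" if "x \<in> carrier M" for x
    using that V by (auto simp: cM)
  have L: "L x \<in> carrier B" if "x \<in> carrier M" for x
    unfolding L_def using LPi[OF that] by (rule B.S.finsum_closed)
  have L_add: "L (x \<oplus>\<^bsub>M\<^esub> x') = L x \<oplus>\<^bsub>B\<^esub> L x'" if "x \<in> carrier M" "x' \<in> carrier M" for x x'
  proof -
    have "L (x \<oplus>\<^bsub>M\<^esub> x') = (\<Oplus>\<^bsub>B\<^esub>k\<in>J. x k \<odot>\<^bsub>B\<^esub> ?g k \<oplus>\<^bsub>B\<^esub> x' k \<odot>\<^bsub>B\<^esub> ?g k)"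
      unfolding L_def using that V by (intro B.S.add.finprod_cong') (auto simp: aM cM B.smult_l_distr)
    also have "\<dots> = L x \<oplus>\<^bsub>B\<^esub> L x'"
      unfolding L_def using LPi[OF that(1)] LPi[OF that(2)] by (rule B.S.finsum_addf)
    finally show ?thesis .
  qed
  have L_smult: "L (r \<odot>\<^bsub>M\<^esub> x) = r \<odot>\<^bsub>B\<^esub> L x" if "r \<in> carrier R" "x \<in> carrier M" for r x
  proof -
    have "L (r \<odot>\<^bsub>M\<^esub> x) = (\<Oplus>\<^bsub>B\<^esub>k\<in>J. r \<odot>\<^bsub>B\<^esub> (x k \<odot>\<^bsub>B\<^esub> ?g k))"
      unfolding L_def using that V by (intro B.S.add.finprod_cong') (auto simp: sM cM B.smult_assoc1)
    also have "\<dots> = r \<odot>\<^bsub>B\<^esub> L x"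
      unfolding L_def using fin that(1) LPi[OF that(2)] by (rule B.finsum_smult_ldistr[symmetric])
    finally show ?thesis .
  qed
  have L_hom: "L \<in> carrier M \<rightarrow> carrier B" using L by auto
  define ev where "ev = peval R B L"
  have ev: "ev \<in> alg_hom R T B" unfolding ev_def T_def using L_hom by (rule B.peval_alg_hom)
  note evD = alg_homD[OF ev]
  have ev_g: "ev (?g x) = L x" if "x \<in> carrier M" for x unfolding ev_def using L[OF that] by (rule B.peval_var[of L])
  define \<Psi> where "\<Psi> P = peval R S w (ev P)" for P
  have wh: "peval R S w \<in> alg_hom R B S" unfolding B_def using wPi by (rule peval_alg_hom)
  have \<Psi>: "\<Psi> \<in> alg_hom R T S" unfolding \<Psi>_def[abs_def] by (rule alg_hom_comp[OF ev wh])
  note \<Psi>D = alg_homD[OF \<Psi>]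
  interpret h: ring_hom_ring T S \<Psi>
    using \<Psi> T.S.ring_axioms S.ring_axioms by (intro ring_hom_ringI2) (auto simp: alg_hom_def)

  \<comment> \<open>The generator of the summand with index \<open>a\<close>.\<close>
  define bas where "bas a = (\<lambda>k\<in>J. if k = a then \<epsilon> a else \<zero>)" for a
  have bas: "bas a \<in> carrier M" if "a \<in> J" for a
    using that \<epsilon> \<epsilon>\<epsilon> by (auto simp: cM bas_def)
  \<comment> \<open>In \<open>T\<close> the symbols satisfy no relations, so
    \<open>\<epsilon> a\<close> is inserted as a scalar. The scalar \<open>\<epsilon> a\<close> then
    fixes \<open>t a\<close> already in \<open>T\<close>, as \<open>peval_mult_mpow\<close>
    requires.\<close>
  define t where "t a = \<epsilon> a \<odot>\<^bsub>T\<^esub> ?g (bas a)" for a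
  have t: "t a \<in> carrier T" if "a \<in> J" for a unfolding t_def using \<epsilon> g[OF bas[OF that]] by (rule T.smult_closed)
  have \<epsilon>t: "\<epsilon> a \<odot>\<^bsub>T\<^esub> t a = t a" if "a \<in> J" for a
    unfolding t_def using \<epsilon> \<epsilon>\<epsilon>[OF that] g[OF bas[OF that]] by (simp add: T.smult_assoc1[symmetric])
  have tPi: "t \<in> J \<rightarrow> carrier T" using t by auto
  define \<Theta> where "\<Theta> = peval R T t"
  have \<Theta>: "\<Theta> \<in> alg_hom R B T" unfolding \<Theta>_def B_def using tPi by (rule T.peval_alg_hom)
  interpret \<Theta>: ring_hom_cring B T \<Theta>
    using \<Theta> B.S.is_cring T.S.is_cring
    by (auto simp: alg_hom_def ring_hom_cring_def ring_hom_cring_axioms_def)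
  have H: "(\<lambda>P. \<Theta> (ev P)) \<in> alg_hom R T T" by (rule alg_hom_comp[OF ev \<Theta>])
  have H_g: "\<Theta> (ev (?g x)) = (\<Oplus>\<^bsub>T\<^esub>k\<in>J. x k \<odot>\<^bsub>T\<^esub> t k)" if x: "x \<in> carrier M" for x
  proof -
    have "\<Theta> (ev (?g x)) = (\<Oplus>\<^bsub>T\<^esub>k\<in>J. (\<Theta> \<circ> (\<lambda>k. x k \<odot>\<^bsub>B\<^esub> ?g k)) k)"
      unfolding ev_g[OF x] L_def using LPi[OF x] by (rule \<Theta>.hom_finsum)
    also have "\<dots> = (\<Oplus>\<^bsub>T\<^esub>k\<in>J. x k \<odot>\<^bsub>T\<^esub> t k)"
    proof (rule T.S.add.finprod_cong')
      fix k
      assume k: "k \<in> J"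
      then have xk: "x k \<in> carrier R" using x by (simp add: cM)
      have "\<Theta> (x k \<odot>\<^bsub>B\<^esub> ?g k) = x k \<odot>\<^bsub>T\<^esub> \<Theta> (?g k)" using \<Theta> xk V[OF k] by (rule alg_homD(5))
      also have "\<Theta> (?g k) = t k" unfolding \<Theta>_def using t[OF k] by (rule T.peval_var[of t])
      finally show "(\<Theta> \<circ> (\<lambda>k. x k \<odot>\<^bsub>B\<^esub> ?g k)) k = x k \<odot>\<^bsub>T\<^esub> t k" by simp
    qed (use x t in \<open>auto simp: cM\<close>)
    finally show ?thesis .
  qed

  have surj: "\<Psi> ` carrier T = carrier S"
  proof
    show "\<Psi> ` carrier T \<subseteq> carrier S" using \<Psi>D(1) by auto
    show "carrier S \<subseteq> \<Psi> ` carrier T"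
    proof
      fix x
      assume "x \<in> carrier S"
      then obtain p where p: "p \<in> carrier B" "x = peval R S w p" using gen by (auto simp: B_def)
      have "\<Psi> (\<Theta> p) = peval R S (\<lambda>k. \<Psi> (t k)) p"
        unfolding \<Theta>_def using p(1) unfolding B_def
        by (intro peval_comp[OF T.alg_axioms alg_axioms \<Psi> tPi])
      also have "\<dots> = peval R S w p"
      proof (rule peval_cong[OF _ wPi])
        show "p \<in> carrier (poly_alg R J)" using p by (simp add: B_def)
        fix k
        assume k: "k \<in> J"
        have "L (bas k) = (\<Oplus>\<^bsub>B\<^esub>j\<in>J. if k = j then \<epsilon> j \<odot>\<^bsub>B\<^esub> ?g j else \<zero>\<^bsub>B\<^esub>)"
          unfolding L_def using \<epsilon> V by (intro B.S.add.finprod_cong') (auto simp: bas_def)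
        also have "\<dots> = \<epsilon> k \<odot>\<^bsub>B\<^esub> ?g k"
          using k fin \<epsilon> V by (intro B.S.add.finprod_singleton) auto
        finally have Lb: "L (bas k) = \<epsilon> k \<odot>\<^bsub>B\<^esub> ?g k" .
        have "\<Psi> (t k) = \<epsilon> k \<odot>\<^bsub>S\<^esub> \<Psi> (?g (bas k))"
          unfolding t_def using \<epsilon> g[OF bas[OF k]] by (rule \<Psi>D(5))
        also have "\<Psi> (?g (bas k)) = peval R S w (\<epsilon> k \<odot>\<^bsub>B\<^esub> ?g k)"
          unfolding \<Psi>_def ev_g[OF bas[OF k]] Lb ..
        also have "\<dots> = \<epsilon> k \<odot>\<^bsub>S\<^esub> peval R S w (?g k)" using wh \<epsilon> V[OF k] by (rule alg_homD(5))
        also have "peval R S w (?g k) = w k" using w[OF k] by (rule peval_var[of w])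
        finally show "\<Psi> (t k) = w k" using \<epsilon>w[OF k] by simp
      qed
      finally have "\<Psi> (\<Theta> p) = x" using p by simp
      moreover have "\<Theta> p \<in> carrier T" using p(1) by (rule alg_homD(1)[OF \<Theta>])
      ultimately show "x \<in> \<Psi> ` carrier T" by blast
    qed
  qed

  have ker: "a_kernel T S \<Psi> = K"
  proof
    have ev0: "ev P = \<zero>\<^bsub>B\<^esub>" if "P \<in> sym_relations R M" for P
    proof -
      have m: "ev (a \<ominus>\<^bsub>T\<^esub> b) = ev a \<ominus>\<^bsub>B\<^esub> ev b" if "a \<in> carrier T" "b \<in> carrier T" for a b
        using alg_hom_minus(2)[OF T.alg_axioms B.alg_axioms ev that] .
      have z: "a \<ominus>\<^bsub>B\<^esub> a = \<zero>\<^bsub>B\<^esub>" if "a \<in> carrier B" for a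
        using that by (simp add: B.S.minus_eq B.S.r_neg)
      from that consider
          x x' where "x \<in> carrier M" "x' \<in> carrier M" "P = ?g (x \<oplus>\<^bsub>M\<^esub> x') \<ominus>\<^bsub>T\<^esub> (?g x \<oplus>\<^bsub>T\<^esub> ?g x')"
        | r x where "r \<in> carrier R" "x \<in> carrier M" "P = ?g (r \<odot>\<^bsub>M\<^esub> x) \<ominus>\<^bsub>T\<^esub> (r \<odot>\<^bsub>T\<^esub> ?g x)"
        unfolding sym_relations_def Let_def T_def[symmetric] by blast
      then show ?thesis
      proof cases
        case 1
        then show ?thesis
          using g aM_closed L by (simp add: m evD(2) ev_g L_add z)
      next
        case 2
        then show ?thesis
          using g sM_closed L by (simp add: m evD(5) ev_g L_smult z)
      qed
    qed
    have "sym_relations R M \<subseteq> a_kernel T S \<Psi>"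
      using rel ev0 alg_hom_minus(1)[OF B.alg_axioms alg_axioms wh B.S.zero_closed B.S.zero_closed]
      by (auto simp: a_kernel_def' \<Psi>_def)
    then show "K \<subseteq> a_kernel T S \<Psi>"
      unfolding K_def by (rule T.S.genideal_minimal[OF h.kernel_is_ideal])
  next
    interpret K: ideal K T by (rule K)
    define q where "q = (\<lambda>P. K +>\<^bsub>T\<^esub> P)"
    have q: "q \<in> ring_hom T (T Quot K)" unfolding q_def by (rule K.rcos_ring_hom)
    interpret Q: ring "T Quot K" by (rule K.quotient_is_ring)
    interpret qh: ring_hom_ring T "T Quot K" q
      using q T.S.ring_axioms Q.ring_axioms by (intro ring_hom_ringI2)
    have qK: "q P = \<zero>\<^bsub>T Quot K\<^esub> \<longleftrightarrow> P \<in> K" if "P \<in> carrier T" for P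
    proof -
      have "K +>\<^bsub>T\<^esub> P = K \<longleftrightarrow> P \<in> K"
        using that K.a_rcos_self[OF that] T.S.a_coset_join2[OF that K.a_subgroup] by auto
      then show ?thesis by (simp add: q_def FactRing_def)
    qed
    have q_eq: "q P = q P'" if "P \<in> carrier T" "P' \<in> carrier T" "P \<ominus>\<^bsub>T\<^esub> P' \<in> K" for P P'
    proof -
      have "q P = q (P \<ominus>\<^bsub>T\<^esub> P' \<oplus>\<^bsub>T\<^esub> P')" using that by (simp add: T.S.minus_add_cancel)
      also have "\<dots> = q (P \<ominus>\<^bsub>T\<^esub> P') \<oplus>\<^bsub>T Quot K\<^esub> q P'" using that by (intro qh.hom_add) auto
      also have "q (P \<ominus>\<^bsub>T\<^esub> P') = \<zero>\<^bsub>T Quot K\<^esub>" using that by (subst qK) auto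
      finally show ?thesis using qh.hom_closed[OF that(2)] by simp
    qed
    have q_add: "q (?g (x \<oplus>\<^bsub>M\<^esub> x')) = q (?g x) \<oplus>\<^bsub>T Quot K\<^esub> q (?g x')"
      if "x \<in> carrier M" "x' \<in> carrier M" for x x'
    proof -
      have "q (?g (x \<oplus>\<^bsub>M\<^esub> x')) = q (?g x \<oplus>\<^bsub>T\<^esub> ?g x')"
        using that g aM_closed relK rel_add by (intro q_eq) auto
      then show ?thesis using that g by simp
    qed
    have q_smult: "q (?g (r \<odot>\<^bsub>M\<^esub> x)) = q (r \<odot>\<^bsub>T\<^esub> ?g x)" if "r \<in> carrier R" "x \<in> carrier M" for r x
      using that g sM_closed relK rel_smult by (intro q_eq) auto
    have q_g: "q (?g x) = q (\<Theta> (ev (?g x)))" if x: "x \<in> carrier M" for x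
    proof -
      \<comment> \<open>The vector is built up one coordinate at a time, since each relation handles
        a sum of two elements.\<close>
      define part where "part A = (\<lambda>k\<in>J. if k \<in> A then x k else \<zero>)" for A
      have xk: "x k \<in> carrier R" "\<epsilon> k \<otimes> x k = x k" if "k \<in> J" for k using x that by (auto simp: cM)
      have part: "part A \<in> carrier M" for A using xk \<epsilon> by (auto simp: cM part_def)
      have "q (?g (part A)) = q (\<Oplus>\<^bsub>T\<^esub>k\<in>A. x k \<odot>\<^bsub>T\<^esub> t k)" if "A \<subseteq> J" for A
        using finite_subset[OF that fin] that
      proof (induction A rule: finite_induct)
        case empty
        \<comment> \<open>The symbol of the zero vector is killed by the scalar relation with
          \<open>r = 0\<close>.\<close>
        have "part {} = \<zero> \<odot>\<^bsub>M\<^esub> x" using xk by (auto simp: part_def sM fun_eq_iff)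
        then show ?case using q_smult[OF R.zero_closed x] g[OF x] by simp
      next
        case (insert a A)
        then have a: "a \<in> J" and AJ: "A \<subseteq> J" by auto
        have Pi: "(\<lambda>k. x k \<odot>\<^bsub>T\<^esub> t k) \<in> A \<rightarrow> carrier T" using AJ xk t by auto
        have xa: "x a \<odot>\<^bsub>T\<^esub> t a \<in> carrier T" using a xk t by auto
        have "x a \<otimes> \<epsilon> a = x a" using xk[OF a] \<epsilon>[of a] by (simp add: R.m_comm)
        then have ta: "x a \<odot>\<^bsub>T\<^esub> ?g (bas a) = x a \<odot>\<^bsub>T\<^esub> t a"
          unfolding t_def using xk[OF a] \<epsilon> g[OF bas[OF a]] by (simp add: T.smult_assoc1[symmetric])
        have "part (insert a A) = part A \<oplus>\<^bsub>M\<^esub> (x a \<odot>\<^bsub>M\<^esub> bas a)"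
          using xk a insert.hyps(2) \<open>x a \<otimes> \<epsilon> a = x a\<close> by (auto simp: part_def aM sM bas_def fun_eq_iff)
        then have "q (?g (part (insert a A))) = q (?g (part A)) \<oplus>\<^bsub>T Quot K\<^esub> q (x a \<odot>\<^bsub>T\<^esub> ?g (bas a))"
          using part bas[OF a] xk[OF a] sM_closed by (simp add: q_add q_smult)
        also have "\<dots> = q ((\<Oplus>\<^bsub>T\<^esub>k\<in>A. x k \<odot>\<^bsub>T\<^esub> t k) \<oplus>\<^bsub>T\<^esub> x a \<odot>\<^bsub>T\<^esub> t a)"
          using insert.IH[OF AJ] Pi xa by (simp add: ta)
        also have "(\<Oplus>\<^bsub>T\<^esub>k\<in>A. x k \<odot>\<^bsub>T\<^esub> t k) \<oplus>\<^bsub>T\<^esub> x a \<odot>\<^bsub>T\<^esub> t a = (\<Oplus>\<^bsub>T\<^esub>k\<in>insert a A. x k \<odot>\<^bsub>T\<^esub> t k)"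
          using insert.hyps Pi xa by (simp add: T.S.a_comm)
        finally show ?case .
      qed
      from this[of J] have "q (?g (part J)) = q (\<Theta> (ev (?g x)))" by (simp add: H_g[OF x])
      moreover have "part J = x" using x by (auto simp: part_def cM extensional_def fun_eq_iff)
      ultimately show ?thesis by simp
    qed
    have qH: "q P = q (\<Theta> (ev P))" if P: "P \<in> carrier T" for P
    proof (rule R.pa_ring_hom_unique[of q "carrier M" "T Quot K" "\<lambda>P. q (\<Theta> (ev P))"])
      show "q \<in> ring_hom (poly_alg R (carrier M)) (T Quot K)" using q by (simp add: T_def)
      have "(\<lambda>P. \<Theta> (ev P)) \<in> ring_hom T T" using H by (simp add: alg_hom_def)
      from ring_hom_trans[OF this q] show "(\<lambda>P. q (\<Theta> (ev P))) \<in> ring_hom (poly_alg R (carrier M)) (T Quot K)"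
        by (simp add: T_def comp_def)
      fix c
      assume c: "c \<in> carrier R"
      have "R.indexed_const c = c \<odot>\<^bsub>T\<^esub> \<one>\<^bsub>T\<^esub>"
        using c by (auto simp: T_def R.pa_smult R.pa_one R.indexed_const_def pmonom_def)
      moreover have "\<Theta> (ev (c \<odot>\<^bsub>T\<^esub> \<one>\<^bsub>T\<^esub>)) = c \<odot>\<^bsub>T\<^esub> \<one>\<^bsub>T\<^esub>"
        using alg_homD(5)[OF H c T.S.one_closed] alg_homD(4)[OF H] by simp
      ultimately show "q (R.indexed_const c) = q (\<Theta> (ev (R.indexed_const c)))" by simp
    qed (use P q_g in \<open>auto simp: T_def\<close>)
    show "a_kernel T S \<Psi> \<subseteq> K"
    proof
      fix P
      assume "P \<in> a_kernel T S \<Psi>"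
      then have P: "P \<in> carrier T" and P0: "peval R S w (ev P) = \<zero>\<^bsub>S\<^esub>"
        by (auto simp: a_kernel_def' \<Psi>_def)
      have p: "ev P \<in> carrier (poly_alg R J)" using evD(1)[OF P] by (simp add: B_def)
      \<comment> \<open>Inserting the idempotents into the coefficients does not affect the value
        under \<open>\<Theta>\<close>, and independence of \<open>w\<close> says that the resulting
        polynomial is zero.\<close>
      have "\<Theta> (ev P) = \<Theta> (\<lambda>m. ev P m \<otimes> mpow R \<epsilon> m)"
        unfolding \<Theta>_def by (rule T.peval_mult_mpow(2)[OF p \<epsilon> t \<epsilon>t, symmetric])
      also have "(\<lambda>m. ev P m \<otimes> mpow R \<epsilon> m) = (\<lambda>_. \<zero>)" using ind[OF p P0] by auto
      also have "\<Theta> (\<lambda>_. \<zero>) = \<zero>\<^bsub>T\<^esub>" unfolding \<Theta>_def by (rule T.peval_zero)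
      finally have "q P = \<zero>\<^bsub>T Quot K\<^esub>" using qH[OF P] by simp
      then show "P \<in> K" using qK[OF P] by simp
    qed
  qed

  interpret K: ideal K T by (rule K)
  \<comment> \<open>The map of the first isomorphism theorem runs from the quotient to
    \<open>S\<close>. The isomorphism required here is its inverse, and R-linearity is checked for
    that.\<close>
  define G where "G = (\<lambda>Z. the_elem (\<Psi> ` Z))"
  define A where "A = quotient_alg T K"
  have G: "G \<in> ring_iso (T Quot K) S"
    using h.FactRing_iso_set[OF surj] by (simp add: ker G_def)
  have GK: "G (K +>\<^bsub>T\<^esub> P) = \<Psi> P" if "P \<in> carrier T" for P
    using h.the_elem_simp[OF that] by (simp add: ker G_def)
  have Aops: "carrier A = carrier (T Quot K)" "monoid.mult A = monoid.mult (T Quot K)"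
    "one A = one (T Quot K)" "add A = add (T Quot K)"
    "smult A = (\<lambda>r Z. \<Union>x\<in>Z. K +>\<^bsub>T\<^esub> (r \<odot>\<^bsub>T\<^esub> x))"
    by (simp_all add: A_def quotient_alg_def ring.defs module.defs)
  have cQ: "\<exists>P\<in>carrier T. Z = K +>\<^bsub>T\<^esub> P" if "Z \<in> carrier A" for Z
    using that by (auto simp: Aops FactRing_def A_RCOSETS_def')
  have Kc: "K +>\<^bsub>T\<^esub> P \<in> carrier A" if "P \<in> carrier T" for P
    using that by (auto simp: Aops FactRing_def A_RCOSETS_def')
  \<comment> \<open>The scalar multiple of a coset is a union over all representatives. They give
    the same coset, since \<open>K\<close> is closed under scalars: \<open>r\<close> acts as
    multiplication by the ring element r 1.\<close>
  have smultK: "r \<odot>\<^bsub>A\<^esub> (K +>\<^bsub>T\<^esub> P) = K +>\<^bsub>T\<^esub> (r \<odot>\<^bsub>T\<^esub> P)" if r: "r \<in> carrier R" and P: "P \<in> carrier T" for r P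
  proof -
    have "K +>\<^bsub>T\<^esub> (r \<odot>\<^bsub>T\<^esub> x) = K +>\<^bsub>T\<^esub> (r \<odot>\<^bsub>T\<^esub> P)" if x: "x \<in> K +>\<^bsub>T\<^esub> P" for x
    proof -
      obtain k where k: "k \<in> K" "x = k \<oplus>\<^bsub>T\<^esub> P" using x by (auto simp: a_r_coset_def')
      have kT: "k \<in> carrier T" using k by auto
      have rk: "r \<odot>\<^bsub>T\<^esub> k = (r \<odot>\<^bsub>T\<^esub> \<one>\<^bsub>T\<^esub>) \<otimes>\<^bsub>T\<^esub> k" using r kT by (simp add: T.smult_assoc2)
      have "r \<odot>\<^bsub>T\<^esub> k \<in> K" unfolding rk using k r by (intro K.I_l_closed) auto
      moreover have "r \<odot>\<^bsub>T\<^esub> x = r \<odot>\<^bsub>T\<^esub> k \<oplus>\<^bsub>T\<^esub> r \<odot>\<^bsub>T\<^esub> P" using r k kT P by (simp add: T.smult_r_distr)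
      ultimately have "r \<odot>\<^bsub>T\<^esub> x \<in> K +>\<^bsub>T\<^esub> (r \<odot>\<^bsub>T\<^esub> P)" by (auto simp: a_r_coset_def')
      then show ?thesis using r P by (intro K.a_repr_independence'[symmetric]) auto
    qed
    moreover have "K +>\<^bsub>T\<^esub> P \<noteq> {}" using K.a_rcos_self[OF P] by blast
    ultimately show ?thesis unfolding Aops(5) by (intro SUP_eq_const)
  qed
  define Gi where "Gi = inv_into (carrier (T Quot K)) G"
  have Gi: "Gi \<in> ring_iso S (T Quot K)"
    unfolding Gi_def by (rule ring_iso_set_sym[OF K.quotient_is_ring G])
  have inj: "inj_on G (carrier A)" and img: "G ` carrier A = carrier S"
    using G by (auto simp: ring_iso_def bij_betw_def Aops)
  have "Gi \<in> alg_hom R S A"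
  proof -
    have "Gi (r \<odot>\<^bsub>S\<^esub> x) = r \<odot>\<^bsub>A\<^esub> Gi x" if r: "r \<in> carrier R" and x: "x \<in> carrier S" for r x
    proof -
      obtain P where P: "P \<in> carrier T" "x = \<Psi> P" using surj x by auto
      have "Gi (\<Psi> P') = K +>\<^bsub>T\<^esub> P'" if "P' \<in> carrier T" for P'
        using inv_into_f_f[OF inj Kc[OF that]] GK[OF that] by (simp add: Gi_def Aops)
      then show ?thesis using P r \<Psi>D(5)[OF r P(1)] smultK[OF r P(1)] by (metis T.smult_closed)
    qed
    moreover have "Gi \<in> ring_hom S A"
      using Gi by (auto simp: ring_iso_def ring_hom_def Aops)
    ultimately show ?thesis by (simp add: alg_hom_def)
  qed
  moreover have "bij_betw Gi (carrier S) (carrier A)" using Gi by (auto simp: ring_iso_def Aops)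
  ultimately have "alg_isomorphic R S A" unfolding alg_isomorphic_def by blast
  then show ?thesis by (simp add: A_def sym_alg_def Let_def T_def K_def M_def)
qed

theorem corollary5p3:
  fixes R :: "('a, 'r) ring_scheme"
    and n :: nat
    and \<phi> :: "(nat multiset \<Rightarrow> 'a) \<Rightarrow> (nat multiset \<Rightarrow> 'a)"
  assumes "cring R"
    and "retraction R (poly_alg R {1..n}) \<phi>"
    and "card {i \<in> {1..n}. \<not> (\<phi> (ring.indexed_var R i) = \<zero>\<^bsub>poly_alg R {1..n}\<^esub> \<or>
                             is_monomial R {1..n} (\<phi> (ring.indexed_var R i)))} \<le> 1"
  shows "\<exists>M :: ('a, nat \<Rightarrow> 'a) module.
           (\<exists>m N. m \<le> n \<and>
              (\<forall>k\<in>{1..m}. cyclic_module R (N k) \<and> projective_module R (N k :: ('a, 'a) module)) \<and>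
              M = direct_sum {1..m} N) \<and>
           alg_isomorphic R (image_alg \<phi> (poly_alg R {1..n})) (sym_alg R M)"
proof -
  interpret R: cring R by fact
  obtain \<epsilon> w where pr: "idem_presentation R (image_alg \<phi> (poly_alg R {1..n})) {1..n} \<epsilon> w"
    using R.retraction_presentation[OF _ assms(2,3)] by auto
  then have \<epsilon>: "\<epsilon> k \<in> carrier R" "\<epsilon> k \<otimes>\<^bsub>R\<^esub> \<epsilon> k = \<epsilon> k" if "k \<in> {1..n}" for k
    using that by (auto simp: idem_presentation_def)
  show ?thesis
  proof (intro exI conjI)
    \<comment> \<open>Every variable contributes a summand, possibly the zero module, so
      \<open>m\<close> is taken to be \<open>n\<close>.\<close>
    show "n \<le> n" by simp
    show "\<forall>k\<in>{1..n}. cyclic_module R (idem_module R (\<epsilon> k)) \<and> projective_module R (idem_module R (\<epsilon> k))"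
      using \<epsilon> R.idem_module_cyclic R.idem_module_projective by blast
    show "alg_isomorphic R (image_alg \<phi> (poly_alg R {1..n}))
      (sym_alg R (direct_sum {1..n} (\<lambda>k. idem_module R (\<epsilon> k))))"
      using alg.sym_alg_presentation[OF R.retraction_image(1)[OF assms(2)] _ pr] by simp
  qed (rule refl)
qed

end
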